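(* Let $\mathrm{D}(\mathbb{Z})$ be the algebra of all distal functions on $\mathbb{Z}$ and $\mathbb{Z}\to\mathbb{Z}^{\mathrm{D}(\mathbb{Z})}$ the corresponding semigroup compactification. Then: (1) The semigroup compactification $\mathbb{Z}\to\mathbb{Z}^{\mathrm{D}(\mathbb{Z})}$ is not (equivalent to) an operator compactification. (2) The algebra $\mathrm{D}(\mathbb{Z})$ is not intro-generated. (3) $(\mathbb{Z},\mathbb{Z}^{\mathrm{D}(\mathbb{Z})})$ is a minimal distal cascade which does not admit faithful $E$-compatible affine compactifications. (4) The compact right topological group $\mathbb{Z}^{\mathrm{D}(\mathbb{Z})}$ does not admit faithful admissible representations on Banach spaces; that is, for no Banach space $V$ is there an admissible embedding of $\mathbb{Z}^{\mathrm{D}(\mathbb{Z})}$ into $\mathcal{E}(V)$.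
   Context: Spaces are Hausdorff, vector spaces real. Below $S$ is a semitopological monoid (e.g. the discrete group $\mathbb{Z}$) and $C(S)$ is the Banach algebra of bounded continuous functions. Cascade means $\mathbb{Z}$-system (compact space with the $\mathbb{Z}$-action generated by a homeomorphism). Distal functions: $\mathrm{D}(\mathbb{Z})\subset l_\infty(\mathbb{Z})$ is the set of all $f$ of the form $f(n)=F(T^nx_0)$, where $(X,T)$ is a compact distal $\mathbb{Z}$-system (for $x\ne y$ no net satisfies $\lim T^{n_i}x=\lim T^{n_i}y$), $x_0\in X$ and $F\in C(X)$. It is a closed unital translation invariant subalgebra. $\mathbb{Z}^{\mathrm{D}(\mathbb{Z})}$ is its Gelfand space (multiplicative functionals, weak$^*$ topology), and $\mathbb{Z}\to\mathbb{Z}^{\mathrm{D}(\mathbb{Z})}$ sends $n$ to evaluation at $n$; this is a right topological semigroup compactification (defined next), and $\mathbb{Z}^{\mathrm{D}(\mathbb{Z})}$ is a right topological group on which $\mathbb{Z}$ acts by left translations. A semigroup with topology is right topological if all right translations are continuous; $\Lambda(P)$ is the set of $a\in P$ whose left translation $x\mapsto ax$ is continuous; $P$ is admissible if right topological with $\Lambda(P)$ dense. A right topological semigroup compactification of $S$ is a continuous homomorphism $\gamma:S\to T$ with dense image into a compact right topological semigroup with $\gamma(S)\subset\Lambda(T)$. Two compactifications of $S$ are equivalent if there is a homeomorphism between them commuting with the maps from $S$. Operator compactification: let $h:S\to L(V)$ be a co-homomorphism ($h(st)=h(t)h(s)$, $h(e)=\mathrm{id}$) into the continuous linear operators on a locally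 convex space $V$, such that all functions $s\mapsto\psi(h(s)v)$ ($v\in V$, $\psi\in V^*$) are continuous and $h(S)$ is equicontinuous. The operator compactification induced by $h$ is $s\mapsto h(s)^*\in\overline{\{h(s)^*:s\in S\}}$, the closure being taken in the space of linear operators on $V^*$ with the topology of pointwise weak$^*$ convergence. Introversion: a unital subspace $F\subset C(S)$, invariant under $(L_sf)(x)=f(sx)$, is introverted if for all $f\in F$, $\varphi\in F^*$ the function $m(f,\varphi)(s)=\varphi(L_sf)$ belongs to $F$. A subalgebra $\mathcal{A}\subset C(S)$ is intro-generated if there is an introverted subspace $V\subset\mathcal{A}$ such that the smallest closed unital subalgebra of $C(S)$ containing $V$ is $\mathcal{A}$. Affine compactifications: the enveloping semigroup $E(X)$ of a compact $S$-system $X$ (separately continuous action) is the pointwise closure in $X^X$ of the translations. An affine $S$-compactification of $X$ is a continuous $S$-map $\alpha:X\to Q$, with $Q$ a compact convex subset of a locally convex space, with a separately continuous action of $S$ by affine maps and $Q=\overline{co}(\alpha(X))$. It is faithful if $\alpha$ is a topological embedding and $E$-compatible if the restriction homomorphism $E(Q)\to E(\overline{\alpha(X)})$ is injective. Admissible embeddings: for a Banach space $V$, $\mathcal{E}(V)$ is the closure of $\{T^*|_{B^*}: T:V\to V \text{ linear}, \|T\|\le1\}$ in $(B^* )^{B^*}$ ($B^*$ the weak$^*$ compact unit ball of $V^*$), a compact right topological admissible semigroup under composition. A continuous homomorphism $\alpha:P\to K$ of compact right topological admissible semigroups is admissible if there is a dense subsemigroup $S'$ of $\Lambda(P)$ with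 $\alpha(S')\subset\Lambda(K)$. *)

theory Defs
  imports "HOL-Analysis.Analysis"
begin

section \<open>Bounded continuous functions on a semitopological monoid\<close>

text \<open>
  The monoid \<open>S\<close> is written additively (without assuming commutativity), so that
  \<^typ>\<open>int\<close> is an instance.  The Banach algebra \<open>C(S)\<close> is
  \<^typ>\<open>'s \<Rightarrow>\<^sub>C real\<close> with the sup norm; \<open>l\<^sub>\<infinity>(\<int>)\<close> is
  \<^typ>\<open>int \<Rightarrow>\<^sub>C real\<close>, since \<^typ>\<open>int\<close> is discrete.
\<close>

class semitopological_monoid = monoid_add + t2_space +
  assumes open_left_translation_vimage: "open U \<Longrightarrow> open ((\<lambda>x. a + x) -` U)"
    and open_right_translation_vimage: "open U \<Longrightarrow> open ((\<lambda>x. x + a) -` U)"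

instance int :: semitopological_monoid
  by standard (simp_all add: open_discrete)

lemma continuous_left_translation:
  "continuous_on UNIV (\<lambda>x. (a :: 's::semitopological_monoid) + x)"
  by (simp add: continuous_on_open_vimage open_left_translation_vimage)

definition ltrans ::
    "'s::semitopological_monoid \<Rightarrow> ('s \<Rightarrow>\<^sub>C real) \<Rightarrow> ('s \<Rightarrow>\<^sub>C real)" where
  "ltrans s f = Bcontfun (\<lambda>x. apply_bcontfun f (s + x))"

lemma apply_ltrans [simp]: "apply_bcontfun (ltrans s f) x = apply_bcontfun f (s + x)"
proof -
  have "continuous_on UNIV (apply_bcontfun f \<circ> (\<lambda>x. s + x))"
    by (intro continuous_on_compose continuous_left_translation) simp
  moreover have "bounded (range (\<lambda>x. apply_bcontfun f (s + x)))"
    by (rule bounded_subset[OF bounded_apply_bcontfun[of f]]) auto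
  ultimately have "(\<lambda>x. apply_bcontfun f (s + x)) \<in> bcontfun"
    by (simp add: bcontfun_def o_def)
  then show ?thesis
    by (simp add: ltrans_def Bcontfun_inverse)
qed

definition bmult ::
    "('s::topological_space \<Rightarrow>\<^sub>C real) \<Rightarrow> ('s \<Rightarrow>\<^sub>C real) \<Rightarrow> ('s \<Rightarrow>\<^sub>C real)" where
  "bmult f g = Bcontfun (\<lambda>x. apply_bcontfun f x * apply_bcontfun g x)"

lemma apply_bmult [simp]:
  "apply_bcontfun (bmult f g) x = apply_bcontfun f x * apply_bcontfun g x"
proof -
  have "\<bar>apply_bcontfun f x * apply_bcontfun g x\<bar> \<le> norm f * norm g" for x
    using norm_bounded[of f x] norm_bounded[of g x] by (simp add: abs_mult mult_mono)
  then have "bounded (range (\<lambda>x. apply_bcontfun f x * apply_bcontfun g x))"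
    by (auto simp: bounded_iff)
  then have "(\<lambda>x. apply_bcontfun f x * apply_bcontfun g x) \<in> bcontfun"
    by (simp add: bcontfun_def continuous_on_mult)
  then show ?thesis
    by (simp add: bmult_def Bcontfun_inverse)
qed

definition unital_subspace :: "('s::topological_space \<Rightarrow>\<^sub>C real) set \<Rightarrow> bool" where
  "unital_subspace F \<longleftrightarrow> subspace F \<and> const_bcontfun 1 \<in> F"

definition closed_unital_subalgebra :: "('s::topological_space \<Rightarrow>\<^sub>C real) set \<Rightarrow> bool" where
  "closed_unital_subalgebra A \<longleftrightarrow>
     unital_subspace A \<and> (\<forall>f\<in>A. \<forall>g\<in>A. bmult f g \<in> A) \<and> closed A"

text \<open>
  The dual of a linear subspace \<open>F\<close> of a normed space.  Functionals are functions on \<open>F\<close>, made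
  unique by the value \<^const>\<open>undefined\<close> outside \<open>F\<close>.
\<close>

definition dual_on :: "'a::real_normed_vector set \<Rightarrow> ('a \<Rightarrow> real) set" where
  "dual_on F = {\<phi> \<in> extensional F.
     (\<forall>f\<in>F. \<forall>g\<in>F. \<phi> (f + g) = \<phi> f + \<phi> g) \<and>
     (\<forall>c. \<forall>f\<in>F. \<phi> (c *\<^sub>R f) = c * \<phi> f) \<and>
     (\<exists>K. \<forall>f\<in>F. \<bar>\<phi> f\<bar> \<le> K * norm f)}"

text \<open>In \<open>introverted\<close>, the function \<open>\<lambda>s. \<phi> (ltrans s f)\<close> is \<open>m(f,\<phi>)\<close>.\<close>

definition introverted :: "('s::semitopological_monoid \<Rightarrow>\<^sub>C real) set \<Rightarrow> bool" where
  "introverted F \<longleftrightarrow>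
     unital_subspace F \<and>
     (\<forall>s. \<forall>f\<in>F. ltrans s f \<in> F) \<and>
     (\<forall>f\<in>F. \<forall>\<phi>\<in>dual_on F. (\<lambda>s. \<phi> (ltrans s f)) \<in> apply_bcontfun ` F)"

definition intro_generated :: "('s::semitopological_monoid \<Rightarrow>\<^sub>C real) set \<Rightarrow> bool" where
  "intro_generated A \<longleftrightarrow>
     (\<exists>V. introverted V \<and> V \<subseteq> A \<and> closed_unital_subalgebra hull V = A)"


section \<open>The Gelfand space of an algebra and its compactification\<close>

text \<open>
  The topology on the functionals is that of pointwise convergence on \<open>A\<close>, that is, the
  weak-star topology.
\<close>

definition gelfand_space ::
    "('s::topological_space \<Rightarrow>\<^sub>C real) set \<Rightarrow> (('s \<Rightarrow>\<^sub>C real) \<Rightarrow> real) topology" where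
  "gelfand_space A = subtopology (powertop_real A)
     {\<phi> \<in> dual_on A. \<phi> (const_bcontfun 1) = 1 \<and>
        (\<forall>f\<in>A. \<forall>g\<in>A. \<phi> (bmult f g) = \<phi> f * \<phi> g)}"

definition gelfand_eval ::
    "('s::topological_space \<Rightarrow>\<^sub>C real) set \<Rightarrow> 's \<Rightarrow> ('s \<Rightarrow>\<^sub>C real) \<Rightarrow> real" where
  "gelfand_eval A s = restrict (\<lambda>f. apply_bcontfun f s) A"

text \<open>
  The product \<open>(\<phi> \<psi>)(f) = \<phi> (m(f,\<psi>))\<close>.  It is the one that makes right translations continuous
  and \<^const>\<open>gelfand_eval\<close> a homomorphism; in particular left translation by
  \<^term>\<open>gelfand_eval A s\<close> sends \<open>\<psi>\<close> to \<open>f \<mapsto> \<psi> (ltrans s f)\<close>.  It is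
  meaningful when every \<open>m(f,\<psi>)\<close> belongs to \<open>A\<close>, as is the case for the distal functions.
\<close>

definition gelfand_mult ::
    "('s::semitopological_monoid \<Rightarrow>\<^sub>C real) set \<Rightarrow> (('s \<Rightarrow>\<^sub>C real) \<Rightarrow> real) \<Rightarrow>
     (('s \<Rightarrow>\<^sub>C real) \<Rightarrow> real) \<Rightarrow> ('s \<Rightarrow>\<^sub>C real) \<Rightarrow> real" where
  "gelfand_mult A \<phi> \<psi> = restrict (\<lambda>f. \<phi> (Bcontfun (\<lambda>s. \<psi> (ltrans s f)))) A"

definition gelfand_action ::
    "('s::semitopological_monoid \<Rightarrow>\<^sub>C real) set \<Rightarrow> 's \<Rightarrow>
     (('s \<Rightarrow>\<^sub>C real) \<Rightarrow> real) \<Rightarrow> ('s \<Rightarrow>\<^sub>C real) \<Rightarrow> real" where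
  "gelfand_action A s = gelfand_mult A (gelfand_eval A s)"

definition compactification_equiv ::
    "'a topology \<Rightarrow> ('s \<Rightarrow> 'a) \<Rightarrow> 'b topology \<Rightarrow> ('s \<Rightarrow> 'b) \<Rightarrow> bool" where
  "compactification_equiv X \<gamma> Y \<delta> \<longleftrightarrow>
     (\<exists>\<theta>. homeomorphic_map X Y \<theta> \<and> (\<forall>s. \<theta> (\<gamma> s) = \<delta> s))"


section \<open>Dynamical systems\<close>

definition action_on :: "'x set \<Rightarrow> ('s::monoid_add \<Rightarrow> 'x \<Rightarrow> 'x) \<Rightarrow> bool" where
  "action_on M a \<longleftrightarrow>
     (\<forall>s. a s \<in> M \<rightarrow> M) \<and>
     (\<forall>x\<in>M. a 0 x = x) \<and>
     (\<forall>s t. \<forall>x\<in>M. a (s + t) x = a s (a t x))"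

definition separately_continuous_action ::
    "'x topology \<Rightarrow> ('s::{monoid_add,topological_space} \<Rightarrow> 'x \<Rightarrow> 'x) \<Rightarrow> bool" where
  "separately_continuous_action X a \<longleftrightarrow>
     action_on (topspace X) a \<and>
     (\<forall>s. continuous_map X X (a s)) \<and>
     (\<forall>x\<in>topspace X. continuous_map euclidean X (\<lambda>s. a s x))"

text \<open>
  For \<open>S = \<int>\<close> these are exactly the cascades: the continuity of orbit maps is void, and
  \<open>a n\<close> is the \<open>n\<close>-th iterate of the homeomorphism \<open>a 1\<close>, whose inverse is \<open>a (-1)\<close>.
\<close>

definition compact_system ::
    "'x topology \<Rightarrow> ('s::semitopological_monoid \<Rightarrow> 'x \<Rightarrow> 'x) \<Rightarrow> bool" where
  "compact_system X a \<longleftrightarrow>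
     compact_space X \<and> Hausdorff_space X \<and> separately_continuous_action X a"

text \<open>
  Nets in \<open>S\<close> are replaced by the proper filters they generate; a net converges along \<open>a\<close>
  if and only if its filter does, and every proper filter comes from a net.
\<close>

definition distal_system :: "'x topology \<Rightarrow> ('s \<Rightarrow> 'x \<Rightarrow> 'x) \<Rightarrow> bool" where
  "distal_system X a \<longleftrightarrow>
     (\<forall>x\<in>topspace X. \<forall>y\<in>topspace X. x \<noteq> y \<longrightarrow>
        \<not> (\<exists>F z. F \<noteq> bot \<and> limitin X (\<lambda>s. a s x) z F \<and> limitin X (\<lambda>s. a s y) z F))"

definition minimal_system :: "'x topology \<Rightarrow> ('s \<Rightarrow> 'x \<Rightarrow> 'x) \<Rightarrow> bool" where
  "minimal_system X a \<longleftrightarrow>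
     topspace X \<noteq> {} \<and>
     (\<forall>C. closedin X C \<and> C \<noteq> {} \<and> (\<forall>s. a s ` C \<subseteq> C) \<longrightarrow> C = topspace X)"

definition enveloping_semigroup :: "'x topology \<Rightarrow> ('s \<Rightarrow> 'x \<Rightarrow> 'x) \<Rightarrow> ('x \<Rightarrow> 'x) set" where
  "enveloping_semigroup X a =
     product_topology (\<lambda>_. X) (topspace X) closure_of range (\<lambda>s. restrict (a s) (topspace X))"


section \<open>Distal functions on the integers\<close>

text \<open>
  HOL cannot quantify over types inside a definition, so the points of the system are taken from
  the type \<^typ>\<open>int set set\<close>.  This is no restriction: only the orbit closure of the base
  point matters, and it has at most \<open>2^(2^\<aleph>\<^sub>0)\<close> points.  The theorem below is the proof.
\<close>

definition distal_functions :: "(int \<Rightarrow>\<^sub>C real) set" where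
  "distal_functions =
     {f. \<exists>(X :: int set set topology) a x0 F.
           compact_system X a \<and> distal_system X a \<and> x0 \<in> topspace X \<and>
           continuous_map X euclideanreal F \<and>
           (\<forall>n. apply_bcontfun f n = F (a n x0))}"

theorem distal_functions_any_carrier:
  fixes X :: "'x topology" and a :: "int \<Rightarrow> 'x \<Rightarrow> 'x"
  assumes X: "compact_system X a" "distal_system X a"
    and x0: "x0 \<in> topspace X"
    and F: "continuous_map X euclideanreal F"
    and f: "\<And>n. apply_bcontfun f n = F (a n x0)"
  shows "f \<in> distal_functions"
proof -
  let ?orb = "\<lambda>n. a n x0"
  define Y where "Y = X closure_of (range ?orb)"
  define e :: "'x \<Rightarrow> int set set" where "e y = {A. y \<in> X closure_of (?orb ` A)}" for y
  have comp: "compact_space X" and haus: "Hausdorff_space X"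
    and cont: "\<And>n. continuous_map X X (a n)"
    and act: "action_on (topspace X) a"
    using X by (auto simp: compact_system_def separately_continuous_action_def)
  have aX: "a n x \<in> topspace X" if "x \<in> topspace X" for n x
    using act that by (auto simp: action_on_def)
  have orb: "range ?orb \<subseteq> topspace X"
    using aX x0 by auto
  have YX: "Y \<subseteq> topspace X"
    by (simp add: Y_def closure_of_subset_topspace)
  have orbY: "?orb n \<in> Y" for n
    unfolding Y_def using closure_of_subset[OF orb] by auto
  have x0Y: "x0 \<in> Y"
    using orbY[of 0] act x0 by (simp add: action_on_def)
  have aY: "a n y \<in> Y" if "y \<in> Y" for n y
  proof -
    have "a n ` range ?orb \<subseteq> range ?orb"
    proof clarify
      fix m
      have "a n (a m x0) = a (n + m) x0"
        using act x0 by (simp add: action_on_def)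
      then show "a n (a m x0) \<in> range ?orb" by auto
    qed
    then have "X closure_of (a n ` range ?orb) \<subseteq> Y"
      unfolding Y_def by (rule closure_of_mono)
    moreover have "a n ` Y \<subseteq> X closure_of (a n ` range ?orb)"
      unfolding Y_def by (rule continuous_map_image_closure_subset[OF cont])
    ultimately show ?thesis using that by blast
  qed
  have inj: "inj_on e Y"
  proof (rule inj_onI, rule ccontr)
    fix y z assume y: "y \<in> Y" and z: "z \<in> Y" and eq: "e y = e z" and ne: "y \<noteq> z"
    obtain U V where UV: "openin X U" "openin X V" "y \<in> U" "z \<in> V" "disjnt U V"
      using haus y z ne YX unfolding Hausdorff_space_def by (metis subsetD)
    define A where "A = {n. ?orb n \<in> U}"
    have "y \<in> X closure_of (?orb ` A)"
      unfolding in_closure_of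
    proof (intro conjI allI impI)
      show "y \<in> topspace X" using y YX by auto
      fix T assume "y \<in> T \<and> openin X T"
      then have "y \<in> T \<inter> U" "openin X (T \<inter> U)" using UV by auto
      moreover have "\<And>V. y \<in> V \<Longrightarrow> openin X V \<Longrightarrow> \<exists>w. w \<in> range ?orb \<and> w \<in> V"
        using y unfolding Y_def in_closure_of by auto
      ultimately obtain w where "w \<in> range ?orb" "w \<in> T \<inter> U"
        by meson
      then show "\<exists>w. w \<in> ?orb ` A \<and> w \<in> T" by (auto simp: A_def)
    qed
    then have "A \<in> e z" using eq by (auto simp: e_def)
    then have "z \<in> X closure_of (?orb ` A)" by (simp add: e_def)
    then obtain w where "w \<in> ?orb ` A" "w \<in> V"
      using UV(2,4) unfolding in_closure_of by meson
    then show False using UV by (auto simp: A_def disjnt_iff)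
  qed
  define d where "d = inv_into Y e"
  have de: "d (e y) = y" if "y \<in> Y" for y
    using inj that by (simp add: d_def)
  have dY: "d c \<in> Y" and ed: "e (d c) = c" if "c \<in> e ` Y" for c
    using that by (simp_all add: d_def inv_into_into f_inv_into_f)
  define X' where "X' = pullback_topology (e ` Y) d X"
  have top': "topspace X' = e ` Y"
    using dY YX by (auto simp: X'_def topspace_pullback_topology)
  have cd: "continuous_map X' X d"
    using continuous_map_pullback[OF continuous_map_id, of "e ` Y" d X] by (simp add: X'_def)
  have ce: "continuous_map (subtopology X Y) X' e"
    unfolding X'_def
  proof (rule continuous_map_pullback')
    have "continuous_map (subtopology X Y) X (\<lambda>y. y)"
      by (simp add: continuous_map_from_subtopology)
    then show "continuous_map (subtopology X Y) X (d \<circ> e)"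
      by (rule continuous_map_eq) (auto simp: de)
  qed auto
  define a' where "a' n c = e (a n (d c))" for n c
  define F' where "F' c = F (d c)" for c
  have ca: "continuous_map X' X' (a' n)" for n
  proof -
    have "continuous_map X' (subtopology X Y) (\<lambda>c. a n (d c))"
      using continuous_map_compose[OF cd cont[of n]] dY aY
      by (auto simp: continuous_map_in_subtopology o_def top')
    from continuous_map_compose[OF this ce] show ?thesis
      by (simp add: a'_def[abs_def] o_def)
  qed
  have "compactin X Y"
    unfolding Y_def by (simp add: closedin_compact_space comp)
  then have "compact_space (subtopology X Y)"
    by (simp add: compact_space_subtopology)
  then have "compactin X' (e ` Y)"
    using image_compactin[OF _ ce, of Y] YX
    by (simp add: compactin_subtopology \<open>compactin X Y\<close>)
  then have comp': "compact_space X'"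
    by (simp add: compact_space_def top')
  have "inj_on d (topspace X')"
    by (metis ed inj_onI top')
  then have haus': "Hausdorff_space X'"
    using Hausdorff_space_injective_preimage[OF haus cd] by simp
  have act': "action_on (topspace X') a'"
    unfolding action_on_def
  proof (intro conjI allI ballI Pi_I)
    fix n m c
    assume "c \<in> topspace X'"
    then have c: "c \<in> e ` Y" by (simp add: top')
    have dX: "d c \<in> topspace X" using dY[OF c] YX by auto
    show "a' n c \<in> topspace X'"
      using aY[OF dY[OF c]] by (simp add: a'_def top')
    show "a' 0 c = c"
      using act dX ed[OF c] by (simp add: action_on_def a'_def)
    have "a (n + m) (d c) = a n (a m (d c))"
      using act dX by (simp add: action_on_def)
    then show "a' (n + m) c = a' n (a' m c)"
      using de[OF aY[OF dY[OF c]]] by (simp add: a'_def)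
  qed
  have "separately_continuous_action X' a'"
    unfolding separately_continuous_action_def
  proof (intro conjI allI ballI act' ca)
    fix c assume "c \<in> topspace X'"
    then have "\<And>n. a' n c \<in> topspace X'"
      using act' by (auto simp: action_on_def)
    then show "continuous_map euclidean X' (\<lambda>n. a' n c)"
      by (auto simp: continuous_map_def open_discrete)
  qed
  then have sys': "compact_system X' a'"
    by (simp add: compact_system_def comp' haus')
  have dist': "distal_system X' a'"
    unfolding distal_system_def
  proof (intro ballI impI notI)
    fix x y assume x: "x \<in> topspace X'" and y: "y \<in> topspace X'" and ne: "x \<noteq> y"
    assume "\<exists>\<F> z. \<F> \<noteq> bot \<and> limitin X' (\<lambda>s. a' s x) z \<F> \<and> limitin X' (\<lambda>s. a' s y) z \<F>"
    then obtain \<F> z where "\<F> \<noteq> bot"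
      and lim: "limitin X' (\<lambda>s. a' s x) z \<F>" "limitin X' (\<lambda>s. a' s y) z \<F>"
      by blast
    have *: "d (a' s w) = a s (d w)" if "w \<in> topspace X'" for s w
      using that aY dY de by (simp add: a'_def top')
    have "limitin X (\<lambda>s. a s (d x)) (d z) \<F>" "limitin X (\<lambda>s. a s (d y)) (d z) \<F>"
      using continuous_map_limit[OF cd lim(1)] continuous_map_limit[OF cd lim(2)] x y
      by (simp_all add: o_def *)
    moreover have "d x \<in> topspace X" "d y \<in> topspace X"
      using x y dY YX by (auto simp: top')
    moreover have "d x \<noteq> d y"
      using x y ne ed[of x] ed[of y] unfolding top' by force
    ultimately show False
      using X(2) \<open>\<F> \<noteq> bot\<close> unfolding distal_system_def by blast
  qed
  have "continuous_map X' euclideanreal F'"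
    using continuous_map_compose[OF cd F] by (simp add: F'_def[abs_def] o_def)
  moreover have "apply_bcontfun f n = F' (a' n (e x0))" for n
    using x0Y aY by (simp add: f F'_def a'_def de)
  moreover have "e x0 \<in> topspace X'"
    using x0Y by (simp add: top')
  ultimately show ?thesis
    unfolding distal_functions_def using sys' dist' by blast
qed


section \<open>Locally convex spaces and operator compactifications\<close>

definition locally_convex_space :: "'v::real_vector topology \<Rightarrow> bool" where
  "locally_convex_space T \<longleftrightarrow>
     topspace T = UNIV \<and> Hausdorff_space T \<and>
     continuous_map (prod_topology T T) T (\<lambda>(x, y). x + y) \<and>
     continuous_map (prod_topology euclideanreal T) T (\<lambda>(c, x). c *\<^sub>R x) \<and>
     (\<forall>U. openin T U \<and> 0 \<in> U \<longrightarrow> (\<exists>W. openin T W \<and> convex W \<and> 0 \<in> W \<and> W \<subseteq> U))"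

definition continuous_dual :: "'v::real_vector topology \<Rightarrow> ('v \<Rightarrow> real) set" where
  "continuous_dual T = {\<psi>. linear \<psi> \<and> continuous_map T euclideanreal \<psi>}"

definition weak_star :: "'v::real_vector topology \<Rightarrow> ('v \<Rightarrow> real) topology" where
  "weak_star T = subtopology (powertop_real UNIV) (continuous_dual T)"

text \<open>The linear operators on \<open>V\<^sup>*\<close> with the topology of pointwise weak-star convergence.\<close>

definition dual_operators ::
    "'v::real_vector topology \<Rightarrow> (('v \<Rightarrow> real) \<Rightarrow> ('v \<Rightarrow> real)) topology" where
  "dual_operators T =
     subtopology (product_topology (\<lambda>_. weak_star T) (continuous_dual T))
       {A. (\<forall>\<phi>\<in>continuous_dual T. \<forall>\<psi>\<in>continuous_dual T.
              A (\<lambda>v. \<phi> v + \<psi> v) = (\<lambda>v. A \<phi> v + A \<psi> v)) \<and>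
           (\<forall>c. \<forall>\<psi>\<in>continuous_dual T. A (\<lambda>v. c * \<psi> v) = (\<lambda>v. c * A \<psi> v))}"

definition adjoint_operator ::
    "'v::real_vector topology \<Rightarrow> ('v \<Rightarrow> 'v) \<Rightarrow> ('v \<Rightarrow> real) \<Rightarrow> ('v \<Rightarrow> real)" where
  "adjoint_operator T A = restrict (\<lambda>\<psi>. \<psi> \<circ> A) (continuous_dual T)"

text \<open>
  Since all \<open>h s\<close> are linear, equicontinuity of \<open>h(S)\<close> is expressed at the origin.
\<close>

definition equicontinuous_corepresentation ::
    "'v::real_vector topology \<Rightarrow> ('s::semitopological_monoid \<Rightarrow> 'v \<Rightarrow> 'v) \<Rightarrow> bool" where
  "equicontinuous_corepresentation T h \<longleftrightarrow>
     (\<forall>s. linear (h s) \<and> continuous_map T T (h s)) \<and>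
     h 0 = id \<and> (\<forall>s t. h (s + t) = h t \<circ> h s) \<and>
     (\<forall>v. \<forall>\<psi>\<in>continuous_dual T. continuous_on UNIV (\<lambda>s. \<psi> (h s v))) \<and>
     (\<forall>U. openin T U \<and> 0 \<in> U \<longrightarrow>
        (\<exists>W. openin T W \<and> 0 \<in> W \<and> (\<forall>s. h s ` W \<subseteq> U)))"

definition operator_compactification_space ::
    "'v::real_vector topology \<Rightarrow> ('s \<Rightarrow> 'v \<Rightarrow> 'v) \<Rightarrow> (('v \<Rightarrow> real) \<Rightarrow> ('v \<Rightarrow> real)) topology" where
  "operator_compactification_space T h =
     subtopology (dual_operators T)
       (dual_operators T closure_of range (\<lambda>s. adjoint_operator T (h s)))"


section \<open>Affine compactifications\<close>

definition affine_on :: "'q::real_vector set \<Rightarrow> ('q \<Rightarrow> 'q) \<Rightarrow> bool" where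
  "affine_on Q g \<longleftrightarrow>
     (\<forall>x\<in>Q. \<forall>y\<in>Q. \<forall>t\<in>{0..1}.
        g ((1 - t) *\<^sub>R x + t *\<^sub>R y) = (1 - t) *\<^sub>R g x + t *\<^sub>R g y)"

text \<open>
  \<open>T\<close> is the topology of the ambient locally convex space, \<open>a\<close> the action on \<open>X\<close> and \<open>b\<close> the
  action on \<open>Q\<close>.
\<close>

definition affine_compactification ::
    "'x topology \<Rightarrow> ('s::semitopological_monoid \<Rightarrow> 'x \<Rightarrow> 'x) \<Rightarrow>
     'q::real_vector topology \<Rightarrow> 'q set \<Rightarrow> ('s \<Rightarrow> 'q \<Rightarrow> 'q) \<Rightarrow> ('x \<Rightarrow> 'q) \<Rightarrow> bool" where
  "affine_compactification X a T Q b \<alpha> \<longleftrightarrow>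
     locally_convex_space T \<and> compactin T Q \<and> convex Q \<and>
     separately_continuous_action (subtopology T Q) b \<and> (\<forall>s. affine_on Q (b s)) \<and>
     continuous_map X (subtopology T Q) \<alpha> \<and>
     (\<forall>s. \<forall>x\<in>topspace X. \<alpha> (a s x) = b s (\<alpha> x)) \<and>
     Q = T closure_of (convex hull (\<alpha> ` topspace X))"

definition faithful_map :: "'x topology \<Rightarrow> 'q topology \<Rightarrow> 'q set \<Rightarrow> ('x \<Rightarrow> 'q) \<Rightarrow> bool" where
  "faithful_map X T Q \<alpha> \<longleftrightarrow> embedding_map X (subtopology T Q) \<alpha>"

text \<open>The restriction of \<open>p \<in> E(Q)\<close> to the closure of \<open>\<alpha>(X)\<close> lies in \<open>E\<close> of that closure.\<close>

definition E_compatible ::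
    "'x topology \<Rightarrow> 'q topology \<Rightarrow> 'q set \<Rightarrow> ('s \<Rightarrow> 'q \<Rightarrow> 'q) \<Rightarrow> ('x \<Rightarrow> 'q) \<Rightarrow> bool" where
  "E_compatible X T Q b \<alpha> \<longleftrightarrow>
     inj_on (\<lambda>p. restrict p (T closure_of (\<alpha> ` topspace X)))
       (enveloping_semigroup (subtopology T Q) b)"


section \<open>Admissible embeddings into operator semigroups of Banach spaces\<close>

definition top_center :: "'a topology \<Rightarrow> ('a \<Rightarrow> 'a \<Rightarrow> 'a) \<Rightarrow> 'a set" where
  "top_center X m = {p \<in> topspace X. continuous_map X X (m p)}"

text \<open>
  A semigroup with topology is given by a topology \<open>X\<close> and a multiplication \<open>m\<close> on its points.
\<close>

definition admissible_embedding ::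
    "'a topology \<Rightarrow> ('a \<Rightarrow> 'a \<Rightarrow> 'a) \<Rightarrow> 'b topology \<Rightarrow> ('b \<Rightarrow> 'b \<Rightarrow> 'b) \<Rightarrow> ('a \<Rightarrow> 'b) \<Rightarrow> bool" where
  "admissible_embedding X m Y k \<alpha> \<longleftrightarrow>
     embedding_map X Y \<alpha> \<and>
     (\<forall>p\<in>topspace X. \<forall>q\<in>topspace X. \<alpha> (m p q) = k (\<alpha> p) (\<alpha> q)) \<and>
     (\<exists>S'. S' \<subseteq> top_center X m \<and> (\<forall>p\<in>S'. \<forall>q\<in>S'. m p q \<in> S') \<and>
           X closure_of S' = topspace X \<and> \<alpha> ` S' \<subseteq> top_center Y k)"

abbreviation dual_ball :: "('b::banach \<Rightarrow>\<^sub>L real) set" where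
  "dual_ball \<equiv> {\<psi>. norm \<psi> \<le> 1}"

definition weak_star_ball :: "('b::banach \<Rightarrow>\<^sub>L real) topology" where
  "weak_star_ball = pullback_topology dual_ball blinfun_apply (powertop_real UNIV)"

definition adjoint_ball ::
    "('b::banach \<Rightarrow>\<^sub>L 'b) \<Rightarrow> ('b \<Rightarrow>\<^sub>L real) \<Rightarrow> ('b \<Rightarrow>\<^sub>L real)" where
  "adjoint_ball T = restrict (\<lambda>\<psi>. \<psi> o\<^sub>L T) dual_ball"

definition banach_semigroup :: "(('b::banach \<Rightarrow>\<^sub>L real) \<Rightarrow> ('b \<Rightarrow>\<^sub>L real)) topology" where
  "banach_semigroup =
     subtopology (product_topology (\<lambda>_. weak_star_ball) dual_ball)
       (product_topology (\<lambda>_. weak_star_ball) dual_ball closure_of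
          (adjoint_ball ` {T. norm T \<le> 1}))"

end

theory Submission
  imports Defs
begin

text \<open>
  Write \<open>X\<close> for the spectrum of the algebra of distal functions: a compact right topological group
  whose identity is evaluation at \<open>0\<close>, and a minimal distal cascade.  Each of the four kinds of
  objects that are to be excluded provides a set of continuous functions \<open>h\<close> on \<open>X\<close> that
  separates points and whose orbits have a recurrence property that is too strong.

  In a distal system the idempotents of the enveloping semigroup are trivial, so there is an
  ultrafilter \<open>p\<close> on the positive integers along which the powers \<open>s^k\<close> of a given \<open>s\<close> in the
  topological centre of \<open>X\<close> tend to the identity (\<open>center_power_recurrence\<close>).  Let \<open>m\<close> be a shift
  invariant mean on bounded sequences and let \<open>f(n) = h(s^(n+1))\<close> be a coefficient of one of the
  excluded structures.  The functional \<open>d \<mapsto> m(f d)\<close> is represented in the structure as well: by an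
  element of the dual space for operator compactifications and introverted spaces, and by a
  barycentre, that is a limit of weighted averages of an orbit, for affine systems and for the dual
  ball of a Banach space.  The hypotheses say that the powers of \<open>s\<close> act on this new element, too, by
  maps that tend to the identity along \<open>p\<close>.  Hence \<open>m(f(n) f(n+k)) \<rightarrow> m(f(n)^2)\<close>, and therefore
  \<open>m((f(n+k) - f(n))^2) \<rightarrow> 0\<close> as \<open>k \<rightarrow> p\<close>: the sequence \<open>f\<close> is recurrent in mean square
  (\<open>recurrent_in_mean_affine\<close> is the affine form of this argument).

  On a compact space the oscillation of any continuous function is controlled by finitely many
  members of a separating family.  So if a separating family is recurrent in mean square along
  \<open>s^(n+1)\<close>, then so is every continuous function on \<open>X\<close> (\<open>recurrent_in_mean_separating\<close>).

  This is impossible.  For \<open>\<mu>\<close> on the circle of infinite order, \<open>n \<mapsto> \<mu>^(n^2)\<close> is distal, being a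
  coefficient of a skew product on the torus.  Along the powers of an \<open>s\<close> in the topological
  centre with nontrivial rotation it becomes a sequence \<open>W\<close> of complex numbers of modulus \<open>1\<close> with
  \<open>W(n+k) = C w^n W(n)\<close>, where \<open>w = v^k\<close> and \<open>v\<close> has infinite order.  As \<open>w \<noteq> 1\<close>, the mean of
  \<open>w^n\<close> vanishes, and \<open>m(|W(n+k) - W(n)|^2) = 2\<close> for all \<open>k > 0\<close>, which contradicts recurrence in
  mean square (\<open>no_recurrent_separating_family\<close>).  For operator compactifications, introverted spaces
  and affine compactifications, \<open>s\<close> is evaluation at \<open>1\<close>; for admissible embeddings only some dense
  subsemigroup of the topological centre is under control, and \<open>s\<close> is chosen in it.
\<close>

section \<open>Ultrafilters and compactness\<close>

definition ultrafilter :: "'a filter \<Rightarrow> bool" where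
  "ultrafilter U \<longleftrightarrow> U \<noteq> bot \<and> (\<forall>P. eventually P U \<or> eventually (\<lambda>x. \<not> P x) U)"

lemma ultrafilter_neq_bot: "ultrafilter U \<Longrightarrow> U \<noteq> bot"
  by (simp add: ultrafilter_def)

text \<open>
  Zorn's lemma for proper filters ordered by refinement; a maximally fine filter is an
  ultrafilter because restricting it to an undecided set would refine it properly.
\<close>

lemma ultrafilter_exists_le:
  fixes F :: "'a filter"
  assumes "F \<noteq> bot"
  shows "\<exists>U. ultrafilter U \<and> U \<le> F"
proof -
  define A where "A = {G. G \<noteq> bot \<and> G \<le> F}"
  have "\<exists>m\<in>A. \<forall>a\<in>A. a \<le> m \<longrightarrow> a = m"
  proof (rule predicate_Zorn)
    show "partial_order_on A (relation_of (\<lambda>a b. b \<le> a) A)"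
      by (rule partial_order_on_relation_ofI) auto
    fix C assume C: "C \<in> Chains (relation_of (\<lambda>a b. b \<le> a) A)"
    show "\<exists>u\<in>A. \<forall>a\<in>C. u \<le> a"
    proof (cases "C = {}")
      case True
      then show ?thesis using assms by (auto simp: A_def)
    next
      case False
      have CA: "C \<subseteq> A" and lin: "\<And>a b. a \<in> C \<Longrightarrow> b \<in> C \<Longrightarrow> a \<le> b \<or> b \<le> a"
        using C by (auto simp: Chains_def relation_of_def)
      have base: "\<exists>x\<in>C. x \<le> inf a b" if "a \<in> C" "b \<in> C" for a b
        using lin[OF that] that by (meson le_inf_iff order_refl)
      have "Inf C \<noteq> bot"
      proof
        assume "Inf C = bot"
        then have "eventually (\<lambda>_. False) (Inf C)" by simp
        then obtain b where "b \<in> C" "eventually (\<lambda>_. False) b"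
          using eventually_Inf_base[OF False base] by auto
        then show False using CA by (auto simp: A_def eventually_False)
      qed
      moreover have "Inf C \<le> F"
      proof -
        obtain c where "c \<in> C" using False by blast
        then show ?thesis using CA by (intro Inf_lower2[of c]) (auto simp: A_def)
      qed
      ultimately have "Inf C \<in> A" by (simp add: A_def)
      then show ?thesis using Inf_lower by blast
    qed
  qed
  then obtain m where mA: "m \<in> A" and maxA: "\<And>a. a \<in> A \<Longrightarrow> a \<le> m \<Longrightarrow> a = m"
    by blast
  have m: "m \<noteq> bot" "m \<le> F" using mA by (auto simp: A_def)
  have max: "a = m" if "a \<noteq> bot" "a \<le> m" for a
    using that m by (intro maxA) (auto simp: A_def)
  have "eventually P m \<or> eventually (\<lambda>x. \<not> P x) m" for P
  proof (cases "inf m (principal {x. P x}) = bot")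
    case True
    then have "eventually (\<lambda>_. False) (inf m (principal {x. P x}))" by simp
    then show ?thesis by (auto simp: eventually_inf_principal)
  next
    case False
    then have "inf m (principal {x. P x}) = m" by (intro max) auto
    moreover have "eventually P (inf m (principal {x. P x}))"
      by (simp add: eventually_inf_principal)
    ultimately show ?thesis by simp
  qed
  with m show ?thesis by (auto simp: ultrafilter_def)
qed

text \<open>
  Otherwise every point has a neighbourhood that is avoided eventually; finitely many of these
  cover \<open>K\<close>, and then \<open>K\<close> itself is avoided eventually.
\<close>

lemma ultrafilter_limitin:
  assumes U: "ultrafilter U" and K: "compactin X K" and g: "eventually (\<lambda>x. g x \<in> K) U"
  shows "\<exists>z\<in>K. limitin X g z U"
proof (rule ccontr)
  assume no: "\<not> ?thesis"
  define O' where "O' = {V. openin X V \<and> eventually (\<lambda>x. g x \<notin> V) U}"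
  have "\<exists>V\<in>O'. z \<in> V" if "z \<in> K" for z
  proof -
    have "z \<in> topspace X" using K that compactin_subset_topspace by blast
    moreover have "\<not> limitin X g z U" using no that by blast
    ultimately obtain V where V: "openin X V" "z \<in> V" "\<not> eventually (\<lambda>x. g x \<in> V) U"
      unfolding limitin_def by meson
    then have "eventually (\<lambda>x. g x \<notin> V) U" using U by (simp add: ultrafilter_def) metis
    with V show ?thesis unfolding O'_def by auto
  qed
  then have "K \<subseteq> \<Union>O'" by blast
  moreover have "\<And>V. V \<in> O' \<Longrightarrow> openin X V" by (simp add: O'_def)
  ultimately obtain \<F> where \<F>: "finite \<F>" "\<F> \<subseteq> O'" "K \<subseteq> \<Union>\<F>"
    using compactinD[OF K, of O'] by meson
  have "\<forall>V\<in>\<F>. eventually (\<lambda>x. g x \<notin> V) U"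
    using \<F>(2) by (auto simp: O'_def)
  then have "eventually (\<lambda>x. \<forall>V\<in>\<F>. g x \<notin> V) U"
    using \<F>(1) by (simp add: eventually_ball_finite)
  then have "eventually (\<lambda>x. False) U"
    using g
  proof eventually_elim
    case (elim x)
    then show ?case using \<F>(3) by blast
  qed
  then show False using U by (simp add: ultrafilter_def)
qed

lemma ultrafilter_limitin_compact_space:
  assumes "ultrafilter U" "compact_space X" "\<And>x. g x \<in> topspace X"
  shows "\<exists>z\<in>topspace X. limitin X g z U"
  using assms ultrafilter_limitin[of U X "topspace X" g] by (simp add: compact_space_def)

corollary ultrafilter_tendsto_bounded:
  fixes a :: "'a \<Rightarrow> real"
  assumes "ultrafilter U" "eventually (\<lambda>x. \<bar>a x\<bar> \<le> M) U"
  shows "\<exists>L. (a \<longlongrightarrow> L) U"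
proof -
  have "eventually (\<lambda>x. a x \<in> {-M..M}) U"
    using assms(2) by eventually_elim auto
  then show ?thesis
    using ultrafilter_limitin[OF assms(1), of euclideanreal "{-M..M}" a] by auto
qed

text \<open>
  Ultrafilters on the index set play the role of convergent nets.
\<close>

lemma closure_of_limitin:
  assumes "z \<in> X closure_of (g ` S)"
  obtains U where "ultrafilter U" "eventually (\<lambda>x. x \<in> S) U" "limitin X g z U"
proof -
  have z: "z \<in> topspace X" using assms by (simp add: in_closure_of)
  define F where "F = inf (filtercomap g (nhdsin X z)) (principal S)"
  have "F \<noteq> bot"
  proof
    assume "F = bot"
    then have "eventually (\<lambda>_. False) F" by simp
    then have "eventually (\<lambda>x. x \<notin> S) (filtercomap g (nhdsin X z))"
      by (simp add: F_def eventually_inf_principal)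
    then obtain P where "eventually P (nhdsin X z)" and P: "\<And>x. P (g x) \<Longrightarrow> x \<notin> S"
      unfolding eventually_filtercomap by blast
    then obtain V where V: "openin X V" "z \<in> V" and "\<And>x. x \<in> V \<Longrightarrow> P x"
      using z unfolding eventually_nhdsin by blast
    then have "\<And>x. g x \<in> V \<Longrightarrow> x \<notin> S" using P by blast
    moreover obtain y where "y \<in> g ` S" "y \<in> V"
      using assms V unfolding in_closure_of by meson
    ultimately show False by blast
  qed
  then obtain U where U: "ultrafilter U" "U \<le> F" using ultrafilter_exists_le by blast
  have "eventually (\<lambda>x. x \<in> S) F" by (simp add: F_def eventually_inf_principal)
  moreover have "limitin X g z F"
    unfolding limitin_def
  proof (intro conjI allI impI z)
    fix V assume "openin X V \<and> z \<in> V"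
    then have "eventually (\<lambda>x. x \<in> V) (nhdsin X z)" by (auto simp: eventually_nhdsin)
    then have "eventually (\<lambda>x. g x \<in> V) (filtercomap g (nhdsin X z))"
      by (rule eventually_filtercomapI)
    then show "eventually (\<lambda>x. g x \<in> V) F"
      by (simp add: F_def eventually_inf_principal eventually_mono)
  qed
  ultimately show ?thesis
    using U that by (simp add: limitin_def le_filter_def)
qed

lemma in_closure_of_limitin:
  assumes "limitin X g z F" "F \<noteq> bot" "\<And>i. g i \<in> S"
  shows "z \<in> X closure_of S"
  unfolding in_closure_of
proof (intro conjI allI impI)
  show "z \<in> topspace X" using assms(1) by (rule limitin_topspace)
  fix T assume "z \<in> T \<and> openin X T"
  then have "eventually (\<lambda>i. g i \<in> T) F" using limitinD[OF assms(1)] by blast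
  then obtain i where "g i \<in> T" using assms(2) eventually_happens by blast
  then show "\<exists>y. y \<in> S \<and> y \<in> T" using assms(3) by blast
qed

text \<open>
  A family of closed sets with the finite intersection property generates a proper filter, and
  the limit of a finer ultrafilter lies in all of them.
\<close>

lemma compact_space_of_ultrafilter_limits:
  assumes "\<And>U. ultrafilter U \<Longrightarrow> eventually (\<lambda>x. x \<in> topspace X) U \<Longrightarrow> \<exists>z. limitin X (\<lambda>x. x) z U"
  shows "compact_space X"
  unfolding compact_space_fip
proof (intro allI impI)
  fix \<C> :: "'a set set"
  assume C: "(\<forall>C\<in>\<C>. closedin X C) \<and> (\<forall>\<F>. finite \<F> \<and> \<F> \<subseteq> \<C> \<longrightarrow> \<Inter>\<F> \<noteq> {})"
  show "\<Inter>\<C> \<noteq> {}"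
  proof (cases "\<C> = {}")
    case False
    define F where "F = (INF C\<in>\<C>. principal C)"
    have "F \<noteq> bot"
    proof
      assume "F = bot"
      then have "eventually (\<lambda>_. False) (INF C\<in>\<C>. principal C)" by (simp add: F_def)
      from iffD1[OF eventually_INF this] obtain \<F> where \<F>: "finite \<F>" "\<F> \<subseteq> \<C>" "eventually (\<lambda>_. False) (INF C\<in>\<F>. principal C)"
        by blast
      have "(INF C\<in>\<F>. principal C) = principal (\<Inter>\<F>)"
        using INF_principal_finite[OF \<F>(1), of "\<lambda>C. C"] by simp
      then have "\<Inter>\<F> = {}" using \<F>(3) by (auto simp: eventually_principal)
      moreover have "\<Inter>\<F> \<noteq> {}" using C \<F>(1,2) by simp
      ultimately show False by simp
    qed
    then obtain U where U: "ultrafilter U" "U \<le> F" using ultrafilter_exists_le by blast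
    have evC: "eventually (\<lambda>x. x \<in> C) U" if "C \<in> \<C>" for C
    proof -
      have "F \<le> principal C" unfolding F_def using that by (rule INF_lower)
      then show ?thesis using U(2) by (metis le_principal order_trans)
    qed
    obtain C0 where "C0 \<in> \<C>" using False by blast
    then have "C0 \<subseteq> topspace X" using C closedin_subset by blast
    then have "eventually (\<lambda>x. x \<in> topspace X) U"
      using evC[OF \<open>C0 \<in> \<C>\<close>] by (auto elim: eventually_mono)
    then obtain z where z: "limitin X (\<lambda>x. x) z U" using assms[OF U(1)] by blast
    have "z \<in> C" if CC: "C \<in> \<C>" for C
    proof (rule ccontr)
      assume "z \<notin> C"
      then have "eventually (\<lambda>x. x \<in> topspace X - C) U"
        using C CC limitin_topspace[OF z] by (intro limitinD[OF z]) auto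
      with evC[OF CC] have "eventually (\<lambda>x. False) U" by eventually_elim blast
      then show False using ultrafilter_neq_bot[OF U(1)] by simp
    qed
    then show ?thesis by blast
  qed simp
qed

section \<open>An invariant mean and recurrence in mean square\<close>

definition mean_filter :: "nat filter" where
  "mean_filter = (SOME U. ultrafilter U \<and> U \<le> sequentially)"

lemma mean_filter: "ultrafilter mean_filter" "mean_filter \<le> sequentially"
proof -
  have "\<exists>U. ultrafilter U \<and> U \<le> sequentially"
    by (rule ultrafilter_exists_le) simp
  then show "ultrafilter mean_filter" "mean_filter \<le> sequentially"
    unfolding mean_filter_def by (metis (mono_tags, lifting) someI_ex)+
qed

lemma mean_filter_neq_bot [simp]: "mean_filter \<noteq> bot"
  using mean_filter by (simp add: ultrafilter_def)

definition cesaro :: "(nat \<Rightarrow> real) \<Rightarrow> nat \<Rightarrow> real" where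
  "cesaro f N = (\<Sum>n<N. f n) / real N"

text \<open>
  A shift invariant mean: the limit of the averages along a fixed free ultrafilter.  The concrete
  form matters in \<open>recurrent_in_mean_affine\<close>, where means arise from limits of convex combinations
  of the points of an orbit.
\<close>

definition mean :: "(nat \<Rightarrow> real) \<Rightarrow> real" where
  "mean f = Lim mean_filter (cesaro f)"

abbreviation bounded_seq :: "('a \<Rightarrow> real) \<Rightarrow> bool" where
  "bounded_seq f \<equiv> bounded (range f)"

lemma bounded_seqI: "(\<And>n. \<bar>f n\<bar> \<le> M) \<Longrightarrow> bounded_seq f"
  by (auto simp: bounded_iff)

lemma bounded_seqE: assumes "bounded_seq f" obtains M where "0 < M" "\<And>n. \<bar>f n\<bar> \<le> M"
  using assms by (auto simp: bounded_pos)

lemma bounded_seq_add: "bounded_seq f \<Longrightarrow> bounded_seq g \<Longrightarrow> bounded_seq (\<lambda>n. f n + g n)"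
  by (rule bounded_plus_comp)

lemma bounded_seq_diff: "bounded_seq f \<Longrightarrow> bounded_seq g \<Longrightarrow> bounded_seq (\<lambda>n. f n - g n)"
  by (rule bounded_minus_comp)

lemma bounded_seq_mult:
  assumes "bounded_seq f" "bounded_seq g" shows "bounded_seq (\<lambda>n. f n * g n)"
proof -
  obtain M N where "0 < M" "\<And>n. \<bar>f n\<bar> \<le> M" "0 < N" "\<And>n. \<bar>g n\<bar> \<le> N"
    using assms bounded_seqE by metis
  then show ?thesis
    by (intro bounded_seqI[of _ "M * N"]) (auto simp: abs_mult intro!: mult_mono)
qed

lemma bounded_seq_const: "bounded_seq (\<lambda>n. c)"
  by (rule bounded_seqI[of _ "\<bar>c\<bar>"]) simp

lemma bounded_seq_reindex: "bounded_seq f \<Longrightarrow> bounded_seq (\<lambda>n. f (h n))"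
  by (rule bounded_subset) auto

lemma bounded_seq_power2: "bounded_seq f \<Longrightarrow> bounded_seq (\<lambda>n. (f n)\<^sup>2)"
  by (simp add: power2_eq_square bounded_seq_mult)

lemma bounded_seq_sum: "(\<And>i. i \<in> I \<Longrightarrow> bounded_seq (f i)) \<Longrightarrow> bounded_seq (\<lambda>n. \<Sum>i\<in>I. f i n)"
  by (induction I rule: infinite_finite_induct) (simp_all add: bounded_seq_const bounded_seq_add)

lemmas bounded_seq_intros =
  bounded_seq_add bounded_seq_diff bounded_seq_mult bounded_seq_const bounded_seq_power2
  bounded_seq_sum

lemma cesaro_tendsto_mean:
  assumes "bounded_seq f" shows "(cesaro f \<longlongrightarrow> mean f) mean_filter"
proof -
  obtain M where M: "0 < M" "\<And>n. \<bar>f n\<bar> \<le> M" using assms bounded_seqE by metis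
  have "\<bar>cesaro f N\<bar> \<le> M" for N
  proof (cases "N = 0")
    case False
    have "\<bar>\<Sum>n<N. f n\<bar> \<le> (\<Sum>n<N. M)"
      by (rule order_trans[OF sum_abs sum_mono]) (use M in auto)
    then show ?thesis using False by (simp add: cesaro_def field_simps)
  qed (use M in \<open>simp add: cesaro_def\<close>)
  then obtain L where L: "(cesaro f \<longlongrightarrow> L) mean_filter"
    using ultrafilter_tendsto_bounded[OF mean_filter(1), of "cesaro f" M] by auto
  then show ?thesis
    unfolding mean_def by (simp add: tendsto_Lim)
qed

lemma mean_eqI: "bounded_seq f \<Longrightarrow> (cesaro f \<longlongrightarrow> L) mean_filter \<Longrightarrow> mean f = L"
  by (rule tendsto_unique[OF mean_filter_neq_bot cesaro_tendsto_mean])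

lemma mean_add:
  assumes "bounded_seq f" "bounded_seq g" shows "mean (\<lambda>n. f n + g n) = mean f + mean g"
proof (rule mean_eqI)
  have "cesaro (\<lambda>n. f n + g n) = (\<lambda>N. cesaro f N + cesaro g N)"
    by (auto simp: cesaro_def sum.distrib add_divide_distrib)
  then show "(cesaro (\<lambda>n. f n + g n) \<longlongrightarrow> mean f + mean g) mean_filter"
    using assms by (auto intro: tendsto_add cesaro_tendsto_mean)
qed (use assms in \<open>intro bounded_seq_intros\<close>)

lemma mean_cmult:
  assumes "bounded_seq f" shows "mean (\<lambda>n. c * f n) = c * mean f"
proof (rule mean_eqI)
  have "cesaro (\<lambda>n. c * f n) = (\<lambda>N. c * cesaro f N)"
    by (auto simp: cesaro_def sum_distrib_left)
  then show "(cesaro (\<lambda>n. c * f n) \<longlongrightarrow> c * mean f) mean_filter"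
    using assms by (auto intro: tendsto_mult_left cesaro_tendsto_mean)
qed (use assms in \<open>intro bounded_seq_intros\<close>)

lemma mean_diff:
  assumes "bounded_seq f" "bounded_seq g" shows "mean (\<lambda>n. f n - g n) = mean f - mean g"
proof -
  have "bounded_seq (\<lambda>n. (-1) * g n)" by (intro bounded_seq_mult bounded_seq_const assms)
  from mean_add[OF assms(1) this] mean_cmult[OF assms(2), of "-1"] show ?thesis by simp
qed

lemma mean_const [simp]: "mean (\<lambda>n. c) = c"
proof (rule mean_eqI[OF bounded_seq_const])
  have "eventually (\<lambda>N. cesaro (\<lambda>n. c) N = c) sequentially"
    using eventually_gt_at_top[of "0::nat"] by eventually_elim (simp add: cesaro_def)
  then have "(cesaro (\<lambda>n. c) \<longlongrightarrow> c) sequentially" by (rule tendsto_eventually)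
  then show "(cesaro (\<lambda>n. c) \<longlongrightarrow> c) mean_filter"
    using mean_filter(2) tendsto_mono by blast
qed

lemma mean_mono:
  assumes "bounded_seq f" "bounded_seq g" "\<And>n. f n \<le> g n" shows "mean f \<le> mean g"
proof (rule tendsto_le[OF mean_filter_neq_bot cesaro_tendsto_mean cesaro_tendsto_mean])
  show "eventually (\<lambda>N. cesaro f N \<le> cesaro g N) mean_filter"
    by (intro always_eventually allI) (simp add: cesaro_def divide_right_mono sum_mono assms)
qed (use assms in auto)

lemma mean_nonneg: "bounded_seq f \<Longrightarrow> (\<And>n. 0 \<le> f n) \<Longrightarrow> 0 \<le> mean f"
  using mean_mono[of "\<lambda>_. 0" f] by (simp add: bounded_seq_const)

lemma abs_mean_le:
  assumes "\<And>n. \<bar>f n\<bar> \<le> M" shows "\<bar>mean f\<bar> \<le> M"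
proof -
  have b: "bounded_seq f" using assms by (rule bounded_seqI)
  have "mean f \<le> mean (\<lambda>_. M)" "mean (\<lambda>_. -M) \<le> mean f"
    by (intro mean_mono b bounded_seq_const; use assms in \<open>simp add: abs_le_iff minus_le_iff\<close>)+
  then show ?thesis by simp
qed

lemma mean_sum:
  "(\<And>i. i \<in> I \<Longrightarrow> bounded_seq (f i)) \<Longrightarrow> mean (\<lambda>n. \<Sum>i\<in>I. f i n) = (\<Sum>i\<in>I. mean (f i))"
  by (induction I rule: infinite_finite_induct) (simp_all add: mean_add bounded_seq_sum)

lemma mean_Suc:
  assumes "bounded_seq f" shows "mean (\<lambda>n. f (Suc n)) = mean f"
proof (rule mean_eqI)
  show "bounded_seq (\<lambda>n. f (Suc n))" using assms by (rule bounded_seq_reindex)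
  obtain M where M: "0 < M" "\<And>n. \<bar>f n\<bar> \<le> M" using assms bounded_seqE by metis
  have "((\<lambda>N. (f N - f 0) / real N) \<longlongrightarrow> 0) sequentially"
  proof (rule Lim_null_comparison)
    show "eventually (\<lambda>N. norm ((f N - f 0) / real N) \<le> 2 * M / real N) sequentially"
    proof (intro always_eventually allI)
      fix N
      have "\<bar>f N - f 0\<bar> \<le> 2 * M" using M(2)[of N] M(2)[of 0] by linarith
      then show "norm ((f N - f 0) / real N) \<le> 2 * M / real N"
        by (auto intro: divide_right_mono)
    qed
    show "((\<lambda>N. 2 * M / real N) \<longlongrightarrow> 0) sequentially" by (rule lim_const_over_n)
  qed
  then have "((\<lambda>N. (f N - f 0) / real N) \<longlongrightarrow> 0) mean_filter"
    using mean_filter(2) tendsto_mono by blast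
  from tendsto_add[OF cesaro_tendsto_mean[OF assms] this]
  have lim: "((\<lambda>N. cesaro f N + (f N - f 0) / real N) \<longlongrightarrow> mean f) mean_filter" by simp
  have "cesaro (\<lambda>n. f (Suc n)) N = cesaro f N + (f N - f 0) / real N" for N
  proof -
    have "(\<Sum>n<N. f (Suc n)) = (\<Sum>n<N. f n) + (f N - f 0)"
      by (induction N) auto
    then show ?thesis by (simp add: cesaro_def add_divide_distrib)
  qed
  then have "cesaro (\<lambda>n. f (Suc n)) = (\<lambda>N. cesaro f N + (f N - f 0) / real N)"
    by (rule ext)
  then show "(cesaro (\<lambda>n. f (Suc n)) \<longlongrightarrow> mean f) mean_filter"
    using lim by simp
qed

lemma mean_shift: "bounded_seq f \<Longrightarrow> mean (\<lambda>n. f (n + k)) = mean f"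
proof (induction k)
  case (Suc k)
  have "bounded_seq (\<lambda>n. f (n + k))" using Suc(2) by (rule bounded_seq_reindex)
  from mean_Suc[OF this] show ?case using Suc by simp
qed simp

text \<open>
  Recurrence of the orbit of \<open>f\<close> under the shift for the seminorm \<open>sqrt (mean (f^2))\<close>.
\<close>

definition recurrent_in_mean :: "nat filter \<Rightarrow> (nat \<Rightarrow> real) \<Rightarrow> bool" where
  "recurrent_in_mean p f \<longleftrightarrow>
     bounded_seq f \<and> ((\<lambda>k. mean (\<lambda>n. (f (n + k) - f n)\<^sup>2)) \<longlongrightarrow> 0) p"

text \<open>
  Expand the square: by shift invariance both quadratic terms have the same mean, so convergence of the
  correlations suffices.
\<close>

lemma recurrent_in_meanI:
  assumes f: "bounded_seq f"
    and lim: "((\<lambda>k. mean (\<lambda>n. f n * f (n + k))) \<longlongrightarrow> mean (\<lambda>n. f n * f n)) p"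
  shows "recurrent_in_mean p f"
proof -
  have "mean (\<lambda>n. (f (n + k) - f n)\<^sup>2) = 2 * (mean (\<lambda>n. f n * f n) - mean (\<lambda>n. f n * f (n + k)))"
    (is "?l = _") for k
  proof -
    have b: "bounded_seq (\<lambda>n. f n * f n)" "bounded_seq (\<lambda>n. f (n + k) * f (n + k))"
      "bounded_seq (\<lambda>n. f n * f (n + k))"
      by (intro bounded_seq_intros bounded_seq_reindex[OF f] f)+
    have "?l = mean (\<lambda>n. (f (n + k) * f (n + k) + f n * f n) - 2 * (f n * f (n + k)))"
      by (rule arg_cong[of _ _ mean]) (auto simp: power2_eq_square algebra_simps)
    also have "\<dots> = (mean (\<lambda>n. f (n + k) * f (n + k)) + mean (\<lambda>n. f n * f n))
        - 2 * mean (\<lambda>n. f n * f (n + k))"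
      using b by (simp add: mean_diff mean_add mean_cmult bounded_seq_add
          bounded_seq_mult[OF bounded_seq_const])
    also have "mean (\<lambda>n. f (n + k) * f (n + k)) = mean (\<lambda>n. f n * f n)"
      using mean_shift[OF b(1)] .
    finally show ?thesis by simp
  qed
  moreover have "((\<lambda>k. 2 * (mean (\<lambda>n. f n * f n) - mean (\<lambda>n. f n * f (n + k)))) \<longlongrightarrow> 0) p"
    using tendsto_mult_left[OF tendsto_diff[OF tendsto_const[of "mean (\<lambda>n. f n * f n)"] lim], of 2]
    by simp
  ultimately show ?thesis using f by (simp add: recurrent_in_mean_def)
qed

section \<open>Recurrence of separating families\<close>

lemma continuous_map_compact_bounded:
  assumes "compact_space X" "continuous_map X euclideanreal G"
  shows "\<exists>M>0. \<forall>a\<in>topspace X. \<bar>G a\<bar> \<le> M"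
proof -
  have "compact (G ` topspace X)"
    using image_compactin[OF _ assms(2)] assms(1) by (simp add: compact_space_def)
  then have "bounded (G ` topspace X)" by (rule compact_imp_bounded)
  then show ?thesis by (auto simp: bounded_pos)
qed

text \<open>
  The set of pairs on which \<open>G\<close> oscillates by at least \<open>sqrt e\<close> is compact, and it is covered by the open
  sets of pairs on which the oscillation of a member of \<open>\<H>\<close> exceeds a positive constant.  The
  members of \<open>J\<close> are pairs of a function and a weight.
\<close>

lemma separating_modulus:
  assumes X: "compact_space X"
    and cont: "\<forall>h\<in>\<H>. continuous_map X euclideanreal h"
    and sep: "\<forall>a\<in>topspace X. \<forall>b\<in>topspace X. a \<noteq> b \<longrightarrow> (\<exists>h\<in>\<H>. h a \<noteq> h b)"
    and G: "continuous_map X euclideanreal G"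
    and e: "0 < e"
  shows "\<exists>J. finite J \<and> fst ` J \<subseteq> \<H> \<and>
    (\<forall>a\<in>topspace X. \<forall>b\<in>topspace X.
       (G a - G b)\<^sup>2 \<le> e + (\<Sum>j\<in>J. snd j * (fst j a - fst j b)\<^sup>2))"
proof -
  obtain M where M: "0 < M" "\<And>a. a \<in> topspace X \<Longrightarrow> \<bar>G a\<bar> \<le> M"
    using continuous_map_compact_bounded[OF X G] by metis
  define D where "D h = (\<lambda>ab. (h (fst ab) - h (snd ab))\<^sup>2)" for h :: "'a \<Rightarrow> real"
  have contD: "continuous_map (prod_topology X X) euclideanreal (D h)"
    if "continuous_map X euclideanreal h" for h
  proof -
    have "continuous_map (prod_topology X X) euclideanreal (\<lambda>ab. h (fst ab))"
      "continuous_map (prod_topology X X) euclideanreal (\<lambda>ab. h (snd ab))"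
      using continuous_map_compose[OF continuous_map_fst that]
        continuous_map_compose[OF continuous_map_snd that] by (auto simp: o_def)
    then show ?thesis
      unfolding D_def by (intro continuous_map_real_pow continuous_map_diff)
  qed
  define K where "K = {ab \<in> topspace (prod_topology X X). D G ab \<in> {e..}}"
  have "closedin (prod_topology X X) K"
    unfolding K_def by (rule closedin_continuous_map_preimage[OF contD[OF G]]) simp
  then have K: "compactin (prod_topology X X) K"
    by (intro closedin_compact_space) (simp_all add: compact_space_prod_topology X)
  define U where "U = (\<lambda>(h, d). {ab \<in> topspace (prod_topology X X). D h ab \<in> {d<..}})"
  have U: "openin (prod_topology X X) (U j)" if "j \<in> \<H> \<times> {0<..}" for j
    using that unfolding U_def
    by (auto simp only: split: prod.split intro!: openin_continuous_map_preimage contD cont[rule_format]) auto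
  have "K \<subseteq> \<Union>(U ` (\<H> \<times> {0<..}))"
  proof
    fix ab assume ab: "ab \<in> K"
    then have X2: "fst ab \<in> topspace X" "snd ab \<in> topspace X" and "e \<le> D G ab"
      by (auto simp: K_def)
    then have "fst ab \<noteq> snd ab" using e by (auto simp: D_def)
    then obtain h where h: "h \<in> \<H>" "h (fst ab) \<noteq> h (snd ab)" using sep X2 by blast
    then have "0 < D h ab" by (simp add: D_def)
    then obtain d where "0 < d" "d < D h ab" using dense by blast
    then have "ab \<in> U (h, d)" using ab by (simp add: U_def K_def)
    then show "ab \<in> \<Union>(U ` (\<H> \<times> {0<..}))" using h \<open>0 < d\<close> by auto
  qed
  with U obtain \<F> where \<F>: "finite \<F>" "\<F> \<subseteq> U ` (\<H> \<times> {0<..})" "K \<subseteq> \<Union>\<F>"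
    using compactinD[OF K, of "U ` (\<H> \<times> {0<..})"] by blast
  obtain J0 where J0: "finite J0" "J0 \<subseteq> \<H> \<times> {0<..}" "\<F> = U ` J0"
    using finite_subset_image[OF \<F>(1,2)] by blast
  \<comment> \<open>The square of the oscillation of \<open>G\<close> never exceeds \<open>(2 M)^2\<close>, so this weight suffices where
    the oscillation of \<open>h\<close> has square at least \<open>d\<close>.\<close>
  define w where "w = (\<lambda>(h::'a \<Rightarrow> real, d). (h, (2 * M)\<^sup>2 / d))"
  have inj: "inj_on w J0"
    using J0(2) M(1) by (auto simp: inj_on_def w_def)
  show ?thesis
  proof (intro exI conjI ballI)
    show "finite (w ` J0)" using J0 by simp
    show "fst ` w ` J0 \<subseteq> \<H>" using J0(2) by (auto simp: w_def)
    fix a b assume ab: "a \<in> topspace X" "b \<in> topspace X"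
    have eq: "(\<Sum>j\<in>w ` J0. snd j * (fst j a - fst j b)\<^sup>2) = (\<Sum>j\<in>J0. snd (w j) * D (fst j) (a, b))"
      by (subst sum.reindex[OF inj]) (auto simp: w_def D_def intro!: sum.cong split: prod.split)
    have nn: "0 \<le> snd (w j) * D (fst j) (a, b)" if "j \<in> J0" for j
      using J0(2) that by (auto simp: w_def D_def split: prod.split)
    show "(G a - G b)\<^sup>2 \<le> e + (\<Sum>j\<in>w ` J0. snd j * (fst j a - fst j b)\<^sup>2)"
    proof (cases "(a, b) \<in> K")
      case True
      then obtain h d where hd: "(h, d) \<in> J0" "(a, b) \<in> U (h, d)"
        using \<F>(3) J0(3) by auto
      then have d: "0 < d" "d < D h (a, b)" using J0(2) by (auto simp: U_def)
      have "\<bar>G a - G b\<bar> \<le> 2 * M" using M(2)[OF ab(1)] M(2)[OF ab(2)] by linarith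
      then have "(G a - G b)\<^sup>2 \<le> (2 * M)\<^sup>2" by (metis abs_ge_zero power2_abs power_mono)
      also have "\<dots> = (2 * M)\<^sup>2 / d * d" using d by simp
      also have "\<dots> \<le> (2 * M)\<^sup>2 / d * D h (a, b)" using d by (intro mult_left_mono) auto
      also have "\<dots> = snd (w (h, d)) * D (fst (h, d)) (a, b)" by (simp add: w_def)
      also have "\<dots> \<le> (\<Sum>j\<in>J0. snd (w j) * D (fst j) (a, b))"
        by (rule member_le_sum[OF hd(1)]) (use nn J0 in auto)
      finally show ?thesis using eq e by simp
    next
      case False
      then have "(G a - G b)\<^sup>2 < e" using ab by (simp add: K_def D_def not_le)
      moreover have "0 \<le> (\<Sum>j\<in>J0. snd (w j) * D (fst j) (a, b))"
        by (rule sum_nonneg) (rule nn)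
      ultimately show ?thesis using eq by simp
    qed
  qed
qed

text \<open>
  The modulus above bounds the mean square oscillation of \<open>G\<close> by those of finitely many
  members of \<open>\<H>\<close>, up to an arbitrarily small error.
\<close>

lemma recurrent_in_mean_separating:
  assumes X: "compact_space X" and x: "\<And>n. x n \<in> topspace X"
    and cont: "\<forall>h\<in>\<H>. continuous_map X euclideanreal h"
    and sep: "\<forall>a\<in>topspace X. \<forall>b\<in>topspace X. a \<noteq> b \<longrightarrow> (\<exists>h\<in>\<H>. h a \<noteq> h b)"
    and rec: "\<forall>h\<in>\<H>. recurrent_in_mean p (\<lambda>n. h (x n))"
    and G: "continuous_map X euclideanreal G"
  shows "recurrent_in_mean p (\<lambda>n. G (x n))"
  unfolding recurrent_in_mean_def
proof
  obtain M where "0 < M" and M: "\<And>a. a \<in> topspace X \<Longrightarrow> \<bar>G a\<bar> \<le> M"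
    using continuous_map_compact_bounded[OF X G] by metis
  then show bG: "bounded_seq (\<lambda>n. G (x n))" using x by (intro bounded_seqI[of _ M]) auto
  have bd: "bounded_seq (\<lambda>n. (f (x (n + k)) - f (x n))\<^sup>2)" if "bounded_seq (\<lambda>n. f (x n))" for f k
    by (intro bounded_seq_intros that bounded_seq_reindex[OF that])
  define m where "m f k = mean (\<lambda>n. (f (x (n + k)) - f (x n))\<^sup>2)" for f k
  have m0: "0 \<le> m G k" for k unfolding m_def by (intro mean_nonneg bd bG) auto
  show "((\<lambda>k. mean (\<lambda>n. (G (x (n + k)) - G (x n))\<^sup>2)) \<longlongrightarrow> 0) p"
    unfolding m_def[symmetric]
  proof (rule tendstoI)
    fix e :: real assume "0 < e"
    then have "0 < e / 2" by simp
    from separating_modulus[OF X cont sep G this] obtain J where J: "finite J" "fst ` J \<subseteq> \<H>" and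
      le: "\<forall>a\<in>topspace X. \<forall>b\<in>topspace X.
        (G a - G b)\<^sup>2 \<le> e / 2 + (\<Sum>j\<in>J. snd j * (fst j a - fst j b)\<^sup>2)"
      by blast
    have bJ: "bounded_seq (\<lambda>n. fst j (x n))" if "j \<in> J" for j
      using rec J(2) that by (auto simp: recurrent_in_mean_def)
    have bs: "bounded_seq (\<lambda>n. snd j * (fst j (x (n + k)) - fst j (x n))\<^sup>2)" if "j \<in> J" for j k
      by (intro bounded_seq_mult bounded_seq_const bd bJ that)
    have bound: "m G k \<le> e / 2 + (\<Sum>j\<in>J. snd j * m (fst j) k)" for k
    proof -
      have "m G k \<le> mean (\<lambda>n. e / 2 + (\<Sum>j\<in>J. snd j * (fst j (x (n + k)) - fst j (x n))\<^sup>2))"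
        unfolding m_def
        by (intro mean_mono bd bG bounded_seq_add bounded_seq_const bounded_seq_sum bs le[rule_format] x)
      also have "\<dots> = e / 2 + (\<Sum>j\<in>J. snd j * m (fst j) k)"
        by (simp add: mean_add bounded_seq_const bounded_seq_sum bs mean_sum mean_cmult bd bJ m_def)
      finally show ?thesis .
    qed
    have "((\<lambda>k. e / 2 + (\<Sum>j\<in>J. snd j * m (fst j) k)) \<longlongrightarrow> e / 2 + (\<Sum>j\<in>J. snd j * 0)) p"
      using rec J(2) by (intro tendsto_intros) (auto simp: recurrent_in_mean_def m_def)
    then have "eventually (\<lambda>k. e / 2 + (\<Sum>j\<in>J. snd j * m (fst j) k) < e) p"
      by (rule order_tendstoD(2)) (use \<open>0 < e\<close> in simp)
    then show "eventually (\<lambda>k. dist (m G k) 0 < e) p"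
    proof eventually_elim
      case (elim k)
      then show ?case using bound[of k] m0[of k] by (simp add: dist_real_def)
    qed
  qed
qed

section \<open>Recurrence of affine coefficients\<close>

text \<open>
  The codomain may differ from the domain, so that the notion covers affine functionals as well as the affine maps
  of \<^const>\<open>affine_on\<close>.
\<close>

definition affine_map_on :: "'q::real_vector set \<Rightarrow> ('q \<Rightarrow> 'r::real_vector) \<Rightarrow> bool" where
  "affine_map_on S g \<longleftrightarrow>
     (\<forall>x\<in>S. \<forall>y\<in>S. \<forall>t\<in>{0..1}.
        g ((1 - t) *\<^sub>R x + t *\<^sub>R y) = (1 - t) *\<^sub>R g x + t *\<^sub>R g y)"

lemma affine_map_on_sum:
  assumes "convex S" "affine_map_on S g" "finite I" "sum a I = 1"
    and "\<And>i. i \<in> I \<Longrightarrow> 0 \<le> a i" "\<And>i. i \<in> I \<Longrightarrow> y i \<in> S"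
  shows "g (\<Sum>i\<in>I. a i *\<^sub>R y i) = (\<Sum>i\<in>I. a i *\<^sub>R g (y i))"
  using assms(3-6)
proof (induction I arbitrary: a rule: finite_induct)
  case (insert i I)
  have nn: "0 \<le> sum a I" by (rule sum_nonneg) (use insert in auto)
  have ai: "a i = 1 - sum a I" using insert by simp
  show ?case
  proof (cases "sum a I = 0")
    case True
    then have "\<forall>j\<in>I. a j = 0"
      using insert by (subst (asm) sum_nonneg_eq_0_iff) auto
    then show ?thesis using insert ai True by simp
  next
    case False
    let ?b = "\<lambda>j. a j / sum a I"
    have b: "sum ?b I = 1" "\<And>j. j \<in> I \<Longrightarrow> 0 \<le> ?b j"
      using False insert nn by (auto simp: sum_divide_distrib[symmetric])
    have IH: "g (\<Sum>j\<in>I. ?b j *\<^sub>R y j) = (\<Sum>j\<in>I. ?b j *\<^sub>R g (y j))"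
      using insert b by simp
    have "(\<Sum>j\<in>I. ?b j *\<^sub>R y j) \<in> S"
      using insert b by (intro convex_sum[OF _ assms(1)]) auto
    moreover have "y i \<in> S" "sum a I \<in> {0..1}"
      using insert.prems(3)[of i] insert.prems(2)[of i] nn ai by auto
    ultimately have "g ((1 - sum a I) *\<^sub>R y i + sum a I *\<^sub>R (\<Sum>j\<in>I. ?b j *\<^sub>R y j))
        = (1 - sum a I) *\<^sub>R g (y i) + sum a I *\<^sub>R g (\<Sum>j\<in>I. ?b j *\<^sub>R y j)"
      using assms(2) unfolding affine_map_on_def by blast
    then show ?thesis
      using insert False unfolding IH by (simp add: scaleR_sum_right ai[symmetric])
  qed
qed simp

lemma affine_map_on_compose:
  assumes "affine_map_on S f" "f ` S \<subseteq> S" "affine_map_on S g"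
  shows "affine_map_on S (\<lambda>x. g (f x))"
  using assms unfolding affine_map_on_def by (simp add: image_subset_iff)

text \<open>
  Only points in the image of \<open>A\<close> have to be recurrent: in the application to operator
  semigroups the powers of \<open>A\<close> converge to an idempotent that need not be the identity.  The
  weights are \<open>f\<close> plus a constant that makes them positive; the constant contributes to the
  correlations a term that does not depend on the shift.
\<close>

theorem recurrent_in_mean_affine:
  fixes Q :: "'q::real_vector topology"
  assumes Q: "compact_space Q" "convex (topspace Q)"
    and A: "continuous_map Q Q A" "affine_map_on (topspace Q) A"
    and l: "continuous_map Q euclideanreal l" "affine_map_on (topspace Q) l"
    and rec: "\<And>q. q \<in> topspace Q \<Longrightarrow> limitin Q (\<lambda>k. (A ^^ k) (A q)) (A q) p"
    and x: "x \<in> topspace Q"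
  shows "recurrent_in_mean p (\<lambda>n. l ((A ^^ Suc n) x))"
proof -
  define f where "f n = l ((A ^^ Suc n) x)" for n
  have AQ: "(A ^^ n) y \<in> topspace Q" if "y \<in> topspace Q" for n y
    using that A(1) by (induction n) (auto simp: continuous_map_def)
  obtain M where M: "0 < M" "\<And>y. y \<in> topspace Q \<Longrightarrow> \<bar>l y\<bar> \<le> M"
    using continuous_map_compact_bounded[OF Q(1) l(1)] by metis
  have fM: "\<bar>f n\<bar> \<le> M" for n unfolding f_def by (rule M(2)[OF AQ[OF x]])
  then have bf: "bounded_seq f" by (rule bounded_seqI)
  have bfk: "bounded_seq (\<lambda>n. f (n + k))" for k by (rule bounded_seq_reindex[OF bf])
  define g where "g n = f n + (M + 1)" for n
  have g1: "1 \<le> g n" for n using fM[of n] by (simp add: g_def abs_le_iff)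
  have bg: "bounded_seq g" unfolding g_def by (intro bounded_seq_intros bf)
  have mg: "1 \<le> mean g" using mean_mono[of "\<lambda>_. 1" g] g1 bg bounded_seq_const by simp
  define s where "s N = (\<Sum>n<N. g n)" for N
  have s: "real N \<le> s N" for N
    using sum_mono[of "{..<N}" "\<lambda>_. 1" g] g1 by (simp add: s_def)
  \<comment> \<open>For the limit \<open>q\<close> of these averages, \<open>A q\<close> represents the functional
    \<open>d \<mapsto> mean (g d) / mean g\<close> on the coefficients.\<close>
  define y where "y N = (\<Sum>n<N. (g n / s N) *\<^sub>R (A ^^ n) x)" for N
  have w: "sum (\<lambda>n. g n / s N) {..<N} = 1" "\<And>n. 0 \<le> g n / s N" if "0 < N" for N
  proof -
    have "0 < s N" using s[of N] that by simp
    then show "sum (\<lambda>n. g n / s N) {..<N} = 1" "\<And>n. 0 \<le> g n / s N"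
      using order_trans[OF zero_le_one g1] by (auto simp: s_def sum_divide_distrib[symmetric])
  qed
  have yQ: "y N \<in> topspace Q" if "0 < N" for N
    unfolding y_def using w[OF that] AQ[OF x] by (intro convex_sum[OF _ Q(2)]) auto
  have pos: "eventually (\<lambda>N. 0 < N) mean_filter"
    using eventually_gt_at_top[of "0::nat"] mean_filter(2) by (simp add: le_filter_def)
  then have "eventually (\<lambda>N. y N \<in> topspace Q) mean_filter"
    by eventually_elim (rule yQ)
  then obtain q where q: "q \<in> topspace Q" "limitin Q y q mean_filter"
    using ultrafilter_limitin[OF mean_filter(1)] Q(1) unfolding compact_space_def by blast
  have val: "l ((A ^^ k) (A q)) = mean (\<lambda>n. g n * f (n + k)) / mean g" for k
  proof -
    have "continuous_map Q Q (A ^^ k)" for k :: nat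
    proof (induction k)
      case (Suc k)
      from continuous_map_compose[OF Suc A(1)] show ?case by (simp add: o_def)
    qed (simp add: id_def[symmetric])
    then have c: "continuous_map Q euclideanreal (\<lambda>z. l ((A ^^ Suc k) z))"
      using continuous_map_compose[OF \<open>continuous_map Q Q (A ^^ Suc k)\<close> l(1)] by (simp only: o_def)
    have "affine_map_on (topspace Q) (A ^^ k)" for k
    proof (induction k)
      case (Suc k)
      have "affine_map_on (topspace Q) (\<lambda>z. A ((A ^^ k) z))"
        by (rule affine_map_on_compose[OF Suc _ A(2)]) (use AQ in blast)
      then show ?case by (simp add: o_def)
    qed (simp add: affine_map_on_def)
    then have a: "affine_map_on (topspace Q) (\<lambda>z. l ((A ^^ Suc k) z))"
      by (intro affine_map_on_compose[OF _ _ l(2)]) (use AQ in blast)+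
    have "l ((A ^^ Suc k) (y N)) = cesaro (\<lambda>n. g n * f (n + k)) N / cesaro g N" if N: "0 < N" for N
    proof -
      have "l ((A ^^ Suc k) (y N)) = (\<Sum>n<N. (g n / s N) *\<^sub>R l ((A ^^ Suc k) ((A ^^ n) x)))"
        unfolding y_def by (rule affine_map_on_sum[OF Q(2) a]) (use w[OF N] AQ[OF x] in auto)
      also have "\<dots> = (\<Sum>n<N. g n * f (n + k)) / s N"
      proof -
        have "(A ^^ Suc k) ((A ^^ n) x) = (A ^^ Suc (n + k)) x" for n
        proof -
          have "(A ^^ Suc k) ((A ^^ n) x) = (A ^^ (Suc k + n)) x" by (simp only: funpow_add o_apply)
          then show ?thesis by (simp add: add.commute[of n])
        qed
        then show ?thesis unfolding f_def by (simp add: sum_divide_distrib)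
      qed
      finally show ?thesis using N by (simp add: cesaro_def s_def)
    qed
    then have ev: "eventually (\<lambda>N. l ((A ^^ Suc k) (y N)) = cesaro (\<lambda>n. g n * f (n + k)) N / cesaro g N) mean_filter"
      using pos by (auto elim: eventually_mono)
    have "((\<lambda>N. cesaro (\<lambda>n. g n * f (n + k)) N / cesaro g N) \<longlongrightarrow> mean (\<lambda>n. g n * f (n + k)) / mean g) mean_filter"
      using mg by (intro tendsto_divide cesaro_tendsto_mean bounded_seq_mult bg bfk) auto
    moreover have "((\<lambda>N. l ((A ^^ Suc k) (y N))) \<longlongrightarrow> l ((A ^^ Suc k) q)) mean_filter"
      using continuous_map_limit[OF c q(2)] by (simp add: o_def)
    ultimately have "l ((A ^^ Suc k) q) = mean (\<lambda>n. g n * f (n + k)) / mean g"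
      using tendsto_unique[OF mean_filter_neq_bot] tendsto_cong[OF ev] by blast
    then show ?thesis by (simp add: funpow_swap1)
  qed
  have split: "mean (\<lambda>n. f n * f (n + k)) = l ((A ^^ k) (A q)) * mean g - (M + 1) * mean f" for k
  proof -
    have "(\<lambda>n. g n * f (n + k)) = (\<lambda>n. f n * f (n + k) + (M + 1) * f (n + k))"
      by (simp add: g_def algebra_simps)
    then have "mean (\<lambda>n. g n * f (n + k)) = mean (\<lambda>n. f n * f (n + k)) + (M + 1) * mean f"
      by (simp only: mean_add mean_cmult bounded_seq_mult bounded_seq_const bf bfk mean_shift)
    then show ?thesis using val[of k] mg by simp
  qed
  have "((\<lambda>k. l ((A ^^ k) (A q))) \<longlongrightarrow> l (A q)) p"
    using continuous_map_limit[OF l(1) rec[OF q(1)]] by (simp add: o_def)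
  then have "((\<lambda>k. mean (\<lambda>n. f n * f (n + k))) \<longlongrightarrow> mean (\<lambda>n. f n * f n)) p"
    unfolding split using split[of 0] by (auto intro!: tendsto_intros)
  then have "recurrent_in_mean p f" by (rule recurrent_in_meanI[OF bf])
  then show ?thesis by (simp only: f_def[abs_def])
qed

section \<open>Idempotents in compact right topological semigroups\<close>

lemma finite_chain_Inter_in:
  assumes "finite F" "F \<noteq> {}" "\<And>a b. a \<in> F \<Longrightarrow> b \<in> F \<Longrightarrow> a \<subseteq> b \<or> b \<subseteq> a"
  shows "\<Inter>F \<in> F"
  using assms
proof (induction F rule: finite_ne_induct)
  case (insert a F)
  then have "\<Inter>F \<in> F" by blast
  then have "a \<subseteq> \<Inter>F \<or> \<Inter>F \<subseteq> a" using insert.prems by blast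
  then have "\<Inter>(insert a F) = a \<or> \<Inter>(insert a F) = \<Inter>F" by auto
  then show ?case using \<open>\<Inter>F \<in> F\<close> by (elim disjE) (simp_all only: insert_iff, blast+)
qed simp

text \<open>
  The Ellis-Numakura lemma.  In a minimal closed subsemigroup \<open>K\<close> with \<open>u \<in> K\<close>, both \<open>K u\<close> and
  \<open>{z \<in> K. z u = u}\<close> are closed subsemigroups, hence equal to \<open>K\<close>.
\<close>

theorem ellis_idempotent:
  assumes X: "compact_space X" "Hausdorff_space X"
    and assoc: "\<And>x y z. x \<in> topspace X \<Longrightarrow> y \<in> topspace X \<Longrightarrow> z \<in> topspace X \<Longrightarrow>
      m (m x y) z = m x (m y z)"
    and cont: "\<And>y. y \<in> topspace X \<Longrightarrow> continuous_map X X (\<lambda>x. m x y)"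
    and C: "closedin X C" "C \<noteq> {}" "\<And>x y. x \<in> C \<Longrightarrow> y \<in> C \<Longrightarrow> m x y \<in> C"
  shows "\<exists>u\<in>C. m u u = u"
proof -
  define \<A> where "\<A> = {K. closedin X K \<and> K \<noteq> {} \<and> K \<subseteq> C \<and> (\<forall>x\<in>K. \<forall>y\<in>K. m x y \<in> K)}"
  have "\<exists>K\<in>\<A>. \<forall>L\<in>\<A>. L \<subseteq> K \<longrightarrow> L = K"
  proof (rule predicate_Zorn)
    show "partial_order_on \<A> (relation_of (\<lambda>a b. b \<subseteq> a) \<A>)"
      by (rule partial_order_on_relation_ofI) auto
    fix Ch assume Ch: "Ch \<in> Chains (relation_of (\<lambda>a b. b \<subseteq> a) \<A>)"
    then have sub: "Ch \<subseteq> \<A>" and lin: "\<And>a b. a \<in> Ch \<Longrightarrow> b \<in> Ch \<Longrightarrow> a \<subseteq> b \<or> b \<subseteq> a"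
      by (auto simp: Chains_def relation_of_def)
    show "\<exists>u\<in>\<A>. \<forall>a\<in>Ch. u \<subseteq> a"
    proof (cases "Ch = {}")
      case True
      then show ?thesis using C by (auto simp: \<A>_def)
    next
      case False
      have "\<Inter>F \<noteq> {}" if "finite F" "F \<subseteq> Ch" for F
      proof (cases "F = {}")
        case False
        then have "\<Inter>F \<in> F" using that lin by (intro finite_chain_Inter_in) blast+
        then show ?thesis using that sub by (auto simp: \<A>_def)
      qed simp
      moreover have "\<forall>K\<in>Ch. closedin X K" using sub by (auto simp: \<A>_def)
      ultimately have "\<Inter>Ch \<noteq> {}" using X(1)[unfolded compact_space_fip, rule_format, of Ch] by simp
      moreover have "closedin X (\<Inter>Ch)" using sub False by (auto simp: \<A>_def)
      moreover have "\<Inter>Ch \<subseteq> C" using sub False by (auto simp: \<A>_def)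
      moreover have "m x y \<in> \<Inter>Ch" if "x \<in> \<Inter>Ch" "y \<in> \<Inter>Ch" for x y
        using sub that by (auto simp: \<A>_def)
      ultimately have "\<Inter>Ch \<in> \<A>" by (simp add: \<A>_def)
      then show ?thesis by blast
    qed
  qed
  then obtain K where KA: "K \<in> \<A>" and min': "\<forall>L\<in>\<A>. L \<subseteq> K \<longrightarrow> L = K" by blast
  then have min: "L = K" if "L \<in> \<A>" "L \<subseteq> K" for L using that by blast
  from KA have K: "closedin X K" "K \<noteq> {}" "K \<subseteq> C" and Km: "\<And>x y. x \<in> K \<Longrightarrow> y \<in> K \<Longrightarrow> m x y \<in> K"
    by (auto simp: \<A>_def)
  have KX: "K \<subseteq> topspace X" using K(1) closedin_subset by blast
  obtain u where u: "u \<in> K" using K by blast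
  have uX: "u \<in> topspace X" using u KX by blast
  have Ku: "(\<lambda>x. m x u) ` K = K"
  proof (rule min)
    have "compactin X ((\<lambda>x. m x u) ` K)"
      by (rule image_compactin[OF closedin_compact_space[OF X(1) K(1)] cont[OF uX]])
    then have "closedin X ((\<lambda>x. m x u) ` K)" using X(2) compactin_imp_closedin by blast
    moreover have sub: "(\<lambda>x. m x u) ` K \<subseteq> K" using Km u by blast
    moreover have "m (m x u) (m y u) \<in> (\<lambda>x. m x u) ` K" if xy: "x \<in> K" "y \<in> K" for x y
    proof -
      have "m (m x u) (m y u) = m (m (m x u) y) u"
        using assoc[of "m x u" y u] Km[OF xy(1) u] xy uX KX by (simp add: subset_iff)
      moreover have "m (m x u) y \<in> K" by (intro Km xy u)
      ultimately show ?thesis by (rule image_eqI)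
    qed
    moreover have "(\<lambda>x. m x u) ` K \<noteq> {}" using K(2) by simp
    ultimately show "(\<lambda>x. m x u) ` K \<in> \<A>" using K(3) unfolding \<A>_def by blast
    show "(\<lambda>x. m x u) ` K \<subseteq> K" by (rule sub)
  qed
  have "u \<in> (\<lambda>x. m x u) ` K" using Ku u by simp
  then obtain x where x: "x \<in> K" "m x u = u" by auto
  have "{z \<in> K. m z u = u} = K"
  proof (rule min)
    have eq: "{z \<in> K. m z u = u} = K \<inter> {z \<in> topspace X. m z u \<in> {u}}" using KX by auto
    have "closedin X {z \<in> topspace X. m z u \<in> {u}}"
      by (rule closedin_continuous_map_preimage[OF cont[OF uX]])
        (simp add: closedin_Hausdorff_singleton X uX)
    then have "closedin X {z \<in> K. m z u = u}" unfolding eq using K(1) by blast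
    moreover have "m a b \<in> {z \<in> K. m z u = u}" if ab: "a \<in> K" "b \<in> K" "m a u = u" "m b u = u" for a b
      using assoc[of a b u] Km[OF ab(1,2)] ab KX uX by auto
    moreover have "{z \<in> K. m z u = u} \<noteq> {}" "{z \<in> K. m z u = u} \<subseteq> C" using x K(3) by auto
    ultimately show "{z \<in> K. m z u = u} \<in> \<A>"
      unfolding \<A>_def by (intro CollectI conjI ballI) auto
  qed blast
  then have "m u u = u" using u by blast
  then show ?thesis using u K by blast
qed

section \<open>The Hahn-Banach theorem\<close>

text \<open>
  The inequality \<open>p (c x) \<le> c p x\<close> for all \<open>c > 0\<close> already implies equality.
\<close>

definition sublinear :: "('v::real_vector \<Rightarrow> real) \<Rightarrow> bool" where
  "sublinear p \<longleftrightarrow>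
     (\<forall>x y. p (x + y) \<le> p x + p y) \<and> p 0 = 0 \<and> (\<forall>c>0. \<forall>x. p (c *\<^sub>R x) \<le> c * p x)"

lemma sublinear_scaleR:
  assumes "sublinear p" "0 < c" shows "p (c *\<^sub>R x) = c * p x"
proof (rule antisym)
  show "p (c *\<^sub>R x) \<le> c * p x" using assms by (auto simp: sublinear_def)
  have "p ((1 / c) *\<^sub>R (c *\<^sub>R x)) \<le> (1 / c) * p (c *\<^sub>R x)"
    using assms unfolding sublinear_def by (metis zero_less_divide_1_iff)
  then show "c * p x \<le> p (c *\<^sub>R x)" using assms(2) by (simp add: field_simps)
qed

lemma sublinear_minus: "sublinear p \<Longrightarrow> - p (- x) \<le> p x"
proof -
  assume p: "sublinear p"
  then have "p (x + - x) \<le> p x + p (- x)" "p 0 = 0" unfolding sublinear_def by blast+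
  then show ?thesis by simp
qed

definition sublinear_reduction :: "('v::real_vector \<Rightarrow> real) \<Rightarrow> 'v \<Rightarrow> 'v \<Rightarrow> real" where
  "sublinear_reduction q y x = (INF t\<in>{0..}. q (x + t *\<^sub>R y) - t * q y)"

lemma sublinear_reduction:
  assumes q: "sublinear q"
  shows "sublinear (sublinear_reduction q y)"
    and "0 \<le> t \<Longrightarrow> sublinear_reduction q y x \<le> q (x + t *\<^sub>R y) - t * q y"
proof -
  have lower: "- q (- x) \<le> q (x + t *\<^sub>R y) - t * q y" if "0 \<le> t" for x t
  proof -
    have "q (t *\<^sub>R y) = t * q y"
      using sublinear_scaleR[OF q, of t y] that q by (cases "t = 0") (auto simp: sublinear_def)
    moreover have "q ((x + t *\<^sub>R y) + - x) \<le> q (x + t *\<^sub>R y) + q (- x)"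
      using q unfolding sublinear_def by blast
    ultimately show ?thesis by simp
  qed
  have upper: "sublinear_reduction q y x \<le> q (x + t *\<^sub>R y) - t * q y" if "0 \<le> t" for x t
    unfolding sublinear_reduction_def
    using that lower[of _ x] by (intro cINF_lower) (auto intro!: bdd_belowI2)
  then show "0 \<le> t \<Longrightarrow> sublinear_reduction q y x \<le> q (x + t *\<^sub>R y) - t * q y" .
  have greatest: "L \<le> sublinear_reduction q y x"
    if "\<And>t. 0 \<le> t \<Longrightarrow> L \<le> q (x + t *\<^sub>R y) - t * q y" for L x
    unfolding sublinear_reduction_def using that by (intro cINF_greatest) auto
  show "sublinear (sublinear_reduction q y)"
    unfolding sublinear_def
  proof (intro conjI allI impI)
    fix a b
    have "sublinear_reduction q y (a + b) - (q (b + s *\<^sub>R y) - s * q y) \<le> q (a + t *\<^sub>R y) - t * q y"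
      if "0 \<le> s" "0 \<le> t" for s t
    proof -
      have "sublinear_reduction q y (a + b) \<le> q ((a + b) + (t + s) *\<^sub>R y) - (t + s) * q y"
        using that by (intro upper) simp
      also have "(a + b) + (t + s) *\<^sub>R y = (a + t *\<^sub>R y) + (b + s *\<^sub>R y)"
        by (simp add: algebra_simps)
      finally have "sublinear_reduction q y (a + b) \<le> q ((a + t *\<^sub>R y) + (b + s *\<^sub>R y)) - (t + s) * q y" .
      moreover have "q ((a + t *\<^sub>R y) + (b + s *\<^sub>R y)) \<le> q (a + t *\<^sub>R y) + q (b + s *\<^sub>R y)"
        using q unfolding sublinear_def by blast
      ultimately show ?thesis by (simp add: algebra_simps)
    qed
    then have "sublinear_reduction q y (a + b) - (q (b + s *\<^sub>R y) - s * q y) \<le> sublinear_reduction q y a"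
      if "0 \<le> s" for s using that by (intro greatest) auto
    then have "sublinear_reduction q y (a + b) - sublinear_reduction q y a \<le> sublinear_reduction q y b"
      by (intro greatest) (force simp: algebra_simps)
    then show "sublinear_reduction q y (a + b) \<le> sublinear_reduction q y a + sublinear_reduction q y b"
      by simp
  next
    show "sublinear_reduction q y 0 = 0"
    proof (rule antisym)
      show "sublinear_reduction q y 0 \<le> 0" using upper[of 0 0] q by (simp add: sublinear_def)
      show "0 \<le> sublinear_reduction q y 0"
        using lower[of _ 0] q by (intro greatest) (simp add: sublinear_def)
    qed
  next
    fix c :: real and x assume c: "0 < c"
    have "sublinear_reduction q y (c *\<^sub>R x) / c \<le> sublinear_reduction q y x"
    proof (rule greatest)
      fix t :: real assume "0 \<le> t"
      then have "sublinear_reduction q y (c *\<^sub>R x) \<le> q (c *\<^sub>R x + (c * t) *\<^sub>R y) - (c * t) * q y"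
        using c by (intro upper) simp
      also have "c *\<^sub>R x + (c * t) *\<^sub>R y = c *\<^sub>R (x + t *\<^sub>R y)" by (simp add: algebra_simps)
      finally have "sublinear_reduction q y (c *\<^sub>R x) \<le> c * (q (x + t *\<^sub>R y) - t * q y)"
        by (simp only: sublinear_scaleR[OF q c] right_diff_distrib mult.assoc)
      then show "sublinear_reduction q y (c *\<^sub>R x) / c \<le> q (x + t *\<^sub>R y) - t * q y"
        using c by (simp add: field_simps)
    qed
    then show "sublinear_reduction q y (c *\<^sub>R x) \<le> c * sublinear_reduction q y x"
      using c by (simp add: field_simps)
  qed
qed

text \<open>
  Minimal sublinear functionals are linear: if \<open>l\<close> is minimal, then it coincides with its reduction
  at each \<open>y\<close>, which gives \<open>l x \<le> l (x + y) - l y\<close>, the missing half of additivity.  The value at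
  \<open>z\<close> is prescribed by starting Zorn's lemma below the reduction of \<open>p\<close> at \<open>z\<close>.
\<close>

theorem hahn_banach_sublinear:
  fixes p :: "'v::real_vector \<Rightarrow> real"
  assumes p: "sublinear p"
  shows "\<exists>l. linear l \<and> (\<forall>x. l x \<le> p x) \<and> l z = p z"
proof -
  define p' where "p' = sublinear_reduction p z"
  have p': "sublinear p'" unfolding p'_def by (rule sublinear_reduction(1)[OF p])
  have p'p: "p' x \<le> p x" for x using sublinear_reduction(2)[OF p, of 0 z x] by (simp add: p'_def)
  have p'z: "p' (- z) \<le> - p z"
    using sublinear_reduction(2)[OF p, of 1 z "- z"] p by (simp add: p'_def sublinear_def)
  define \<A> where "\<A> = {q. sublinear q \<and> (\<forall>x. q x \<le> p' x)}"
  have "\<exists>q\<in>\<A>. \<forall>r\<in>\<A>. (\<forall>x. r x \<le> q x) \<longrightarrow> r = q"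
  proof (rule predicate_Zorn)
    show "partial_order_on \<A> (relation_of (\<lambda>a b. \<forall>x. b x \<le> a x) \<A>)"
      by (rule partial_order_on_relation_ofI) (auto intro: order_trans antisym simp: fun_eq_iff)
    fix Ch assume Ch: "Ch \<in> Chains (relation_of (\<lambda>a b. \<forall>x. b x \<le> a x) \<A>)"
    then have sub: "Ch \<subseteq> \<A>"
      and lin: "\<And>a b. a \<in> Ch \<Longrightarrow> b \<in> Ch \<Longrightarrow> (\<forall>x. a x \<le> b x) \<or> (\<forall>x. b x \<le> a x)"
      by (auto simp: Chains_def relation_of_def)
    show "\<exists>u\<in>\<A>. \<forall>a\<in>Ch. \<forall>x. u x \<le> a x"
    proof (cases "Ch = {}")
      case True
      then show ?thesis using p' by (auto simp: \<A>_def)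
    next
      case False
      define u where "u x = (INF q\<in>Ch. q x)" for x
      have slin: "sublinear q" if "q \<in> Ch" for q using that sub by (auto simp: \<A>_def)
      have "- p' (- x) \<le> q x" if "q \<in> Ch" for q x
      proof -
        have "q (- x) \<le> p' (- x)" using sub that by (auto simp: \<A>_def)
        then show ?thesis using sublinear_minus[OF slin[OF that], of x] by linarith
      qed
      then have lower: "u x \<le> q x" if "q \<in> Ch" for q x
        unfolding u_def using that by (intro cINF_lower bdd_belowI2[of _ "- p' (- x)"]) auto
      have greatest: "L \<le> u x" if "\<And>q. q \<in> Ch \<Longrightarrow> L \<le> q x" for L x
        unfolding u_def using False that by (intro cINF_greatest) auto
      have "sublinear u"
        unfolding sublinear_def
      proof (intro conjI allI impI)
        fix x y
        have "u (x + y) \<le> q x + r y" if qr: "q \<in> Ch" "r \<in> Ch" for q r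
        proof -
          obtain s where s: "s \<in> Ch" "s x \<le> q x" "s y \<le> r y"
            using lin[OF qr] qr by (meson order_refl)
          have "u (x + y) \<le> s (x + y)" by (rule lower[OF s(1)])
          also have "\<dots> \<le> s x + s y" using slin[OF s(1)] by (auto simp: sublinear_def)
          finally show ?thesis using s by linarith
        qed
        then have "u (x + y) - r y \<le> u x" if "r \<in> Ch" for r
          using that by (intro greatest) (simp add: diff_le_eq)
        then have "u (x + y) - u x \<le> u y"
          by (intro greatest) (simp add: diff_le_eq add.commute)
        then show "u (x + y) \<le> u x + u y" by simp
      next
        obtain q where "q \<in> Ch" using False by blast
        then have "u 0 \<le> 0" using lower[of q 0] slin[of q] by (simp add: sublinear_def)
        moreover have "0 \<le> u 0"
        proof (rule greatest)
          fix q assume "q \<in> Ch"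
          then have "q 0 = 0" using slin unfolding sublinear_def by blast
          then show "0 \<le> q 0" by simp
        qed
        ultimately show "u 0 = 0" by simp
      next
        fix c :: real and x assume c: "0 < c"
        have "u (c *\<^sub>R x) / c \<le> u x"
        proof (rule greatest)
          fix q assume q: "q \<in> Ch"
          have "u (c *\<^sub>R x) \<le> c * q x"
            using lower[OF q, of "c *\<^sub>R x"] sublinear_scaleR[OF slin[OF q] c] by simp
          then show "u (c *\<^sub>R x) / c \<le> q x" using c by (simp add: field_simps)
        qed
        then show "u (c *\<^sub>R x) \<le> c * u x" using c by (simp add: field_simps)
      qed
      moreover obtain q where "q \<in> Ch" using False by blast
      then have "u x \<le> p' x" for x using lower[of q x] sub by (force simp: \<A>_def intro: order_trans)
      ultimately have "u \<in> \<A>" by (simp add: \<A>_def)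
      then show ?thesis using lower by blast
    qed
  qed
  then obtain l where lA: "l \<in> \<A>" and min': "\<forall>r\<in>\<A>. (\<forall>x. r x \<le> l x) \<longrightarrow> r = l"
    by blast
  then have min: "r = l" if "r \<in> \<A>" "\<And>x. r x \<le> l x" for r using that by blast
  have l: "sublinear l" "\<And>x. l x \<le> p' x" using lA by (auto simp: \<A>_def)
  have add: "l (x + y) = l x + l y" for x y
  proof -
    have le: "sublinear_reduction l y x \<le> l x" for x
      using sublinear_reduction(2)[OF l(1), of 0 y x] by simp
    then have "sublinear_reduction l y \<in> \<A>"
      using sublinear_reduction(1)[OF l(1)] l(2) order_trans unfolding \<A>_def by blast
    then have "sublinear_reduction l y = l" using le by (intro min) auto
    then have "l x \<le> l (x + y) - l y" using sublinear_reduction(2)[OF l(1), of 1 y x] by simp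
    then show ?thesis using l(1) by (intro antisym) (auto simp: sublinear_def)
  qed
  have l0: "l 0 = 0" using l(1) by (simp add: sublinear_def)
  have neg: "l (- x) = - l x" for x using add[of x "- x"] l0 by simp
  have "linear l"
  proof (rule linearI)
    fix c :: real and x
    consider "0 < c" | "c = 0" | "0 < - c" by linarith
    then show "l (c *\<^sub>R x) = c *\<^sub>R l x"
    proof cases
      case 3
      then have "l ((- c) *\<^sub>R x) = - c * l x" by (rule sublinear_scaleR[OF l(1)])
      then show ?thesis using neg[of "c *\<^sub>R x"] by simp
    qed (use l0 sublinear_scaleR[OF l(1)] in auto)
  qed (rule add)
  moreover have "l x \<le> p x" for x using l(2) p'p order_trans by blast
  moreover have "p z \<le> l z" using l(2)[of "- z"] p'z neg[of z] by linarith
  ultimately show ?thesis by (intro exI[of _ l]) (auto intro: antisym)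
qed

text \<open>
  By linearity the bound on \<open>W\<close> and on \<open>- W\<close> rescales to arbitrarily small bounds near every point.
\<close>

lemma linear_continuous_map_of_bound:
  assumes T: "locally_convex_space T" and l: "linear l"
    and W: "openin T W" "0 \<in> W" and bound: "\<And>v. v \<in> W \<Longrightarrow> l v \<le> 1"
  shows "continuous_map T euclideanreal l"
proof -
  have top: "topspace T = UNIV"
    and addT: "continuous_map (prod_topology T T) T (\<lambda>(x, y). x + y)"
    and scT: "continuous_map (prod_topology euclideanreal T) T (\<lambda>(c, x). c *\<^sub>R x)"
    using T by (auto simp: locally_convex_space_def)
  have sc: "continuous_map T T (\<lambda>v. c *\<^sub>R (v + a))" for c a
  proof -
    have "continuous_map T (prod_topology T T) (\<lambda>v. (v, a))"
      by (simp add: continuous_map_pairwise o_def top)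
    from continuous_map_compose[OF this addT] have 1: "continuous_map T T (\<lambda>v. v + a)"
      by (simp add: o_def)
    have "continuous_map T (prod_topology euclideanreal T) (\<lambda>v. (c, v + a))"
      using 1 by (simp add: continuous_map_pairwise o_def)
    from continuous_map_compose[OF this scT] show ?thesis by (simp add: o_def)
  qed
  have "openin T {v \<in> topspace T. l v \<in> B}" if "open B" for B
    unfolding openin_subopen[of T "{v \<in> topspace T. l v \<in> B}"]
  proof
    fix a assume "a \<in> {v \<in> topspace T. l v \<in> B}"
    then have "l a \<in> B" by simp
    then obtain e where e: "0 < e" "\<And>r. \<bar>r - l a\<bar> < e \<Longrightarrow> r \<in> B"
      using \<open>open B\<close> unfolding open_real by blast
    define V where "V = {v \<in> topspace T. (2 / e) *\<^sub>R (v + - a) \<in> W} \<inter> {v \<in> topspace T. (- 2 / e) *\<^sub>R (v + - a) \<in> W}"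
    have "openin T V"
      unfolding V_def by (intro openin_Int openin_continuous_map_preimage[OF sc] W)
    moreover have "a \<in> V" using W by (simp add: V_def top)
    moreover have "V \<subseteq> {v \<in> topspace T. l v \<in> B}"
    proof
      fix v assume "v \<in> V"
      then have "l ((2 / e) *\<^sub>R (v + - a)) \<le> 1" "l ((- 2 / e) *\<^sub>R (v + - a)) \<le> 1"
        unfolding V_def by (auto intro: bound)
      moreover have "l (c *\<^sub>R (v + - a)) = c * (l v - l a)" for c
        using l by (simp add: linear_cmul linear_diff)
      ultimately have "(2 / e) * (l v - l a) \<le> 1" "(- 2 / e) * (l v - l a) \<le> 1" by metis+
      then have "\<bar>l v - l a\<bar> < e" using e(1) by (simp add: field_simps)
      then show "v \<in> {v \<in> topspace T. l v \<in> B}" using e by (simp add: top)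
    qed
    ultimately show "\<exists>V. openin T V \<and> a \<in> V \<and> V \<subseteq> {v \<in> topspace T. l v \<in> B}" by blast
  qed
  then show ?thesis by (simp add: continuous_map_def)
qed

text \<open>
  Apply the Hahn-Banach theorem to the Minkowski gauge of a convex neighbourhood of \<open>0\<close> that
  misses \<open>x - y\<close>.
\<close>

theorem continuous_dual_separates_points:
  assumes T: "locally_convex_space T" and "x \<noteq> y"
  shows "\<exists>l\<in>continuous_dual T. l x \<noteq> l y"
proof -
  have top: "topspace T = UNIV" and haus: "Hausdorff_space T"
    and scT: "continuous_map (prod_topology euclideanreal T) T (\<lambda>(c, x). c *\<^sub>R x)"
    and conv: "\<And>U. openin T U \<Longrightarrow> 0 \<in> U \<Longrightarrow> \<exists>W. openin T W \<and> convex W \<and> 0 \<in> W \<and> W \<subseteq> U"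
    using T by (auto simp: locally_convex_space_def)
  define z where "z = x - y"
  have "z \<noteq> 0" using assms by (simp add: z_def)
  then obtain U U' where "openin T U" "openin T U'" "0 \<in> U" "z \<in> U'" "disjnt U U'"
    using haus top unfolding Hausdorff_space_def by (metis UNIV_I)
  then obtain W where W: "openin T W" "convex W" "0 \<in> W" "z \<notin> W"
    using conv[of U] by (auto simp: disjnt_iff)
  define S where "S v = {t. 0 < t \<and> (1 / t) *\<^sub>R v \<in> W}" for v
  define p where "p v = Inf (S v)" for v
  have absorb: "S v \<noteq> {}" for v
  proof -
    have "continuous_map euclideanreal (prod_topology euclideanreal T) (\<lambda>c. (c, v))"
      by (simp add: continuous_map_pairwise o_def top)
    from continuous_map_compose[OF this scT] have "continuous_map euclideanreal T (\<lambda>c. c *\<^sub>R v)"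
      by (simp add: o_def)
    then have "open {c. c *\<^sub>R v \<in> W}"
      using openin_continuous_map_preimage[OF _ W(1)] by fastforce
    moreover have "0 \<in> {c. c *\<^sub>R v \<in> W}" using W by simp
    ultimately obtain e where e: "0 < e" "\<And>c. \<bar>c\<bar> < e \<Longrightarrow> c *\<^sub>R v \<in> W"
      unfolding open_real by (metis (mono_tags, lifting) diff_zero mem_Collect_eq)
    then have "2 / e \<in> S v" by (simp add: S_def)
    then show ?thesis by blast
  qed
  have lower: "p v \<le> t" if "t \<in> S v" for v t
    unfolding p_def using that by (intro cInf_lower) (auto simp: S_def bdd_below_def intro: less_imp_le)
  have greatest: "L \<le> p v" if "\<And>t. t \<in> S v \<Longrightarrow> L \<le> t" for L v
    unfolding p_def using absorb that by (intro cInf_greatest)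
  have p0: "0 \<le> p v" for v by (rule greatest) (simp add: S_def)
  have "sublinear p"
    unfolding sublinear_def
  proof (intro conjI allI impI)
    fix v w
    have "p (v + w) \<le> s + t" if st: "s \<in> S v" "t \<in> S w" for s t
    proof (rule lower)
      have pos: "0 < s" "0 < t" using st by (auto simp: S_def)
      have "(s / (s + t)) *\<^sub>R ((1 / s) *\<^sub>R v) + (t / (s + t)) *\<^sub>R ((1 / t) *\<^sub>R w) \<in> W"
        using st pos by (intro convexD[OF W(2)]) (auto simp: S_def add_divide_distrib[symmetric])
      moreover have "(s / (s + t)) *\<^sub>R ((1 / s) *\<^sub>R v) + (t / (s + t)) *\<^sub>R ((1 / t) *\<^sub>R w)
          = (1 / (s + t)) *\<^sub>R (v + w)"
        using pos by (simp add: scaleR_add_right)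
      ultimately show "s + t \<in> S (v + w)" using pos by (simp add: S_def)
    qed
    then have "p (v + w) - t \<le> p v" if "t \<in> S w" for t
      using that by (intro greatest) (simp add: diff_le_eq)
    then have "p (v + w) - p v \<le> p w"
      by (intro greatest) (simp add: diff_le_eq add.commute)
    then show "p (v + w) \<le> p v + p w" by simp
  next
    have "p 0 \<le> e" if "0 < e" for e using that W by (intro lower) (simp add: S_def)
    then show "p 0 = 0" using p0[of 0] by (metis antisym_conv1 dense leD less_le_not_le)
  next
    fix c :: real and v assume c: "0 < c"
    have "p (c *\<^sub>R v) / c \<le> p v"
    proof (rule greatest)
      fix t assume "t \<in> S v"
      then have "c * t \<in> S (c *\<^sub>R v)" using c by (simp add: S_def)
      then show "p (c *\<^sub>R v) / c \<le> t" using lower c by (simp add: field_simps)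
    qed
    then show "p (c *\<^sub>R v) \<le> c * p v" using c by (simp add: field_simps)
  qed
  from hahn_banach_sublinear[OF this, of z]
  obtain l where l: "linear l" "\<And>v. l v \<le> p v" "l z = p z" by blast
  have "1 \<le> p z"
  proof (rule greatest, rule ccontr)
    fix t assume t: "t \<in> S z" "\<not> 1 \<le> t"
    then have "t *\<^sub>R ((1 / t) *\<^sub>R z) + (1 - t) *\<^sub>R 0 \<in> W"
      using W by (intro convexD[OF W(2)]) (auto simp: S_def)
    then show False using t W(4) by (simp add: S_def)
  qed
  then have "l x \<noteq> l y" using l by (auto simp: z_def linear_diff)
  moreover have "l v \<le> 1" if "v \<in> W" for v
    using l(2)[of v] lower[of 1 v] that by (simp add: S_def)
  then have "continuous_map T euclideanreal l"
    by (rule linear_continuous_map_of_bound[OF T l(1) W(1,3)])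
  ultimately show ?thesis using l(1) by (auto simp: continuous_dual_def)
qed

section \<open>The algebra of distal functions\<close>

abbreviation \<D> :: "(int \<Rightarrow>\<^sub>C real) set" where
  "\<D> \<equiv> distal_functions"

lemma apply_Bcontfun_int:
  fixes f :: "int \<Rightarrow> real"
  assumes "bounded_seq f" shows "apply_bcontfun (Bcontfun f) = f"
  using assms by (intro Bcontfun_inverse) (simp add: bcontfun_def)

lemma bounded_seq_bcontfun: "bounded_seq (apply_bcontfun f)"
  by (rule bounded_apply_bcontfun)

lemma ltrans_ltrans: "ltrans s (ltrans t f) = ltrans (s + t) (f :: int \<Rightarrow>\<^sub>C real)"
  by (rule bcontfun_eqI) (simp add: ac_simps)

lemma ltrans_0 [simp]: "ltrans 0 (f :: int \<Rightarrow>\<^sub>C real) = f"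
  by (rule bcontfun_eqI) simp

lemma ltrans_add: "ltrans s (f + g) = ltrans s f + ltrans s (g :: int \<Rightarrow>\<^sub>C real)"
  and ltrans_scaleR: "ltrans s (c *\<^sub>R f) = c *\<^sub>R ltrans s f"
  and ltrans_bmult: "ltrans s (bmult f g) = bmult (ltrans s f) (ltrans s g)"
  and ltrans_const: "ltrans s (const_bcontfun c) = const_bcontfun c"
  by (rule bcontfun_eqI; simp)+

lemma compact_systemD:
  assumes "compact_system X (a :: int \<Rightarrow> 'x \<Rightarrow> 'x)"
  shows "compact_space X" "Hausdorff_space X" "continuous_map X X (a n)"
    "x \<in> topspace X \<Longrightarrow> a n x \<in> topspace X"
    "x \<in> topspace X \<Longrightarrow> a 0 x = x"
    "x \<in> topspace X \<Longrightarrow> a (n + m) x = a n (a m x)"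
  using assms by (auto simp: compact_system_def separately_continuous_action_def action_on_def)

lemma compact_systemI:
  assumes "compact_space X" "Hausdorff_space X" "\<And>n. continuous_map X X (a n)"
    "\<And>x. x \<in> topspace X \<Longrightarrow> a 0 x = x"
    "\<And>x n m. x \<in> topspace X \<Longrightarrow> a (n + m) x = a n (a m x)"
  shows "compact_system X (a :: int \<Rightarrow> 'x \<Rightarrow> 'x)"
proof -
  have a: "a n x \<in> topspace X" if "x \<in> topspace X" for n x
    using assms(3) that by (auto simp: continuous_map_def)
  then have "continuous_map euclidean X (\<lambda>n. a n x)" if "x \<in> topspace X" for x
    using that by (auto simp: continuous_map_def open_discrete)
  then show ?thesis
    using assms a by (auto simp: compact_system_def separately_continuous_action_def action_on_def)
qed

lemma distal_systemD:
  assumes "distal_system X a" "x \<in> topspace X" "y \<in> topspace X" "F \<noteq> bot"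
    "limitin X (\<lambda>s. a s x) z F" "limitin X (\<lambda>s. a s y) z F"
  shows "x = y"
  using assms unfolding distal_system_def by blast

text \<open>
  Both functions are coefficients of the product of their systems, which is distal because limits in a product
  are taken coordinatewise.
\<close>

lemma distal_functions_comp2:
  assumes f: "f \<in> \<D>" and g: "g \<in> \<D>"
    and H: "continuous_on UNIV H" and h: "\<And>n. apply_bcontfun h n = H (apply_bcontfun f n, apply_bcontfun g n)"
  shows "h \<in> \<D>"
proof -
  obtain X :: "int set set topology" and a x0 F where
    X: "compact_system X a" "distal_system X a" "x0 \<in> topspace X"
    "continuous_map X euclideanreal F" "\<And>n. apply_bcontfun f n = F (a n x0)"
    using f unfolding distal_functions_def by blast
  obtain Y :: "int set set topology" and b y0 G where
    Y: "compact_system Y b" "distal_system Y b" "y0 \<in> topspace Y"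
    "continuous_map Y euclideanreal G" "\<And>n. apply_bcontfun g n = G (b n y0)"
    using g unfolding distal_functions_def by blast
  note X' = compact_systemD[OF X(1)] and Y' = compact_systemD[OF Y(1)]
  define c where "c n = map_prod (a n) (b n)" for n
  show ?thesis
  proof (rule distal_functions_any_carrier)
    show "compact_system (prod_topology X Y) c"
    proof (rule compact_systemI)
      show "continuous_map (prod_topology X Y) (prod_topology X Y) (c n)" for n
        using continuous_map_compose[OF continuous_map_fst X'(3)[of n]]
          continuous_map_compose[OF continuous_map_snd Y'(3)[of n]]
        unfolding continuous_map_pairwise by (auto simp: o_def c_def)
    qed (use X' Y' in \<open>auto simp: compact_space_prod_topology Hausdorff_space_prod_topology c_def\<close>)
    show "distal_system (prod_topology X Y) c"
      unfolding distal_system_def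
    proof (intro ballI impI notI)
      fix x y assume xy: "x \<in> topspace (prod_topology X Y)" "y \<in> topspace (prod_topology X Y)" "x \<noteq> y"
      assume "\<exists>\<F> z. \<F> \<noteq> bot \<and> limitin (prod_topology X Y) (\<lambda>s. c s x) z \<F>
              \<and> limitin (prod_topology X Y) (\<lambda>s. c s y) z \<F>"
      then obtain \<F> z where \<F>: "\<F> \<noteq> bot" and "limitin (prod_topology X Y) (\<lambda>s. c s x) z \<F>"
        "limitin (prod_topology X Y) (\<lambda>s. c s y) z \<F>" by (elim exE conjE)
      then have lims: "limitin X (\<lambda>s. a s (fst x)) (fst z) \<F>" "limitin X (\<lambda>s. a s (fst y)) (fst z) \<F>"
        "limitin Y (\<lambda>s. b s (snd x)) (snd z) \<F>" "limitin Y (\<lambda>s. b s (snd y)) (snd z) \<F>"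
        by (auto simp: limitin_pairwise o_def c_def)
      have "fst x = fst y"
        by (rule distal_systemD[OF X(2) _ _ \<F> lims(1,2)]) (use xy in auto)
      moreover have "snd x = snd y"
        by (rule distal_systemD[OF Y(2) _ _ \<F> lims(3,4)]) (use xy in auto)
      ultimately show False using xy(3) by (simp add: prod_eq_iff)
    qed
    show "(x0, y0) \<in> topspace (prod_topology X Y)" using X Y by simp
    show "continuous_map (prod_topology X Y) euclideanreal (\<lambda>p. H (F (fst p), G (snd p)))"
    proof -
      have "continuous_map (prod_topology X Y) (prod_topology euclideanreal euclideanreal) (\<lambda>p. (F (fst p), G (snd p)))"
        using continuous_map_compose[OF continuous_map_fst X(4)] continuous_map_compose[OF continuous_map_snd Y(4)]
        unfolding continuous_map_pairwise by (auto simp: o_def)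
      moreover have "continuous_map (prod_topology euclideanreal euclideanreal) euclideanreal H"
        using H by (simp add: continuous_map_iff_continuous2)
      ultimately have "continuous_map (prod_topology X Y) euclideanreal (H \<circ> (\<lambda>p. (F (fst p), G (snd p))))"
        by (rule continuous_map_compose)
      then show ?thesis by (simp add: o_def)
    qed
    show "apply_bcontfun h n = H (F (fst (c n (x0, y0))), G (snd (c n (x0, y0))))" for n
      using X(5) Y(5) h by (simp add: c_def)
  qed
qed

lemma const_distal [simp]: "const_bcontfun c \<in> \<D>"
proof (rule distal_functions_any_carrier)
  let ?X = "discrete_topology {()}"
  show "compact_system ?X (\<lambda>n::int. \<lambda>x. x)"
    by (rule compact_systemI) (auto simp: compact_space_discrete_topology)
  show "distal_system ?X (\<lambda>n::int. \<lambda>x. x)" by (auto simp: distal_system_def)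
  show "continuous_map ?X euclideanreal (\<lambda>_. c)" by simp
qed auto

lemma distal_add [intro]: "f \<in> \<D> \<Longrightarrow> g \<in> \<D> \<Longrightarrow> f + g \<in> \<D>"
  by (rule distal_functions_comp2[of f g "\<lambda>x. fst x + snd x"]) (auto intro!: continuous_intros)

lemma distal_bmult [intro]: "f \<in> \<D> \<Longrightarrow> g \<in> \<D> \<Longrightarrow> bmult f g \<in> \<D>"
  by (rule distal_functions_comp2[of f g "\<lambda>x. fst x * snd x"]) (auto intro!: continuous_intros)

lemma distal_scaleR [intro]: "f \<in> \<D> \<Longrightarrow> c *\<^sub>R f \<in> \<D>"
  by (rule distal_functions_comp2[of f f "\<lambda>x. c * fst x"]) (auto intro!: continuous_intros)

lemma distal_diff [intro]: "f \<in> \<D> \<Longrightarrow> g \<in> \<D> \<Longrightarrow> f - g \<in> \<D>"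
  by (rule distal_functions_comp2[of f g "\<lambda>x. fst x - snd x"]) (auto intro!: continuous_intros)

lemma distal_ltrans [intro]:
  assumes "f \<in> \<D>" shows "ltrans k f \<in> \<D>"
proof -
  obtain X :: "int set set topology" and a x0 F where
    X: "compact_system X a" "distal_system X a" "x0 \<in> topspace X"
    "continuous_map X euclideanreal F" "\<And>n. apply_bcontfun f n = F (a n x0)"
    using assms unfolding distal_functions_def by blast
  note X' = compact_systemD[OF X(1)]
  show ?thesis
  proof (rule distal_functions_any_carrier[OF X(1,2) _ X(4)])
    show "a k x0 \<in> topspace X" by (rule X'(4)[OF X(3)])
    show "apply_bcontfun (ltrans k f) n = F (a n (a k x0))" for n
      using X'(6)[OF X(3), of n k] by (simp add: X(5) add.commute)
  qed
qed

section \<open>The spectrum of the algebra of distal functions\<close>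

abbreviation spectrum :: "((int \<Rightarrow>\<^sub>C real) \<Rightarrow> real) topology" where
  "spectrum \<equiv> gelfand_space \<D>"

abbreviation ev :: "int \<Rightarrow> (int \<Rightarrow>\<^sub>C real) \<Rightarrow> real" where
  "ev \<equiv> gelfand_eval \<D>"

abbreviation mult :: "((int \<Rightarrow>\<^sub>C real) \<Rightarrow> real) \<Rightarrow> ((int \<Rightarrow>\<^sub>C real) \<Rightarrow> real) \<Rightarrow> (int \<Rightarrow>\<^sub>C real) \<Rightarrow> real"
    (infixl \<open>\<odot>\<close> 70) where
  "\<phi> \<odot> \<psi> \<equiv> gelfand_mult \<D> \<phi> \<psi>"

abbreviation points :: "((int \<Rightarrow>\<^sub>C real) \<Rightarrow> real) set" where
  "points \<equiv> topspace spectrum"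

lemma points_eq:
  "points = {\<phi> \<in> dual_on \<D>. \<phi> (const_bcontfun 1) = 1 \<and>
     (\<forall>f\<in>\<D>. \<forall>g\<in>\<D>. \<phi> (bmult f g) = \<phi> f * \<phi> g)}"
  by (auto simp: gelfand_space_def dual_on_def PiE_iff dest: extensional_arb)

lemma pointD:
  assumes "\<phi> \<in> points"
  shows "\<phi> \<in> extensional \<D>"
    and "f \<in> \<D> \<Longrightarrow> g \<in> \<D> \<Longrightarrow> \<phi> (f + g) = \<phi> f + \<phi> g"
    and "f \<in> \<D> \<Longrightarrow> \<phi> (c *\<^sub>R f) = c * \<phi> f"
    and "\<phi> (const_bcontfun 1) = 1"
    and "f \<in> \<D> \<Longrightarrow> g \<in> \<D> \<Longrightarrow> \<phi> (bmult f g) = \<phi> f * \<phi> g"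
  using assms by (auto simp: points_eq dual_on_def)

lemma point_diff:
  assumes "\<phi> \<in> points" "f \<in> \<D>" "g \<in> \<D>"
  shows "\<phi> (f - g) = \<phi> f - \<phi> g"
proof -
  have "\<phi> (f + (-1) *\<^sub>R g) = \<phi> f + \<phi> ((-1) *\<^sub>R g)"
    by (rule pointD(2)[OF assms(1,2) distal_scaleR[OF assms(3)]])
  moreover have "\<phi> ((-1) *\<^sub>R g) = (-1) * \<phi> g"
    by (rule pointD(3)[OF assms(1,3)])
  ultimately show ?thesis by simp
qed

lemma point_const:
  assumes "\<phi> \<in> points" shows "\<phi> (const_bcontfun c) = c"
proof -
  have "const_bcontfun c = c *\<^sub>R const_bcontfun (1 :: real)"
    by (rule bcontfun_eqI) simp
  then have "\<phi> (const_bcontfun c) = \<phi> (c *\<^sub>R const_bcontfun 1)" by (rule arg_cong)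
  then show ?thesis using pointD(3)[OF assms, of "const_bcontfun 1" c] pointD(4)[OF assms] by simp
qed

text \<open>Multiplicative functionals are positive because a nonnegative distal function has a distal
  square root.\<close>

lemma point_nonneg:
  assumes \<phi>: "\<phi> \<in> points" and f: "f \<in> \<D>" and "\<And>n. 0 \<le> apply_bcontfun f n"
  shows "0 \<le> \<phi> f"
proof -
  define r where "r = Bcontfun (\<lambda>n. sqrt (apply_bcontfun f n))"
  obtain M where M: "\<And>n. \<bar>apply_bcontfun f n\<bar> \<le> M"
    using bounded_seq_bcontfun[of f] bounded_seqE by metis
  have "\<bar>sqrt (apply_bcontfun f n)\<bar> \<le> sqrt M" for n
    using assms(3)[of n] M[of n] by simp
  then have r: "apply_bcontfun r n = sqrt (apply_bcontfun f n)" for n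
    unfolding r_def by (subst apply_Bcontfun_int) (auto intro: bounded_seqI)
  have "r \<in> \<D>"
    by (rule distal_functions_comp2[OF f f, of "\<lambda>x. sqrt (fst x)"]) (auto intro!: continuous_intros simp: r)
  moreover have "f = bmult r r" by (rule bcontfun_eqI) (simp add: r assms(3))
  ultimately have "\<phi> f = \<phi> r * \<phi> r" using pointD(5)[OF \<phi>] by metis
  then show ?thesis by simp
qed

lemma point_mono:
  assumes "\<phi> \<in> points" "f \<in> \<D>" "g \<in> \<D>"
    "\<And>n. apply_bcontfun f n \<le> apply_bcontfun g n"
  shows "\<phi> f \<le> \<phi> g"
  using point_nonneg[of \<phi> "g - f"] point_diff[of \<phi> g f] assms by auto

lemma abs_point_le:
  assumes "\<phi> \<in> points" "f \<in> \<D>" shows "\<bar>\<phi> f\<bar> \<le> norm f"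
proof -
  have n: "\<bar>apply_bcontfun f n\<bar> \<le> norm f" for n using norm_bounded[of f n] by simp
  have "apply_bcontfun f n \<le> norm f" "- norm f \<le> apply_bcontfun f n" for n
    using n[of n] by linarith+
  then have "\<phi> f \<le> \<phi> (const_bcontfun (norm f))" "\<phi> (const_bcontfun (- norm f)) \<le> \<phi> f"
    using point_mono[OF assms const_distal] point_mono[OF assms(1) const_distal assms(2)] by simp_all
  then show ?thesis using point_const[OF assms(1)] by (simp add: abs_le_iff)
qed

lemma pointI:
  assumes "\<phi> \<in> extensional \<D>"
    and "\<And>f g. f \<in> \<D> \<Longrightarrow> g \<in> \<D> \<Longrightarrow> \<phi> (f + g) = \<phi> f + \<phi> g"
    and "\<And>f c. f \<in> \<D> \<Longrightarrow> \<phi> (c *\<^sub>R f) = c * \<phi> f"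
    and "\<phi> (const_bcontfun 1) = 1"
    and "\<And>f g. f \<in> \<D> \<Longrightarrow> g \<in> \<D> \<Longrightarrow> \<phi> (bmult f g) = \<phi> f * \<phi> g"
    and "\<And>f. f \<in> \<D> \<Longrightarrow> \<bar>\<phi> f\<bar> \<le> norm f"
  shows "\<phi> \<in> points"
  using assms unfolding points_eq dual_on_def by (auto intro!: exI[of _ 1])

lemma ev_apply [simp]: "f \<in> \<D> \<Longrightarrow> ev n f = apply_bcontfun f n"
  by (simp add: gelfand_eval_def)

lemma ev_points [simp]: "ev n \<in> points"
proof (rule pointI)
  show "ev n \<in> extensional \<D>" by (simp add: gelfand_eval_def)
  show "\<bar>ev n f\<bar> \<le> norm f" if "f \<in> \<D>" for f
    using norm_bounded[of f n] that by simp
qed (simp_all add: distal_add distal_scaleR distal_bmult)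

lemma limitin_spectrum:
  "limitin spectrum g z F \<longleftrightarrow>
     z \<in> points \<and> eventually (\<lambda>i. g i \<in> points) F \<and> (\<forall>f\<in>\<D>. ((\<lambda>i. g i f) \<longlongrightarrow> z f) F)"
proof -
  have sub: "spectrum = subtopology (powertop_real \<D>) points"
    unfolding points_eq by (simp add: gelfand_space_def)
  have ext: "\<phi> \<in> topspace (powertop_real \<D>)" if "\<phi> \<in> points" for \<phi>
    using pointD(1)[OF that] by (simp add: PiE_iff)
  have "limitin spectrum g z F \<longleftrightarrow>
      limitin (subtopology (powertop_real \<D>) points) g z F"
    using sub by (rule arg_cong)
  also have "\<dots> \<longleftrightarrow> z \<in> points \<and> eventually (\<lambda>i. g i \<in> points) F \<and>
      eventually (\<lambda>i. g i \<in> topspace (powertop_real \<D>)) F \<and>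
      (\<forall>f\<in>\<D>. ((\<lambda>i. g i f) \<longlongrightarrow> z f) F)"
    unfolding limitin_subtopology limitin_componentwise limitin_canonical_iff
    using pointD(1) by blast
  also have "\<dots> \<longleftrightarrow> z \<in> points \<and> eventually (\<lambda>i. g i \<in> points) F \<and>
      (\<forall>f\<in>\<D>. ((\<lambda>i. g i f) \<longlongrightarrow> z f) F)"
    by (auto elim: eventually_mono intro: ext simp del: topspace_product_topology)
  finally show ?thesis .
qed

lemma limitin_spectrumI:
  assumes "z \<in> points" "\<And>i. g i \<in> points" "\<And>f. f \<in> \<D> \<Longrightarrow> ((\<lambda>i. g i f) \<longlongrightarrow> z f) F"
  shows "limitin spectrum g z F"
  using assms by (simp add: limitin_spectrum)

lemma continuous_map_apply:
  "f \<in> \<D> \<Longrightarrow> continuous_map spectrum euclideanreal (\<lambda>\<phi>. \<phi> f)"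
  unfolding gelfand_space_def
  by (intro continuous_map_from_subtopology continuous_map_product_projection)

lemma continuous_map_into_spectrum:
  assumes "\<And>x. x \<in> topspace Y \<Longrightarrow> g x \<in> points"
    "\<And>f. f \<in> \<D> \<Longrightarrow> continuous_map Y euclideanreal (\<lambda>x. g x f)"
  shows "continuous_map Y spectrum g"
proof -
  have sub: "spectrum = subtopology (powertop_real \<D>) points"
    unfolding points_eq by (simp add: gelfand_space_def)
  have "continuous_map Y (powertop_real \<D>) g"
    using assms pointD(1) by (auto simp: continuous_map_componentwise)
  then have "continuous_map Y (subtopology (powertop_real \<D>) points) g"
    using assms(1) by (auto simp: continuous_map_in_subtopology)
  then show ?thesis using sub by metis
qed

lemma point_eqI:
  assumes "\<phi> \<in> points" "\<psi> \<in> points" "\<And>f. f \<in> \<D> \<Longrightarrow> \<phi> f = \<psi> f"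
  shows "\<phi> = \<psi>"
  using assms pointD(1) by (metis extensionalityI)

lemma Hausdorff_spectrum: "Hausdorff_space spectrum"
  unfolding gelfand_space_def
  by (intro Hausdorff_space_subtopology) (simp add: Hausdorff_space_product_topology)

text \<open>
  The limit of multiplicative functionals along an ultrafilter exists on each function
  by boundedness, and it inherits the algebraic identities.
\<close>

lemma compact_spectrum: "compact_space spectrum"
proof (rule compact_space_of_ultrafilter_limits)
  fix U assume U: "ultrafilter U" and pts: "eventually (\<lambda>\<phi>. \<phi> \<in> points) U"
  have "\<exists>L. ((\<lambda>\<phi>. \<phi> f) \<longlongrightarrow> L) U" if f: "f \<in> \<D>" for f
  proof (rule ultrafilter_tendsto_bounded[OF U])
    show "eventually (\<lambda>\<phi>. \<bar>\<phi> f\<bar> \<le> norm f) U"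
      using pts by eventually_elim (rule abs_point_le[OF _ f])
  qed
  then obtain l where l: "\<And>f. f \<in> \<D> \<Longrightarrow> ((\<lambda>\<phi>. \<phi> f) \<longlongrightarrow> l f) U" by metis
  define z where "z = restrict l \<D>"
  have lim: "((\<lambda>\<phi>. \<phi> f) \<longlongrightarrow> z f) U" if "f \<in> \<D>" for f
    using l[OF that] that by (simp add: z_def)
  have eq: "x = y" if "(g \<longlongrightarrow> x) U" "(h \<longlongrightarrow> y) U" "\<And>\<phi>. \<phi> \<in> points \<Longrightarrow> g \<phi> = h \<phi>"
    for g h :: "_ \<Rightarrow> real" and x y
  proof -
    have "eventually (\<lambda>\<phi>. g \<phi> = h \<phi>) U" using pts by eventually_elim (rule that(3))
    then have "(h \<longlongrightarrow> x) U" using that(1) by (rule Lim_transform_eventually[rotated])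
    then show ?thesis using that(2) tendsto_unique[OF ultrafilter_neq_bot[OF U]] by blast
  qed
  have "z \<in> points"
  proof (rule pointI)
    show "z \<in> extensional \<D>" by (simp add: z_def)
    fix f assume f: "f \<in> \<D>"
    show "\<bar>z f\<bar> \<le> norm f"
    proof (rule tendsto_upperbound[OF tendsto_rabs[OF lim[OF f]] _ ultrafilter_neq_bot[OF U]])
      show "eventually (\<lambda>\<phi>. \<bar>\<phi> f\<bar> \<le> norm f) U"
        using pts by eventually_elim (rule abs_point_le[OF _ f])
    qed
    show "z (c *\<^sub>R f) = c * z f" for c
      by (rule eq[OF lim tendsto_mult_left[OF lim]]) (auto intro: f pointD)
    fix g assume g: "g \<in> \<D>"
    show "z (f + g) = z f + z g"
      by (rule eq[OF lim tendsto_add[OF lim lim]]) (auto intro: f g pointD)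
    show "z (bmult f g) = z f * z g"
      by (rule eq[OF lim tendsto_mult[OF lim lim]]) (auto intro: f g pointD)
  next
    show "z (const_bcontfun 1) = 1"
      by (rule eq[OF lim tendsto_const]) (auto intro: pointD)
  qed
  then have "limitin spectrum (\<lambda>\<phi>. \<phi>) z U" using pts lim by (simp add: limitin_spectrum)
  then show "\<exists>z. limitin spectrum (\<lambda>\<phi>. \<phi>) z U" by blast
qed

lemma limitin_spectrumD:
  "limitin spectrum g z F \<Longrightarrow> f \<in> \<D> \<Longrightarrow> ((\<lambda>i. g i f) \<longlongrightarrow> z f) F"
  by (simp add: limitin_spectrum)

section \<open>Density of the evaluations\<close>

lemma point_sum_of_squares:
  assumes \<phi>: "\<phi> \<in> points" and "finite J" "J \<subseteq> \<D>"
  shows "\<exists>g\<in>\<D>. \<phi> g = 0 \<and>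
    (\<forall>n. apply_bcontfun g n = (\<Sum>f\<in>J. (apply_bcontfun f n - \<phi> f)\<^sup>2))"
  using assms(2,3)
proof (induction J rule: finite_induct)
  case empty
  show ?case using point_const[OF \<phi>, of 0] const_distal[of 0] by (intro bexI[of _ "const_bcontfun 0"]) auto
next
  case (insert f J)
  then obtain g where g: "g \<in> \<D>" "\<phi> g = 0"
    "\<And>n. apply_bcontfun g n = (\<Sum>f\<in>J. (apply_bcontfun f n - \<phi> f)\<^sup>2)" by auto
  define d where "d = f - const_bcontfun (\<phi> f)"
  have f: "f \<in> \<D>" using insert by blast
  then have d: "d \<in> \<D>" by (simp add: d_def distal_diff)
  have "\<phi> d = 0" using point_diff[OF \<phi> f const_distal] point_const[OF \<phi>] by (simp add: d_def)
  then have "\<phi> (bmult d d + g) = 0"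
    using pointD(2)[OF \<phi> distal_bmult[OF d d] g(1)] pointD(5)[OF \<phi> d d] g(2) by simp
  moreover have "bmult d d + g \<in> \<D>" by (intro distal_add distal_bmult d g)
  moreover have "apply_bcontfun (bmult d d + g) n = (\<Sum>f\<in>insert f J. (apply_bcontfun f n - \<phi> f)\<^sup>2)" for n
    using insert.hyps g(3) by (simp add: d_def power2_eq_square)
  ultimately show ?case by blast
qed

text \<open>
  If no evaluation were close to \<open>\<phi>\<close> on \<open>J\<close>, the sum of the squares of \<open>f - \<phi> f\<close> would be
  bounded below by a positive constant although \<open>\<phi>\<close> annihilates it, contradicting positivity.
\<close>

lemma point_approximation:
  assumes \<phi>: "\<phi> \<in> points" and J: "finite J" "J \<subseteq> \<D>" and e: "0 < e"
  shows "\<exists>n. \<forall>f\<in>J. \<bar>apply_bcontfun f n - \<phi> f\<bar> < e"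
proof (rule ccontr)
  assume no: "\<not> ?thesis"
  obtain g where g: "g \<in> \<D>" "\<phi> g = 0"
    "\<And>n. apply_bcontfun g n = (\<Sum>f\<in>J. (apply_bcontfun f n - \<phi> f)\<^sup>2)"
    using point_sum_of_squares[OF \<phi> J] by blast
  have "e\<^sup>2 \<le> apply_bcontfun g n" for n
  proof -
    obtain f where f: "f \<in> J" "e \<le> \<bar>apply_bcontfun f n - \<phi> f\<bar>" using no by (meson not_less)
    have "e\<^sup>2 \<le> (apply_bcontfun f n - \<phi> f)\<^sup>2"
      using f(2) e by (metis less_imp_le power2_abs power_mono)
    also have "\<dots> \<le> apply_bcontfun g n"
      unfolding g(3) by (rule member_le_sum[OF f(1)]) (use J in auto)
    finally show ?thesis .
  qed
  then have "\<phi> (const_bcontfun (e\<^sup>2)) \<le> \<phi> g"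
    using point_mono[OF \<phi> const_distal g(1)] by simp
  then show False using e g(2) point_const[OF \<phi>] by simp
qed

text \<open>
  This is the density of the evaluations; the ultrafilter plays the role of the net of integers that
  converges to \<open>\<phi>\<close>.
\<close>

lemma point_limit_of_evaluations:
  assumes \<phi>: "\<phi> \<in> points"
  obtains U where "ultrafilter U" "limitin spectrum ev \<phi> U"
proof -
  define B where "B = {(J, e). finite J \<and> J \<subseteq> \<D> \<and> (0::real) < e}"
  define N where "N = (\<lambda>(J, e). {n. \<forall>f\<in>J. \<bar>apply_bcontfun f n - \<phi> f\<bar> < e})"
  \<comment> \<open>The sets of good approximations to \<open>\<phi>\<close> form a filter base.\<close>
  define F where "F = (INF b\<in>B. principal (N b))"
  have "({}, 1) \<in> B" by (simp add: B_def)
  then have B0: "B \<noteq> {}" by blast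
  have base: "\<exists>x\<in>B. principal (N x) \<le> inf (principal (N a)) (principal (N b))"
    if "a \<in> B" "b \<in> B" for a b
  proof -
    obtain J e J' e' where ab: "a = (J, e)" "b = (J', e')" by (metis surj_pair)
    have "(J \<union> J', min e e') \<in> B" using that by (simp add: B_def ab)
    moreover have "N (J \<union> J', min e e') \<subseteq> N a \<inter> N b" by (auto simp: N_def ab)
    ultimately show ?thesis by (metis inf_principal principal_le_iff)
  qed
  have ev: "eventually P F \<longleftrightarrow> (\<exists>b\<in>B. \<forall>n\<in>N b. P n)" for P
    unfolding F_def by (subst eventually_INF_base[OF B0 base]) (simp_all add: eventually_principal)
  have "F \<noteq> bot"
  proof
    assume "F = bot"
    then obtain J e where Je: "(J, e) \<in> B" "N (J, e) = {}" using ev[of "\<lambda>_. False"] by auto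
    then obtain n where "\<forall>f\<in>J. \<bar>apply_bcontfun f n - \<phi> f\<bar> < e"
      using point_approximation[OF \<phi>, of J e] by (auto simp: B_def)
    then show False using Je(2) by (auto simp: N_def)
  qed
  then obtain U where U: "ultrafilter U" "U \<le> F" using ultrafilter_exists_le by blast
  have "((\<lambda>n. ev n f) \<longlongrightarrow> \<phi> f) F" if f: "f \<in> \<D>" for f
  proof (rule tendstoI)
    fix e :: real assume "0 < e"
    then have "({f}, e) \<in> B" using f by (simp add: B_def)
    moreover have "\<forall>n\<in>N ({f}, e). dist (ev n f) (\<phi> f) < e" using f by (simp add: N_def dist_real_def)
    ultimately show "eventually (\<lambda>n. dist (ev n f) (\<phi> f) < e) F" unfolding ev by blast
  qed
  then have "limitin spectrum ev \<phi> U"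
    using U(2) \<phi> by (intro limitin_spectrumI) (auto intro: tendsto_mono)
  then show ?thesis using U(1) that by blast
qed

text \<open>
  A point of the spectrum acts on the coefficients of any compact system based at \<open>x0\<close> as a point of that system:
  the limit \<open>y\<close> of \<open>x0\<close> along the ultrafilter of evaluations that converges to \<open>\<psi>\<close>.
\<close>

lemma point_model:
  assumes Y: "compact_system Y a" and x0: "x0 \<in> topspace Y" and \<psi>: "\<psi> \<in> points"
  shows "\<exists>y\<in>topspace Y. \<forall>G g s. continuous_map Y euclideanreal G \<longrightarrow> g \<in> \<D> \<longrightarrow>
    (\<forall>n. apply_bcontfun g n = G (a n x0)) \<longrightarrow> \<psi> (ltrans s g) = G (a s y)"
proof -
  note Y' = compact_systemD[OF Y]
  obtain U where U: "ultrafilter U" "limitin spectrum ev \<psi> U"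
    using point_limit_of_evaluations[OF \<psi>] by blast
  obtain y where y: "y \<in> topspace Y" "limitin Y (\<lambda>n. a n x0) y U"
    using ultrafilter_limitin_compact_space[OF U(1) Y'(1), of "\<lambda>n. a n x0"] Y'(4)[OF x0] by auto
  have "\<psi> (ltrans s g) = G (a s y)"
    if G: "continuous_map Y euclideanreal G" and g: "g \<in> \<D>" "\<forall>n. apply_bcontfun g n = G (a n x0)"
    for G g s
  proof (rule tendsto_unique[OF ultrafilter_neq_bot[OF U(1)]])
    show "((\<lambda>n. ev n (ltrans s g)) \<longlongrightarrow> \<psi> (ltrans s g)) U"
      by (rule limitin_spectrumD[OF U(2) distal_ltrans[OF g(1)]])
    have "((\<lambda>n. G (a s (a n x0))) \<longlongrightarrow> G (a s y)) U"
      using continuous_map_limit[OF continuous_map_compose[OF Y'(3)[of s] G] y(2)] by (simp add: o_def)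
    then show "((\<lambda>n. ev n (ltrans s g)) \<longlongrightarrow> G (a s y)) U"
      using g Y'(6)[OF x0] by (simp add: distal_ltrans)
  qed
  then show ?thesis using y(1) by blast
qed

section \<open>The spectrum as a right topological semigroup\<close>

text \<open>
  The function \<open>m(f,\<psi>)\<close> of the definition of introversion.
\<close>

definition transfn :: "((int \<Rightarrow>\<^sub>C real) \<Rightarrow> real) \<Rightarrow> (int \<Rightarrow>\<^sub>C real) \<Rightarrow> (int \<Rightarrow>\<^sub>C real)" where
  "transfn \<psi> f = Bcontfun (\<lambda>s. \<psi> (ltrans s f))"

lemma apply_transfn:
  assumes "\<psi> \<in> points" "f \<in> \<D>"
  shows "apply_bcontfun (transfn \<psi> f) s = \<psi> (ltrans s f)"
proof -
  have "\<bar>\<psi> (ltrans s f)\<bar> \<le> norm f" for s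
  proof -
    have "norm (ltrans s f) \<le> norm f" by (rule norm_bound) (use norm_bounded[of f] in simp)
    then show ?thesis using abs_point_le[OF assms(1) distal_ltrans[OF assms(2)], of s] by linarith
  qed
  then have "bounded_seq (\<lambda>s. \<psi> (ltrans s f))" by (rule bounded_seqI)
  then show ?thesis by (simp add: transfn_def apply_Bcontfun_int)
qed

text \<open>
  It is a coefficient of the same system as \<open>f\<close>, based at the point that represents \<open>\<psi>\<close>.
\<close>

lemma transfn_distal:
  assumes \<psi>: "\<psi> \<in> points" and f: "f \<in> \<D>"
  shows "transfn \<psi> f \<in> \<D>"
proof -
  obtain X :: "int set set topology" and a x0 F where
    X: "compact_system X a" "distal_system X a" "x0 \<in> topspace X"
    "continuous_map X euclideanreal F" "\<And>n. apply_bcontfun f n = F (a n x0)"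
    using f unfolding distal_functions_def by blast
  obtain y where y: "y \<in> topspace X" "\<And>s. \<psi> (ltrans s f) = F (a s y)"
    using point_model[OF X(1,3) \<psi>] X(4,5) f by blast
  show ?thesis
    by (rule distal_functions_any_carrier[OF X(1,2) y(1) X(4)]) (simp add: apply_transfn[OF \<psi> f] y(2))
qed

lemma mult_apply: "f \<in> \<D> \<Longrightarrow> (\<phi> \<odot> \<psi>) f = \<phi> (transfn \<psi> f)"
  by (simp add: gelfand_mult_def transfn_def)

lemma mult_points [simp]:
  assumes \<phi>: "\<phi> \<in> points" and \<psi>: "\<psi> \<in> points" shows "\<phi> \<odot> \<psi> \<in> points"
proof (rule pointI)
  show "\<phi> \<odot> \<psi> \<in> extensional \<D>" by (simp add: gelfand_mult_def)
  fix f assume f: "f \<in> \<D>"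
  note T = apply_transfn[OF \<psi>] and TD = transfn_distal[OF \<psi>]
  show "\<bar>(\<phi> \<odot> \<psi>) f\<bar> \<le> norm f"
  proof -
    have "norm (transfn \<psi> f) \<le> norm f"
    proof (rule norm_bound)
      fix s
      have "norm (ltrans s f) \<le> norm f" by (rule norm_bound) (use norm_bounded[of f] in simp)
      then show "norm (apply_bcontfun (transfn \<psi> f) s) \<le> norm f"
        using abs_point_le[OF \<psi> distal_ltrans[OF f], of s] T[OF f] by simp
    qed
    then show ?thesis using abs_point_le[OF \<phi> TD[OF f]] by (simp add: mult_apply f)
  qed
  have "transfn \<psi> (c *\<^sub>R f) = c *\<^sub>R transfn \<psi> f" for c
    using f by (intro bcontfun_eqI)
      (simp add: T distal_scaleR ltrans_scaleR pointD(3)[OF \<psi> distal_ltrans])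
  then show "(\<phi> \<odot> \<psi>) (c *\<^sub>R f) = c * (\<phi> \<odot> \<psi>) f" for c
    by (simp add: mult_apply f distal_scaleR pointD(3)[OF \<phi> TD])
  fix g assume g: "g \<in> \<D>"
  have "transfn \<psi> (f + g) = transfn \<psi> f + transfn \<psi> g"
    using f g by (intro bcontfun_eqI)
      (simp add: T distal_add ltrans_add pointD(2)[OF \<psi> distal_ltrans distal_ltrans])
  then show "(\<phi> \<odot> \<psi>) (f + g) = (\<phi> \<odot> \<psi>) f + (\<phi> \<odot> \<psi>) g"
    by (simp add: mult_apply f g distal_add pointD(2)[OF \<phi> TD TD])
  have "transfn \<psi> (bmult f g) = bmult (transfn \<psi> f) (transfn \<psi> g)"
    using f g by (intro bcontfun_eqI)
      (simp add: T distal_bmult ltrans_bmult pointD(5)[OF \<psi> distal_ltrans distal_ltrans])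
  then show "(\<phi> \<odot> \<psi>) (bmult f g) = (\<phi> \<odot> \<psi>) f * (\<phi> \<odot> \<psi>) g"
    by (simp add: mult_apply f g distal_bmult pointD(5)[OF \<phi> TD TD])
next
  have "transfn \<psi> (const_bcontfun 1) = const_bcontfun 1"
    by (rule bcontfun_eqI) (simp add: apply_transfn[OF \<psi>] ltrans_const point_const[OF \<psi>])
  then show "(\<phi> \<odot> \<psi>) (const_bcontfun 1) = 1"
    by (simp add: mult_apply point_const[OF \<phi>])
qed

lemma ev_mult_apply:
  "\<psi> \<in> points \<Longrightarrow> f \<in> \<D> \<Longrightarrow> (ev n \<odot> \<psi>) f = \<psi> (ltrans n f)"
  by (simp add: mult_apply transfn_distal apply_transfn)

lemma ev_0_mult [simp]: "\<psi> \<in> points \<Longrightarrow> ev 0 \<odot> \<psi> = \<psi>"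
  by (rule point_eqI) (simp_all add: ev_mult_apply)

lemma ev_mult_ev: "ev m \<odot> ev n = ev (m + n)"
  by (rule point_eqI) (simp_all add: ev_mult_apply distal_ltrans)

lemma mult_ev_0 [simp]:
  assumes "\<phi> \<in> points" shows "\<phi> \<odot> ev 0 = \<phi>"
proof (rule point_eqI)
  fix f assume f: "f \<in> \<D>"
  have "transfn (ev 0) f = f"
    by (rule bcontfun_eqI) (simp add: apply_transfn f distal_ltrans)
  then show "(\<phi> \<odot> ev 0) f = \<phi> f" by (simp add: mult_apply f)
qed (use assms in auto)

lemma mult_assoc:
  assumes "\<phi> \<in> points" "\<psi> \<in> points" "\<omega> \<in> points"
  shows "(\<phi> \<odot> \<psi>) \<odot> \<omega> = \<phi> \<odot> (\<psi> \<odot> \<omega>)"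
proof (rule point_eqI)
  fix f assume f: "f \<in> \<D>"
  have "transfn \<psi> (transfn \<omega> f) = transfn (\<psi> \<odot> \<omega>) f"
  proof (rule bcontfun_eqI)
    fix s
    have "ltrans s (transfn \<omega> f) = transfn \<omega> (ltrans s f)"
      by (rule bcontfun_eqI) (simp add: apply_transfn assms f distal_ltrans ltrans_ltrans add.commute)
    then show "apply_bcontfun (transfn \<psi> (transfn \<omega> f)) s = apply_bcontfun (transfn (\<psi> \<odot> \<omega>) f) s"
      by (simp add: apply_transfn assms f transfn_distal mult_apply distal_ltrans)
  qed
  then show "((\<phi> \<odot> \<psi>) \<odot> \<omega>) f = (\<phi> \<odot> (\<psi> \<odot> \<omega>)) f"
    by (simp add: mult_apply f transfn_distal assms)
qed (use assms in auto)

lemma continuous_mult_right: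
  assumes "\<psi> \<in> points" shows "continuous_map spectrum spectrum (\<lambda>\<phi>. \<phi> \<odot> \<psi>)"
  using assms
  by (intro continuous_map_into_spectrum) (auto simp: mult_apply transfn_distal continuous_map_apply)

lemma continuous_ev_mult: "continuous_map spectrum spectrum ((\<odot>) (ev n))"
proof (rule continuous_map_into_spectrum)
  fix f assume f: "f \<in> \<D>"
  show "continuous_map spectrum euclideanreal (\<lambda>\<psi>. (ev n \<odot> \<psi>) f)"
    by (rule continuous_map_eq[OF continuous_map_apply[OF distal_ltrans[OF f]]])
      (simp add: ev_mult_apply f)
qed simp

lemma limitin_mult_right:
  "limitin spectrum g z F \<Longrightarrow> \<psi> \<in> points \<Longrightarrow> limitin spectrum (\<lambda>i. g i \<odot> \<psi>) (z \<odot> \<psi>) F"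
  using continuous_map_limit[OF continuous_mult_right] by (fastforce simp: o_def)

lemma gelfand_action_eq: "gelfand_action \<D> n = (\<odot>) (ev n)"
  by (simp add: gelfand_action_def fun_eq_iff)

section \<open>The spectrum as a minimal distal cascade\<close>

theorem spectrum_compact_system: "compact_system spectrum (gelfand_action \<D>)"
  unfolding gelfand_action_eq[abs_def]
  by (rule compact_systemI)
    (auto simp: compact_spectrum Hausdorff_spectrum continuous_ev_mult ev_mult_ev[symmetric] mult_assoc)

lemma compact_Hausdorff_separation:
  assumes "compact_space Y" "Hausdorff_space Y" "z \<in> topspace Y" "w \<in> topspace Y" "z \<noteq> w"
  shows "\<exists>G. continuous_map Y euclideanreal G \<and> G z \<noteq> G w"
proof -
  have "normal_space Y" using assms compact_Hausdorff_or_regular_imp_normal_space by blast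
  moreover have "closedin Y {z}" "closedin Y {w}" "disjnt {z} {w}"
    using assms by (auto simp: closedin_Hausdorff_singleton)
  ultimately obtain f where "continuous_map Y euclideanreal f \<and> f ` {z} \<subseteq> {0} \<and> f ` {w} \<subseteq> {1}"
    unfolding normal_space_iff_Urysohn_alt by meson
  then show ?thesis by (intro exI[of _ f]) auto
qed

text \<open>
  Let \<open>\<phi>\<close> and \<open>\<psi>\<close> be proximal and let \<open>y\<close> and \<open>w\<close> represent them in a system of which \<open>f\<close> is a
  coefficient.  All continuous functions have the same limit along the orbits of \<open>y\<close> and \<open>w\<close>, so
  \<open>y\<close> and \<open>w\<close> are proximal, hence equal, and \<open>\<phi> f = \<psi> f\<close>.
\<close>

theorem spectrum_distal_system: "distal_system spectrum (gelfand_action \<D>)"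
  unfolding distal_system_def
proof (intro ballI impI notI)
  fix \<phi> \<psi> assume \<phi>: "\<phi> \<in> points" and \<psi>: "\<psi> \<in> points" and ne: "\<phi> \<noteq> \<psi>"
  assume "\<exists>F z. F \<noteq> bot \<and> limitin spectrum (\<lambda>s. gelfand_action \<D> s \<phi>) z F \<and>
    limitin spectrum (\<lambda>s. gelfand_action \<D> s \<psi>) z F"
  then obtain F z where F: "F \<noteq> bot" and lim: "limitin spectrum (\<lambda>s. ev s \<odot> \<phi>) z F"
    "limitin spectrum (\<lambda>s. ev s \<odot> \<psi>) z F"
    unfolding gelfand_action_eq by (elim exE conjE)
  have "\<phi> f = \<psi> f" if f: "f \<in> \<D>" for f
  proof -
    obtain Y :: "int set set topology" and a x0 G where
      Y: "compact_system Y a" "distal_system Y a" "x0 \<in> topspace Y"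
      "continuous_map Y euclideanreal G" "\<And>n. apply_bcontfun f n = G (a n x0)"
      using f unfolding distal_functions_def by blast
    note Y' = compact_systemD[OF Y(1)]
    obtain y where y: "y \<in> topspace Y" "\<And>G g s. continuous_map Y euclideanreal G \<Longrightarrow> g \<in> \<D> \<Longrightarrow>
      (\<forall>n. apply_bcontfun g n = G (a n x0)) \<Longrightarrow> \<phi> (ltrans s g) = G (a s y)"
      using point_model[OF Y(1,3) \<phi>] by blast
    obtain w where w: "w \<in> topspace Y" "\<And>G g s. continuous_map Y euclideanreal G \<Longrightarrow> g \<in> \<D> \<Longrightarrow>
      (\<forall>n. apply_bcontfun g n = G (a n x0)) \<Longrightarrow> \<psi> (ltrans s g) = G (a s w)"
      using point_model[OF Y(1,3) \<psi>] by blast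
    obtain U where U: "ultrafilter U" "U \<le> F" using ultrafilter_exists_le[OF F] by blast
    obtain y' where y': "limitin Y (\<lambda>n. a n y) y' U"
      using ultrafilter_limitin_compact_space[OF U(1) Y'(1), of "\<lambda>n. a n y"] Y'(4)[OF y(1)] by auto
    obtain w' where w': "limitin Y (\<lambda>n. a n w) w' U"
      using ultrafilter_limitin_compact_space[OF U(1) Y'(1), of "\<lambda>n. a n w"] Y'(4)[OF w(1)] by auto
    have "y' = w'"
    proof (rule ccontr)
      assume "y' \<noteq> w'"
      then obtain H where H: "continuous_map Y euclideanreal H" "H y' \<noteq> H w'"
        using compact_Hausdorff_separation[OF Y'(1,2)] limitin_topspace[OF y'] limitin_topspace[OF w'] by blast
      obtain M where M: "\<And>v. v \<in> topspace Y \<Longrightarrow> \<bar>H v\<bar> \<le> M"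
        using continuous_map_compact_bounded[OF Y'(1) H(1)] by metis
      define h where "h = Bcontfun (\<lambda>n. H (a n x0))"
      have h: "apply_bcontfun h n = H (a n x0)" for n
        unfolding h_def by (subst apply_Bcontfun_int) (auto intro!: bounded_seqI M Y'(4) Y(3))
      have hD: "h \<in> \<D>"
        by (rule distal_functions_any_carrier[OF Y(1-3) H(1) h])
      have "H y' = z h"
      proof (rule tendsto_unique[OF ultrafilter_neq_bot[OF U(1)]])
        show "((\<lambda>n. H (a n y)) \<longlongrightarrow> H y') U" using continuous_map_limit[OF H(1) y'] by (simp add: o_def)
        show "((\<lambda>n. H (a n y)) \<longlongrightarrow> z h) U"
          using tendsto_mono[OF U(2) limitin_spectrumD[OF lim(1) hD]] y(2)[OF H(1) hD] h \<phi> hD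
          by (simp add: ev_mult_apply)
      qed
      moreover have "H w' = z h"
      proof (rule tendsto_unique[OF ultrafilter_neq_bot[OF U(1)]])
        show "((\<lambda>n. H (a n w)) \<longlongrightarrow> H w') U" using continuous_map_limit[OF H(1) w'] by (simp add: o_def)
        show "((\<lambda>n. H (a n w)) \<longlongrightarrow> z h) U"
          using tendsto_mono[OF U(2) limitin_spectrumD[OF lim(2) hD]] w(2)[OF H(1) hD] h \<psi> hD
          by (simp add: ev_mult_apply)
      qed
      ultimately show False using H(2) by simp
    qed
    then have "y = w"
      using distal_systemD[OF Y(2) y(1) w(1) ultrafilter_neq_bot[OF U(1)] y'] w' by simp
    then show ?thesis using y(2)[OF Y(4) f, of 0] w(2)[OF Y(4) f, of 0] Y(5) by simp
  qed
  then show False using ne point_eqI[OF \<phi> \<psi>] by blast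
qed

text \<open>
  If \<open>u\<close> is the limit of the evaluations at a net of integers, the hypothesis says that \<open>\<phi>\<close>
  and \<open>\<psi>\<close> are proximal along this net.
\<close>

lemma mult_left_cancel:
  assumes "u \<in> points" "\<phi> \<in> points" "\<psi> \<in> points" "u \<odot> \<phi> = u \<odot> \<psi>"
  shows "\<phi> = \<psi>"
proof -
  obtain U where U: "ultrafilter U" "limitin spectrum ev u U"
    using point_limit_of_evaluations[OF assms(1)] by blast
  show ?thesis
    using distal_systemD[OF spectrum_distal_system assms(2,3) ultrafilter_neq_bot[OF U(1)], of "u \<odot> \<phi>"]
      limitin_mult_right[OF U(2) assms(2)] limitin_mult_right[OF U(2) assms(3)] assms(4)
    by (simp add: gelfand_action_eq)
qed

lemma idempotent_eq_ev_0: "u \<in> points \<Longrightarrow> u \<odot> u = u \<Longrightarrow> u = ev 0"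
  using mult_left_cancel[of u u "ev 0"] by simp

lemma closed_subsemigroup_contains_ev_0:
  assumes "closedin spectrum C" "C \<noteq> {}" "\<And>x y. x \<in> C \<Longrightarrow> y \<in> C \<Longrightarrow> x \<odot> y \<in> C"
  shows "ev 0 \<in> C"
proof -
  obtain u where "u \<in> C" "u \<odot> u = u"
    using ellis_idempotent[OF compact_spectrum Hausdorff_spectrum, where m = "(\<odot>)" and C = C]
      assms mult_assoc continuous_mult_right by blast
  moreover from this have "u \<in> points" using closedin_subset[OF assms(1)] by blast
  ultimately show ?thesis using idempotent_eq_ev_0 by blast
qed

text \<open>
  A closed invariant set is a left ideal, so it contains an idempotent, and the only idempotent is
  the identity.
\<close>

theorem spectrum_minimal_system: "minimal_system spectrum (gelfand_action \<D>)"
  unfolding minimal_system_def gelfand_action_eq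
proof (intro conjI allI impI)
  show "points \<noteq> {}" using ev_points by blast
  fix C assume "closedin spectrum C \<and> C \<noteq> {} \<and> (\<forall>s. (\<odot>) (ev s) ` C \<subseteq> C)"
  then have C: "closedin spectrum C" "C \<noteq> {}" "\<And>s x. x \<in> C \<Longrightarrow> ev s \<odot> x \<in> C" by blast+
  have CX: "C \<subseteq> points" using C(1) by (rule closedin_subset)
  have ideal: "x \<odot> y \<in> C" if x: "x \<in> points" and y: "y \<in> C" for x y
  proof -
    obtain U where U: "ultrafilter U" "limitin spectrum ev x U"
      using point_limit_of_evaluations[OF x] by blast
    have "x \<odot> y \<in> spectrum closure_of C"
      using in_closure_of_limitin[OF limitin_mult_right[OF U(2)] ultrafilter_neq_bot[OF U(1)]] C(3) y CX
      by blast
    then show ?thesis using C(1) closure_of_closedin by blast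
  qed
  then have "ev 0 \<in> C"
    using CX by (intro closed_subsemigroup_contains_ev_0 C) blast+
  then have "x \<in> C" if "x \<in> points" for x using ideal[OF that] that by fastforce
  then show "C = points" using CX by blast
qed

section \<open>Powers of elements of the topological centre\<close>

abbreviation center :: "((int \<Rightarrow>\<^sub>C real) \<Rightarrow> real) set" where
  "center \<equiv> top_center spectrum (gelfand_mult \<D>)"

lemma ev_center: "ev n \<in> center"
  by (simp add: top_center_def continuous_ev_mult)

definition point_power :: "((int \<Rightarrow>\<^sub>C real) \<Rightarrow> real) \<Rightarrow> nat \<Rightarrow> (int \<Rightarrow>\<^sub>C real) \<Rightarrow> real" where
  "point_power s n = ((\<odot>) s ^^ n) (ev 0)"

lemma point_power_0 [simp]: "point_power s 0 = ev 0" and point_power_Suc: "point_power s (Suc n) = s \<odot> point_power s n"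
  by (simp_all add: point_power_def)

lemma point_power_points [simp]: "s \<in> points \<Longrightarrow> point_power s n \<in> points"
  by (induction n) (simp_all add: point_power_Suc)

lemma point_power_add: "s \<in> points \<Longrightarrow> point_power s (m + n) = point_power s m \<odot> point_power s n"
  by (induction m) (simp_all add: point_power_Suc mult_assoc)

lemma point_power_ev_1: "point_power (ev 1) n = ev (int n)"
  by (induction n) (simp_all add: point_power_Suc ev_mult_ev)

text \<open>
  As left multiplication by \<open>s\<close> is continuous, the closure of the positive powers of \<open>s\<close> is
  a subsemigroup.  By the Ellis-Numakura lemma it contains an idempotent, which is the identity.
\<close>

theorem center_power_recurrence:
  assumes "s \<in> center"
  obtains p where "ultrafilter p" "eventually (\<lambda>k. 1 \<le> k) p" "limitin spectrum (point_power s) (ev 0) p"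
proof -
  have s: "s \<in> points" and cont: "continuous_map spectrum spectrum ((\<odot>) s)"
    using assms by (auto simp: top_center_def)
  define C where "C = spectrum closure_of (point_power s ` {1..})"
  have CX: "C \<subseteq> points" unfolding C_def by (rule closure_of_subset_topspace)
  have sub: "point_power s ` {1..} \<subseteq> C" unfolding C_def by (rule closure_of_subset) (use s in auto)
  have sC: "s \<odot> y \<in> C" if "y \<in> C" for y
  proof -
    have "s \<odot> point_power s n \<in> point_power s ` {1..}" for n
      by (intro image_eqI[of _ _ "Suc n"]) (simp_all add: point_power_Suc)
    then have "(\<odot>) s ` (point_power s ` {1..}) \<subseteq> point_power s ` {1..}" by blast
    then have "spectrum closure_of ((\<odot>) s ` (point_power s ` {1..})) \<subseteq> C"
      unfolding C_def by (rule closure_of_mono)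
    then show ?thesis
      using continuous_map_image_closure_subset[OF cont, of "point_power s ` {1..}"] that unfolding C_def by blast
  qed
  have pC: "point_power s n \<odot> y \<in> C" if "y \<in> C" for n y
  proof (induction n)
    case 0
    show ?case using that CX by (metis ev_0_mult point_power_0 subsetD)
  next
    case (Suc n)
    then show ?case using sC that CX s by (simp add: point_power_Suc mult_assoc subset_iff)
  qed
  have "x \<odot> y \<in> C" if x: "x \<in> C" and y: "y \<in> C" for x y
  proof -
    obtain U where U: "ultrafilter U" "limitin spectrum (point_power s) x U"
      using closure_of_limitin[of x spectrum "point_power s" "{1..}"] x unfolding C_def by blast
    have "x \<odot> y \<in> spectrum closure_of C"
      using in_closure_of_limitin[OF limitin_mult_right[OF U(2)] ultrafilter_neq_bot[OF U(1)]] pC y CX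
      by blast
    then show ?thesis unfolding C_def by simp
  qed
  moreover have "C \<noteq> {}" using sub by auto
  moreover have "closedin spectrum C" unfolding C_def by simp
  ultimately have "ev 0 \<in> C" by (intro closed_subsemigroup_contains_ev_0)
  then show ?thesis
    using closure_of_limitin[of "ev 0" spectrum "point_power s" "{1..}"] that unfolding C_def by auto
qed

section \<open>Distal phases\<close>

definition re_part :: "(int \<Rightarrow> complex) \<Rightarrow> (int \<Rightarrow>\<^sub>C real)" where
  "re_part F = Bcontfun (\<lambda>n. Re (F n))"

definition im_part :: "(int \<Rightarrow> complex) \<Rightarrow> (int \<Rightarrow>\<^sub>C real)" where
  "im_part F = Bcontfun (\<lambda>n. Im (F n))"

definition distal_phase :: "(int \<Rightarrow> complex) \<Rightarrow> bool" where
  "distal_phase F \<longleftrightarrow> (\<forall>n. norm (F n) = 1) \<and> re_part F \<in> \<D> \<and> im_part F \<in> \<D>"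

text \<open>
  The complex linear extension of \<open>\<phi>\<close>.
\<close>

definition cval :: "((int \<Rightarrow>\<^sub>C real) \<Rightarrow> real) \<Rightarrow> (int \<Rightarrow> complex) \<Rightarrow> complex" where
  "cval \<phi> F = Complex (\<phi> (re_part F)) (\<phi> (im_part F))"

lemma apply_parts:
  assumes "\<And>n. norm (F n) = 1"
  shows "apply_bcontfun (re_part F) n = Re (F n)" "apply_bcontfun (im_part F) n = Im (F n)"
proof -
  have "bounded_seq (\<lambda>n. Re (F n))" "bounded_seq (\<lambda>n. Im (F n))"
    using abs_Re_le_cmod[of "F _"] abs_Im_le_cmod[of "F _"] assms by (auto intro!: bounded_seqI[of _ 1])
  then show "apply_bcontfun (re_part F) n = Re (F n)" "apply_bcontfun (im_part F) n = Im (F n)"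
    by (simp_all add: re_part_def im_part_def apply_Bcontfun_int)
qed

lemma cval_ev: "distal_phase F \<Longrightarrow> cval (ev n) F = F n"
  by (simp add: cval_def distal_phase_def apply_parts complex_eq_iff)

lemma distal_phase_shift:
  assumes "distal_phase F" shows "distal_phase (\<lambda>k. F (n + k))"
    and "re_part (\<lambda>k. F (n + k)) = ltrans n (re_part F)"
    and "im_part (\<lambda>k. F (n + k)) = ltrans n (im_part F)"
proof -
  have F: "\<And>n. norm (F n) = 1" using assms by (simp add: distal_phase_def)
  show re: "re_part (\<lambda>k. F (n + k)) = ltrans n (re_part F)"
    and im: "im_part (\<lambda>k. F (n + k)) = ltrans n (im_part F)"
    by (rule bcontfun_eqI; simp add: apply_parts F)+
  show "distal_phase (\<lambda>k. F (n + k))"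
    using assms by (simp add: distal_phase_def re im distal_ltrans)
qed

lemma cval_ev_mult:
  "\<psi> \<in> points \<Longrightarrow> distal_phase F \<Longrightarrow> cval (ev n \<odot> \<psi>) F = cval \<psi> (\<lambda>k. F (n + k))"
  by (simp add: cval_def distal_phase_shift ev_mult_apply distal_phase_def)

lemma tendsto_cval:
  "limitin spectrum g z U \<Longrightarrow> distal_phase F \<Longrightarrow> ((\<lambda>i. cval (g i) F) \<longlongrightarrow> cval z F) U"
  unfolding cval_def distal_phase_def by (intro tendsto_Complex limitin_spectrumD) auto

lemma tendsto_phase:
  "limitin spectrum ev \<phi> U \<Longrightarrow> distal_phase F \<Longrightarrow> (F \<longlongrightarrow> cval \<phi> F) U"
  using tendsto_cval[of ev \<phi> U F] by (simp add: cval_ev)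

lemma norm_cval:
  assumes "\<phi> \<in> points" "distal_phase F" shows "norm (cval \<phi> F) = 1"
proof -
  obtain U where U: "ultrafilter U" "limitin spectrum ev \<phi> U"
    using point_limit_of_evaluations[OF assms(1)] by blast
  have "((\<lambda>n. norm (F n)) \<longlongrightarrow> norm (cval \<phi> F)) U"
    by (intro tendsto_norm tendsto_phase U assms)
  then have "((\<lambda>n. 1) \<longlongrightarrow> norm (cval \<phi> F)) U" using assms(2) by (simp add: distal_phase_def)
  then show ?thesis using tendsto_unique[OF ultrafilter_neq_bot[OF U(1)] _ tendsto_const] by blast
qed

text \<open>
  The phase is the second coordinate of the orbit of \<open>(\<zeta>, 1)\<close> under the skew product
  \<open>(z, w) \<mapsto> (\<mu>^2 z, \<mu> z w)\<close> of the torus, whose \<open>n\<close>-th iterate sends \<open>(z, w)\<close> to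
  \<open>(\<mu>^(2n) z, \<mu>^(n^2) z^n w)\<close>.  It is distal: iteration preserves the distance of the first
  coordinates, and, once these agree, that of the second coordinates.
\<close>

lemma quadratic_phase_distal:
  fixes \<mu> \<zeta> :: complex
  assumes \<mu>: "norm \<mu> = 1" and \<zeta>: "norm \<zeta> = 1"
  shows "distal_phase (\<lambda>n. \<mu> powi (n * n) * \<zeta> powi n)"
proof -
  define S where "S = sphere (0::complex) 1 \<times> sphere (0::complex) 1"
  define X where "X = top_of_set S"
  define a where "a n x = (\<mu> powi (2 * n) * fst x, \<mu> powi (n * n) * fst x powi n * snd x)"
    for n :: int and x :: "complex \<times> complex"
  have S: "x \<in> S \<longleftrightarrow> norm (fst x) = 1 \<and> norm (snd x) = 1" for x by (cases x) (simp add: S_def)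
  have top: "topspace X = S" by (simp add: X_def)
  have mu0: "\<mu> \<noteq> 0" using \<mu> by auto
  have norm_mu: "norm (\<mu> powi n) = 1" for n by (simp add: norm_power_int \<mu>)
  have sys: "compact_system X a"
  proof (rule compact_systemI)
    have "compact S" unfolding S_def by (intro compact_Times compact_sphere)
    then show "compact_space X" by (simp add: X_def compact_space_subtopology)
    show "Hausdorff_space X" unfolding X_def by (intro Hausdorff_space_subtopology) simp
    show "continuous_map X X (a n)" for n
    proof -
      have "continuous_on S (a n)"
        unfolding a_def by (intro continuous_intros) (use S in auto)
      moreover have "a n ` S \<subseteq> S" by (auto simp: S a_def norm_mult norm_power_int \<mu>)
      ultimately show ?thesis by (auto simp: X_def continuous_map_in_subtopology)
    qed
    fix x assume "x \<in> topspace X"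
    then have x0: "fst x \<noteq> 0" using S top by auto
    show "a 0 x = x" by (simp add: a_def)
    fix n m :: int
    have "(n + m) * (n + m) = n * n + (2 * m) * n + m * m" by (simp add: algebra_simps)
    then have "\<mu> powi ((n + m) * (n + m)) = \<mu> powi (n * n) * (\<mu> powi (2 * m)) powi n * \<mu> powi (m * m)"
      by (simp only: power_int_add mu0 power_int_mult[symmetric] simp_thms)
    moreover have "fst x powi (n + m) = fst x powi n * fst x powi m"
      using x0 by (simp add: power_int_add)
    moreover have "\<mu> powi (2 * (n + m)) = \<mu> powi (2 * n) * \<mu> powi (2 * m)"
      using mu0 by (simp add: distrib_left power_int_add)
    ultimately show "a (n + m) x = a n (a m x)"
      by (simp add: a_def power_int_mult_distrib mult_ac)
  qed
  have dist: "distal_system X a"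
    unfolding distal_system_def
  proof (intro ballI impI notI)
    fix x y assume xy: "x \<in> topspace X" "y \<in> topspace X" "x \<noteq> y"
    assume "\<exists>F z. F \<noteq> bot \<and> limitin X (\<lambda>s. a s x) z F \<and> limitin X (\<lambda>s. a s y) z F"
    then obtain F z where F: "F \<noteq> bot" and lim: "limitin X (\<lambda>s. a s x) z F" "limitin X (\<lambda>s. a s y) z F"
      by (elim exE conjE)
    have lim': "((\<lambda>s. a s x) \<longlongrightarrow> z) F" "((\<lambda>s. a s y) \<longlongrightarrow> z) F"
      using lim by (auto simp: X_def limitin_subtopology)
    have zero: "d = 0" if "\<And>s. norm (g s) = d" "(g \<longlongrightarrow> 0) F" for g :: "int \<Rightarrow> complex" and d
      using tendsto_unique[OF F tendsto_const, of d] tendsto_norm[OF that(2)] that(1) by simp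
    have "norm (fst x - fst y) = 0"
    proof (rule zero)
      show "((\<lambda>s. fst (a s x) - fst (a s y)) \<longlongrightarrow> 0) F"
        using tendsto_diff[OF tendsto_fst[OF lim'(1)] tendsto_fst[OF lim'(2)]] by simp
      have "fst (a s x) - fst (a s y) = \<mu> powi (2 * s) * (fst x - fst y)" for s
        by (simp add: a_def algebra_simps)
      then show "norm (fst (a s x) - fst (a s y)) = norm (fst x - fst y)" for s
        by (simp add: norm_mult norm_mu)
    qed
    then have fst: "fst x = fst y" by simp
    have "norm (snd x - snd y) = 0"
    proof (rule zero)
      show "((\<lambda>s. snd (a s x) - snd (a s y)) \<longlongrightarrow> 0) F"
        using tendsto_diff[OF tendsto_snd[OF lim'(1)] tendsto_snd[OF lim'(2)]] by simp
      have "snd (a s x) - snd (a s y) = \<mu> powi (s * s) * fst x powi s * (snd x - snd y)" for s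
        by (simp add: a_def fst algebra_simps)
      then show "norm (snd (a s x) - snd (a s y)) = norm (snd x - snd y)" for s
        using xy S top by (simp add: norm_mult norm_power_int \<mu>)
    qed
    then show False using fst xy(3) by (simp add: prod_eq_iff)
  qed
  let ?F = "\<lambda>n. \<mu> powi (n * n) * \<zeta> powi n"
  have F: "norm (?F n) = 1" for n by (simp add: norm_mult norm_power_int \<mu> \<zeta>)
  have base: "(\<zeta>, 1) \<in> topspace X" using S top \<zeta> by simp
  have "re_part ?F \<in> \<D>"
    by (rule distal_functions_any_carrier[OF sys dist base, of "\<lambda>x. Re (snd x)"])
      (auto simp: X_def a_def apply_parts F intro!: continuous_map_from_subtopology continuous_intros)
  moreover have "im_part ?F \<in> \<D>"
    by (rule distal_functions_any_carrier[OF sys dist base, of "\<lambda>x. Im (snd x)"])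
      (auto simp: X_def a_def apply_parts F intro!: continuous_map_from_subtopology continuous_intros)
  ultimately show ?thesis using F by (simp add: distal_phase_def)
qed

lemma linear_phase_distal: "norm \<zeta> = 1 \<Longrightarrow> distal_phase (\<lambda>n. \<zeta> powi n)"
  using quadratic_phase_distal[of 1 \<zeta>] by simp

section \<open>Rotations of infinite order\<close>

definition infinite_order :: "complex \<Rightarrow> bool" where
  "infinite_order \<rho> \<longleftrightarrow> norm \<rho> = 1 \<and> (\<forall>j>0. \<rho> ^ j \<noteq> 1)"

lemma cis_eq_1_iff: "cis a = 1 \<longleftrightarrow> (\<exists>n::int. a = of_int n * (2 * pi))"
proof
  assume "cis a = 1"
  then have "cos a = 1" by (simp add: complex_eq_iff)
  then show "\<exists>n::int. a = of_int n * (2 * pi)" by (auto simp: cos_one_2pi_int mult_ac)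
next
  assume "\<exists>n::int. a = of_int n * (2 * pi)"
  then obtain n :: int where "a = 2 * pi * of_int n" by (auto simp: mult_ac)
  then show "cis a = 1" using cis_multiple_2pi[of "of_int n"] by simp
qed

lemma infinite_order_cis:
  "infinite_order (cis (2 * pi * \<theta>)) \<longleftrightarrow> \<theta> \<notin> \<rat>"
proof -
  have "(\<exists>j>0. cis (2 * pi * \<theta>) ^ j = 1) \<longleftrightarrow> \<theta> \<in> \<rat>"
  proof
    assume "\<exists>j>0. cis (2 * pi * \<theta>) ^ j = 1"
    then obtain j and n :: int where "0 < j" "real j * (2 * pi * \<theta>) = of_int n * (2 * pi)"
      by (auto simp: Complex.DeMoivre cis_eq_1_iff)
    then have "\<theta> = of_int n / real j" by (simp add: field_simps)
    then show "\<theta> \<in> \<rat>" by simp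
  next
    assume "\<theta> \<in> \<rat>"
    then obtain m b where "0 < b" "\<theta> = of_int m / of_int b" by (rule Rats_cases')
    moreover define n where "n = nat b"
    ultimately have "0 < n" "\<theta> = of_int m / of_nat n" by simp_all
    then have "cis (2 * pi * \<theta>) ^ n = 1" by (auto simp: Complex.DeMoivre cis_eq_1_iff intro!: exI[of _ m])
    then show "\<exists>j>0. cis (2 * pi * \<theta>) ^ j = 1" using \<open>0 < n\<close> by blast
  qed
  then show ?thesis by (auto simp: infinite_order_def)
qed

lemma infinite_order_exists: "\<exists>\<mu>. infinite_order \<mu>"
proof -
  have "\<exists>\<theta>::real. \<theta> \<notin> \<rat>"
    using uncountable_UNIV_real countable_rat by (metis UNIV_eq_I)
  then show ?thesis using infinite_order_cis by blast
qed

lemma infinite_order_power: "infinite_order \<rho> \<Longrightarrow> 0 < j \<Longrightarrow> infinite_order (\<rho> ^ j)"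
  by (auto simp: infinite_order_def norm_power simp flip: power_mult)

text \<open>
  Kronecker's theorem in dimension one.
\<close>

lemma infinite_order_dense:
  assumes \<rho>: "infinite_order \<rho>" and \<zeta>: "norm \<zeta> = 1"
  shows "\<zeta> \<in> closure (range (\<lambda>i::nat. \<rho> ^ i))"
proof -
  have polar: "\<exists>\<alpha>. 0 \<le> \<alpha> \<and> \<alpha> \<le> 1 \<and> z = cis (2 * pi * \<alpha>)" if "norm z = 1" for z
  proof (intro exI conjI)
    show "z = cis (2 * pi * (Arg2pi z / (2 * pi)))"
      using complex_norm_eq_1_exp[of z] that by (simp add: cis_conv_exp)
    show "0 \<le> Arg2pi z / (2 * pi)" "Arg2pi z / (2 * pi) \<le> 1"
      using Arg2pi_ge_0[of z] Arg2pi_lt_2pi[of z] by (auto simp: field_simps)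
  qed
  obtain \<theta> where \<theta>: "\<rho> = cis (2 * pi * \<theta>)" using polar \<rho> by (auto simp: infinite_order_def)
  then have irr: "\<theta> \<notin> \<rat>" using \<rho> infinite_order_cis by simp
  obtain \<alpha> where \<alpha>: "0 \<le> \<alpha>" "\<alpha> \<le> 1" "\<zeta> = cis (2 * pi * \<alpha>)" using polar[OF \<zeta>] by blast
  have "isCont (\<lambda>t. cis (2 * pi * t)) \<alpha>"
    unfolding cis_conv_exp by (intro continuous_intros)
  show ?thesis
    unfolding closure_approachable
  proof (intro allI impI)
    fix e :: real assume "0 < e"
    then obtain d where d: "0 < d" "\<And>t. \<bar>t - \<alpha>\<bar> < d \<Longrightarrow> dist (cis (2 * pi * t)) \<zeta> < e"
      using \<open>isCont _ _\<close> unfolding continuous_at_eps_delta \<alpha>(3) by (auto simp: dist_real_def)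
    obtain k where k: "\<bar>frac (real k * \<theta>) - \<alpha>\<bar> < d"
      using Kronecker_approx_1_explicit[OF irr \<alpha>(1,2) d(1)] by blast
    have "\<rho> ^ k = cis (2 * pi * (real_of_int \<lfloor>real k * \<theta>\<rfloor> + frac (real k * \<theta>)))"
      by (simp add: \<theta> Complex.DeMoivre frac_def mult_ac)
    also have "\<dots> = cis (2 * pi * frac (real k * \<theta>))"
      by (simp add: distrib_left flip: cis_mult)
    finally show "\<exists>y\<in>range (\<lambda>i. \<rho> ^ i). dist y \<zeta> < e"
      using d(2)[OF k] by (metis rangeI)
  qed
qed

lemma infinite_order_limit:
  assumes "infinite_order \<rho>" "norm \<zeta> = 1"
  obtains U where "ultrafilter U" "((\<lambda>i::nat. \<rho> ^ i) \<longlongrightarrow> \<zeta>) U"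
  using closure_of_limitin[of \<zeta> euclidean "\<lambda>i::nat. \<rho> ^ i" UNIV] infinite_order_dense[OF assms] by auto

section \<open>Rotation and quadratic phase of a point of the spectrum\<close>

definition \<mu> :: complex where "\<mu> = (SOME \<mu>. infinite_order \<mu>)"

lemma \<mu>: "infinite_order \<mu>" "norm \<mu> = 1" "\<mu> \<noteq> 0" "infinite_order (\<mu>\<^sup>2)"
proof -
  show "infinite_order \<mu>" unfolding \<mu>_def by (rule someI_ex[OF infinite_order_exists])
  then show "infinite_order (\<mu>\<^sup>2)" "norm \<mu> = 1"
    using infinite_order_power[of \<mu> 2] by (simp_all add: infinite_order_def)
  then show "\<mu> \<noteq> 0" by auto
qed

text \<open>
  A possibly discontinuous character of the circle: the limit of the power maps \<open>\<zeta> \<mapsto> \<zeta>^n\<close>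
  along the integers \<open>n\<close> that converge to \<open>\<phi>\<close>.
\<close>

definition character :: "((int \<Rightarrow>\<^sub>C real) \<Rightarrow> real) \<Rightarrow> complex \<Rightarrow> complex" where
  "character \<phi> \<zeta> = cval \<phi> (\<lambda>n. \<zeta> powi n)"

abbreviation rotation :: "((int \<Rightarrow>\<^sub>C real) \<Rightarrow> real) \<Rightarrow> complex" where
  "rotation \<phi> \<equiv> character \<phi> (\<mu>\<^sup>2)"

text \<open>
  The rotation and the quadratic phase of \<open>\<phi>\<close> are the coordinates of the point of the torus that represents
  \<open>\<phi>\<close> in the skew product with base point \<open>(1, 1)\<close>.
\<close>

definition quadratic :: "((int \<Rightarrow>\<^sub>C real) \<Rightarrow> real) \<Rightarrow> complex" where
  "quadratic \<phi> = cval \<phi> (\<lambda>n. \<mu> powi (n * n))"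

lemma quadratic_distal: "distal_phase (\<lambda>n. \<mu> powi (n * n))"
  using quadratic_phase_distal[of \<mu> 1] \<mu> by simp

lemma norm_character: "\<phi> \<in> points \<Longrightarrow> norm \<zeta> = 1 \<Longrightarrow> norm (character \<phi> \<zeta>) = 1"
  unfolding character_def by (intro norm_cval linear_phase_distal)

lemma norm_rotation: "\<phi> \<in> points \<Longrightarrow> norm (rotation \<phi>) = 1"
  using \<mu> by (intro norm_character) (auto simp: norm_power)

lemma norm_quadratic: "\<phi> \<in> points \<Longrightarrow> norm (quadratic \<phi>) = 1"
  unfolding quadratic_def by (intro norm_cval quadratic_distal)

lemma character_mult:
  assumes "\<phi> \<in> points" "norm \<zeta> = 1" "norm \<xi> = 1"
  shows "character \<phi> (\<zeta> * \<xi>) = character \<phi> \<zeta> * character \<phi> \<xi>"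
proof -
  obtain U where U: "ultrafilter U" "limitin spectrum ev \<phi> U"
    using point_limit_of_evaluations[OF assms(1)] by blast
  have "((\<lambda>n. (\<zeta> * \<xi>) powi n) \<longlongrightarrow> character \<phi> (\<zeta> * \<xi>)) U"
    unfolding character_def using assms by (intro tendsto_phase U linear_phase_distal) (simp add: norm_mult)
  moreover have "((\<lambda>n. \<zeta> powi n * \<xi> powi n) \<longlongrightarrow> character \<phi> \<zeta> * character \<phi> \<xi>) U"
    unfolding character_def using assms by (intro tendsto_mult tendsto_phase U linear_phase_distal)
  ultimately show ?thesis
    using tendsto_unique[OF ultrafilter_neq_bot[OF U(1)]] by (simp add: power_int_mult_distrib)
qed

lemma character_power:
  assumes "\<phi> \<in> points" "norm \<zeta> = 1"
  shows "character \<phi> (\<zeta> ^ n) = character \<phi> \<zeta> ^ n"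
proof (induction n)
  case 0
  have "character \<phi> 1 = character \<phi> 1 * character \<phi> 1"
    using character_mult[OF assms(1), of 1 1] by simp
  moreover have "character \<phi> 1 \<noteq> 0" using norm_character[OF assms(1), of 1] by auto
  ultimately show ?case by simp
next
  case (Suc n)
  then show ?case using character_mult[OF assms, of "\<zeta> ^ n"] assms by (simp add: norm_power)
qed

lemma rotation_mult:
  assumes s: "s \<in> points" and \<psi>: "\<psi> \<in> points"
  shows "rotation (s \<odot> \<psi>) = rotation s * rotation \<psi>"
proof -
  let ?F = "\<lambda>n. (\<mu>\<^sup>2) powi n"
  have F: "distal_phase ?F" using \<mu> by (intro linear_phase_distal) (simp add: norm_power)
  obtain U where U: "ultrafilter U" "limitin spectrum ev s U"
    using point_limit_of_evaluations[OF s] by blast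
  obtain V where V: "ultrafilter V" "limitin spectrum ev \<psi> V"
    using point_limit_of_evaluations[OF \<psi>] by blast
  have "cval (ev n \<odot> \<psi>) ?F = ?F n * rotation \<psi>" for n
  proof (rule tendsto_unique[OF ultrafilter_neq_bot[OF V(1)]])
    show "((\<lambda>k. ?F (n + k)) \<longlongrightarrow> cval (ev n \<odot> \<psi>) ?F) V"
      unfolding cval_ev_mult[OF \<psi> F] by (rule tendsto_phase[OF V(2) distal_phase_shift(1)[OF F]])
    have "((\<lambda>k. ?F n * ?F k) \<longlongrightarrow> ?F n * rotation \<psi>) V"
      unfolding character_def by (intro tendsto_mult tendsto_const tendsto_phase V F)
    then show "((\<lambda>k. ?F (n + k)) \<longlongrightarrow> ?F n * rotation \<psi>) V"
      using \<mu> by (simp add: power_int_add)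
  qed
  then have "((\<lambda>n. ?F n * rotation \<psi>) \<longlongrightarrow> rotation (s \<odot> \<psi>)) U"
    using tendsto_cval[OF limitin_mult_right[OF U(2) \<psi>] F] by (simp add: character_def)
  moreover have "((\<lambda>n. ?F n * rotation \<psi>) \<longlongrightarrow> rotation s * rotation \<psi>) U"
    using tendsto_mult[OF tendsto_phase[OF U(2) F] tendsto_const[of "rotation \<psi>"]]
    by (simp add: character_def)
  ultimately show ?thesis using tendsto_unique[OF ultrafilter_neq_bot[OF U(1)]] by blast
qed

text \<open>
  Pass to the limit, first in \<open>k\<close> and then in \<open>n\<close>, in
  \<open>\<mu>^((n+k)^2) = \<mu>^(n^2) (\<mu>^(2k))^n \<mu>^(k^2)\<close>.
\<close>

lemma quadratic_mult:
  assumes s: "s \<in> points" and \<psi>: "\<psi> \<in> points"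
  shows "quadratic (s \<odot> \<psi>) = quadratic s * character s (rotation \<psi>) * quadratic \<psi>"
proof -
  let ?Q = "\<lambda>n. \<mu> powi (n * n)" and ?L = "\<lambda>n. (\<mu>\<^sup>2) powi n" and ?R = "\<lambda>n. rotation \<psi> powi n"
  have L: "distal_phase ?L" using \<mu> by (intro linear_phase_distal) (simp add: norm_power)
  have R: "distal_phase ?R" by (intro linear_phase_distal norm_rotation \<psi>)
  obtain U where U: "ultrafilter U" "limitin spectrum ev s U"
    using point_limit_of_evaluations[OF s] by blast
  obtain V where V: "ultrafilter V" "limitin spectrum ev \<psi> V"
    using point_limit_of_evaluations[OF \<psi>] by blast
  have "cval (ev n \<odot> \<psi>) ?Q = ?Q n * ?R n * quadratic \<psi>" for n
  proof (rule tendsto_unique[OF ultrafilter_neq_bot[OF V(1)]])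
    show "((\<lambda>k. ?Q (n + k)) \<longlongrightarrow> cval (ev n \<odot> \<psi>) ?Q) V"
      unfolding cval_ev_mult[OF \<psi> quadratic_distal]
      by (rule tendsto_phase[OF V(2) distal_phase_shift(1)[OF quadratic_distal]])
    have "((\<lambda>k. ?L k powi n) \<longlongrightarrow> ?R n) V"
      unfolding character_def
      by (intro tendsto_power_int tendsto_phase V L) (use norm_cval[OF \<psi> L] in auto)
    moreover have "(?Q \<longlongrightarrow> quadratic \<psi>) V"
      unfolding quadratic_def by (intro tendsto_phase V quadratic_distal)
    ultimately have "((\<lambda>k. ?Q n * ?L k powi n * ?Q k) \<longlongrightarrow> ?Q n * ?R n * quadratic \<psi>) V"
      by (intro tendsto_mult tendsto_const)
    moreover have "?Q n * ?L k powi n * ?Q k = ?Q (n + k)" for k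
    proof -
      have "(n + k) * (n + k) = n * n + 2 * k * n + k * k" by (simp add: algebra_simps)
      then have "?Q (n + k) = ?Q n * \<mu> powi (2 * k * n) * ?Q k"
        using \<mu>(3) by (simp only: power_int_add simp_thms)
      moreover have "\<mu> powi (2 * k * n) = ?L k powi n"
        by (simp add: power_int_mult)
      ultimately show ?thesis by simp
    qed
    ultimately show "((\<lambda>k. ?Q (n + k)) \<longlongrightarrow> ?Q n * ?R n * quadratic \<psi>) V" by simp
  qed
  then have "((\<lambda>n. ?Q n * ?R n * quadratic \<psi>) \<longlongrightarrow> quadratic (s \<odot> \<psi>)) U"
    using tendsto_cval[OF limitin_mult_right[OF U(2) \<psi>] quadratic_distal] by (simp add: quadratic_def)
  moreover have "((\<lambda>n. ?Q n * ?R n * quadratic \<psi>) \<longlongrightarrow> quadratic s * character s (rotation \<psi>) * quadratic \<psi>) U"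
    unfolding quadratic_def[of s] character_def[of s]
    by (intro tendsto_mult tendsto_const tendsto_phase U R quadratic_distal)
  ultimately show ?thesis using tendsto_unique[OF ultrafilter_neq_bot[OF U(1)]] by blast
qed

lemma rotation_ev: "rotation (ev n) = (\<mu>\<^sup>2) powi n"
  unfolding character_def using \<mu> by (intro cval_ev linear_phase_distal) (simp add: norm_power)

lemma tendsto_rotation: "limitin spectrum g z U \<Longrightarrow> ((\<lambda>i. rotation (g i)) \<longlongrightarrow> rotation z) U"
  unfolding character_def using \<mu> by (intro tendsto_cval linear_phase_distal) (auto simp: norm_power)

lemma rotation_surj:
  assumes "norm \<zeta> = 1" shows "\<exists>x\<in>points. rotation x = \<zeta>"
proof -
  obtain U where U: "ultrafilter U" "((\<lambda>i::nat. (\<mu>\<^sup>2) ^ i) \<longlongrightarrow> \<zeta>) U"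
    using infinite_order_limit[OF \<mu>(4) assms] by blast
  obtain x where x: "x \<in> points" "limitin spectrum (\<lambda>i. ev (int i)) x U"
    using ultrafilter_limitin_compact_space[OF U(1) compact_spectrum, of "\<lambda>i. ev (int i)"] by auto
  have "((\<lambda>i. (\<mu>\<^sup>2) ^ i) \<longlongrightarrow> rotation x) U"
    using tendsto_rotation[OF x(2)] by (simp add: rotation_ev)
  then show ?thesis using x(1) U tendsto_unique[OF ultrafilter_neq_bot[OF U(1)]] by blast
qed

text \<open>
  By \<open>quadratic_mult\<close>, the function \<open>x \<mapsto> character s (rotation x)\<close> is a quotient of continuous
  functions when left multiplication by \<open>s\<close> is continuous.  So the character of \<open>s\<close>
  is continuous on the circle, and it is trivial as soon as it is trivial on the dense set of powers of
  \<open>\<rho>\<close>.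
\<close>

lemma center_character_trivial:
  assumes s: "s \<in> center" and \<rho>: "infinite_order \<rho>" and one: "character s \<rho> = 1" and \<zeta>: "norm \<zeta> = 1"
  shows "character s \<zeta> = 1"
proof -
  have sp: "s \<in> points" and cont: "continuous_map spectrum spectrum ((\<odot>) s)"
    using s by (auto simp: top_center_def)
  have n\<rho>: "norm \<rho> = 1" using \<rho> by (simp add: infinite_order_def)
  obtain U where U: "ultrafilter U" "((\<lambda>i::nat. \<rho> ^ i) \<longlongrightarrow> \<zeta>) U"
    using infinite_order_limit[OF \<rho> \<zeta>] by blast
  have "\<forall>i. \<exists>x\<in>points. rotation x = \<rho> ^ i"
    using rotation_surj n\<rho> by (simp add: norm_power)
  then obtain x where x: "\<And>i. x i \<in> points" "\<And>i. rotation (x i) = \<rho> ^ i" by metis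
  obtain y where y: "y \<in> points" "limitin spectrum x y U"
    using ultrafilter_limitin_compact_space[OF U(1) compact_spectrum, of x] x(1) by auto
  have "rotation y = \<zeta>"
    using tendsto_unique[OF ultrafilter_neq_bot[OF U(1)] _ U(2)] tendsto_rotation[OF y(2)] x(2) by simp
  have ch: "character s (rotation z) = quadratic (s \<odot> z) / (quadratic s * quadratic z)" if "z \<in> points" for z
  proof -
    have "quadratic s \<noteq> 0" "quadratic z \<noteq> 0"
      using norm_quadratic[OF sp] norm_quadratic[OF that] by auto
    then show ?thesis using quadratic_mult[OF sp that] by simp
  qed
  have q: "((\<lambda>i. quadratic (g i)) \<longlongrightarrow> quadratic z) U" if "limitin spectrum g z U" for g z
    unfolding quadratic_def by (rule tendsto_cval[OF that quadratic_distal])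
  have "((\<lambda>i. character s (rotation (x i))) \<longlongrightarrow> character s (rotation y)) U"
  proof -
    have "quadratic s * quadratic y \<noteq> 0" using norm_quadratic[OF sp] norm_quadratic[OF y(1)] by auto
    moreover have "limitin spectrum (\<lambda>i. s \<odot> x i) (s \<odot> y) U"
      using continuous_map_limit[OF cont y(2)] by (simp add: o_def)
    ultimately have "((\<lambda>i. quadratic (s \<odot> x i) / (quadratic s * quadratic (x i)))
        \<longlongrightarrow> quadratic (s \<odot> y) / (quadratic s * quadratic y)) U"
      by (intro tendsto_divide tendsto_mult tendsto_const q y(2))
    then show ?thesis using ch x(1) y(1) by simp
  qed
  moreover have "character s (rotation (x i)) = 1" for i
    using character_power[OF sp n\<rho>] one x(2) by simp
  ultimately have "((\<lambda>i. 1) \<longlongrightarrow> character s \<zeta>) U" using \<open>rotation y = \<zeta>\<close> by simp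
  then show ?thesis using tendsto_unique[OF ultrafilter_neq_bot[OF U(1)] _ tendsto_const] by blast
qed

lemma center_character_infinite_order:
  assumes s: "s \<in> center" and nt: "rotation s \<noteq> 1" and \<rho>: "infinite_order \<rho>"
  shows "infinite_order (character s \<rho>)"
proof -
  have sp: "s \<in> points" using s by (auto simp: top_center_def)
  have n\<rho>: "norm \<rho> = 1" using \<rho> by (simp add: infinite_order_def)
  have "character s \<rho> ^ j \<noteq> 1" if "0 < j" for j
    using center_character_trivial[OF s infinite_order_power[OF \<rho> that], of "\<mu>\<^sup>2"] nt \<mu>(2)
      character_power[OF sp n\<rho>, of j] by (auto simp: norm_power)
  then show ?thesis using norm_character[OF sp n\<rho>] by (simp add: infinite_order_def)
qed

lemma rotation_point_power: "s \<in> points \<Longrightarrow> rotation (point_power s n) = rotation s ^ n"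
  by (induction n) (simp_all add: point_power_Suc rotation_mult rotation_ev)

section \<open>The quadratic phase obstructs recurrence\<close>

text \<open>
  By \<open>quadratic_mult\<close>, the quadratic phases \<open>q n\<close> of the powers of \<open>s\<close> satisfy
  \<open>q (n + 1) = quadratic s * v^n * q n\<close>; iterate this \<open>k\<close> times.
\<close>

lemma quadratic_point_power:
  assumes s: "s \<in> points"
  defines "v \<equiv> character s (rotation s)"
  shows "\<exists>C. norm C = 1 \<and> (\<forall>n. quadratic (point_power s (n + k)) = C * (v ^ k) ^ n * quadratic (point_power s n))"
proof (induction k)
  case 0
  show ?case by (intro exI[of _ 1]) simp
next
  case (Suc k)
  then obtain C where C: "norm C = 1" "\<And>n. quadratic (point_power s (n + k)) = C * (v ^ k) ^ n * quadratic (point_power s n)"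
    by blast
  have v: "norm v = 1" unfolding v_def by (intro norm_character norm_rotation s)
  have step: "quadratic (point_power s (Suc n)) = quadratic s * v ^ n * quadratic (point_power s n)" for n
    using quadratic_mult[OF s point_power_points[OF s]] character_power[OF s norm_rotation[OF s]]
    by (simp add: point_power_Suc rotation_point_power s v_def)
  have "quadratic (point_power s (n + Suc k)) = (quadratic s * v ^ k * C) * (v ^ Suc k) ^ n * quadratic (point_power s n)" for n
    using step[of "n + k"] C(2)[of n] by (simp add: power_add power_mult_distrib mult_ac)
  moreover have "norm (quadratic s * v ^ k * C) = 1"
    by (simp add: norm_mult norm_power norm_quadratic s v C)
  ultimately show ?case by blast
qed

text \<open>
  The sequence solves \<open>f (n + 2) + f n = 2 Re w f (n + 1)\<close>; take means and use \<open>Re w \<noteq> 1\<close>.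
\<close>

lemma mean_phase:
  assumes w: "norm w = 1" "w \<noteq> 1" and b: "bounded_seq (\<lambda>n. Re (C * w ^ n))"
  shows "mean (\<lambda>n. Re (C * w ^ n)) = 0"
proof -
  let ?f = "\<lambda>n. Re (C * w ^ n)"
  \<comment> \<open>On the unit circle only \<open>1\<close> has real part \<open>1\<close>.\<close>
  have "Re w \<noteq> 1"
  proof
    assume "Re w = 1"
    then have "Im w = 0" using w(1) by (simp add: cmod_def)
    then show False using \<open>Re w = 1\<close> w(2) by (simp add: complex_eq_iff)
  qed
  have "w * w + 1 = 2 * Re w * w"
  proof -
    have "w * cnj w = 1" using w(1) by (simp add: complex_norm_square[symmetric])
    then have "w * w + 1 = w * (w + cnj w)" by (simp add: algebra_simps)
    then show ?thesis by (simp add: complex_add_cnj)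
  qed
  then have "C * w ^ (n + 2) + C * w ^ n = complex_of_real (2 * Re w) * (C * w ^ (n + 1))" for n
  proof -
    assume eq: "w * w + 1 = 2 * Re w * w"
    have "C * w ^ (n + 2) + C * w ^ n = C * w ^ n * (w * w + 1)"
      by (simp add: algebra_simps power2_eq_square)
    also have "\<dots> = complex_of_real (2 * Re w) * (C * w ^ (n + 1))"
      unfolding eq by (simp add: mult_ac)
    finally show ?thesis .
  qed
  then have "Re (C * w ^ (n + 2) + C * w ^ n) = Re (complex_of_real (2 * Re w) * (C * w ^ (n + 1)))" for n
    by (simp only:)
  moreover have "Re (complex_of_real t * z) = t * Re z" for t z by simp
  ultimately have "?f (n + 2) + ?f n = 2 * Re w * ?f (n + 1)" for n
    by (metis plus_complex.sel(1))
  then have "mean (\<lambda>n. ?f (n + 2) + ?f n) = mean (\<lambda>n. 2 * Re w * ?f (n + 1))" by presburger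
  moreover have "mean (\<lambda>n. ?f (n + 2) + ?f n) = 2 * mean ?f"
    using mean_add[OF bounded_seq_reindex[OF b] b, of "\<lambda>n. n + 2"] mean_shift[OF b, of 2] by simp
  moreover have "mean (\<lambda>n. 2 * Re w * ?f (n + 1)) = 2 * Re w * mean ?f"
    using mean_cmult[OF bounded_seq_reindex[OF b], of "2 * Re w" "\<lambda>n. n + 1"] mean_shift[OF b, of 1] by simp
  ultimately show ?thesis using \<open>Re w \<noteq> 1\<close> by simp
qed

text \<open>
  If such a family existed, the real and the imaginary part of the quadratic phase would be
  recurrent in mean square along the powers of \<open>s\<close>.  But two shifts of the phase differ by a
  factor \<open>C w^n\<close> with \<open>w \<noteq> 1\<close>, and so their mean square distance is \<open>2\<close>.
\<close>

theorem no_recurrent_separating_family: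
  assumes s: "s \<in> center" and nt: "rotation s \<noteq> 1"
    and p: "p \<noteq> bot" "eventually (\<lambda>k. 1 \<le> k) p"
    and cont: "\<forall>h\<in>\<H>. continuous_map spectrum euclideanreal h"
    and sep: "\<forall>a\<in>points. \<forall>b\<in>points. a \<noteq> b \<longrightarrow> (\<exists>h\<in>\<H>. h a \<noteq> h b)"
    and rec: "\<forall>h\<in>\<H>. recurrent_in_mean p (\<lambda>n. h (point_power s (Suc n)))"
  shows False
proof -
  have sp: "s \<in> points" using s by (auto simp: top_center_def)
  define v where "v = character s (rotation s)"
  have "infinite_order (rotation s)" using center_character_infinite_order[OF s nt \<mu>(4)] .
  then have v: "infinite_order v" unfolding v_def by (rule center_character_infinite_order[OF s nt])
  define W where "W n = quadratic (point_power s (Suc n))" for n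
  have W1: "norm (W n) = 1" for n unfolding W_def by (simp add: norm_quadratic sp)
  define M where "M g k = mean (\<lambda>n. (g (W (n + k)) - g (W n))\<^sup>2)" for g :: "complex \<Rightarrow> real" and k
  have recG: "recurrent_in_mean p (\<lambda>n. point_power s (Suc n) f)" if "f \<in> \<D>" for f
    using recurrent_in_mean_separating[OF compact_spectrum _ cont sep rec continuous_map_apply[OF that]] sp
    by simp
  have "(M Re \<longlongrightarrow> 0) p" "(M Im \<longlongrightarrow> 0) p"
    using recG quadratic_distal
    by (simp_all add: M_def[abs_def] W_def quadratic_def cval_def distal_phase_def recurrent_in_mean_def)
  then have "((\<lambda>k. M Re k + M Im k) \<longlongrightarrow> 0) p" using tendsto_add_zero by blast
  moreover have "M Re k + M Im k = 2" if k: "1 \<le> k" for k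
  proof -
    obtain C where C: "norm C = 1" "\<And>n. quadratic (point_power s (n + k)) = C * (v ^ k) ^ n * quadratic (point_power s n)"
      using quadratic_point_power[OF sp, of k] unfolding v_def by blast
    define D where "D = C * v ^ k"
    have D: "W (n + k) = D * (v ^ k) ^ n * W n" for n
      using C(2)[of "Suc n"] by (simp add: W_def D_def mult_ac)
    have nv: "norm v = 1" "v ^ k \<noteq> 1" using v k by (auto simp: infinite_order_def)
    have nD: "norm (D * (v ^ k) ^ n) = 1" for n by (simp add: D_def norm_mult norm_power C nv)
    have bR: "bounded_seq (\<lambda>n. Re (W n))" "bounded_seq (\<lambda>n. Im (W n))" "bounded_seq (\<lambda>n. Re (D * (v ^ k) ^ n))"
      using abs_Re_le_cmod abs_Im_le_cmod W1 nD by (metis bounded_seqI)+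
    have sq: "(Re (W (n + k)) - Re (W n))\<^sup>2 + (Im (W (n + k)) - Im (W n))\<^sup>2 = 2 - 2 * Re (D * (v ^ k) ^ n)" for n
    proof -
      have "(Re (W (n + k)) - Re (W n))\<^sup>2 + (Im (W (n + k)) - Im (W n))\<^sup>2 = (norm (W (n + k) - W n))\<^sup>2"
        by (simp add: cmod_power2)
      also have "W (n + k) - W n = (D * (v ^ k) ^ n - 1) * W n" unfolding D by (simp add: algebra_simps)
      also have "(norm \<dots>)\<^sup>2 = (norm (D * (v ^ k) ^ n - 1))\<^sup>2" by (simp add: norm_mult W1)
      also have "\<dots> = (norm (D * (v ^ k) ^ n))\<^sup>2 + 1 - 2 * Re (D * (v ^ k) ^ n)"
        by (simp only: cmod_power2) (simp add: power2_eq_square algebra_simps)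
      finally show ?thesis using nD by simp
    qed
    have "M Re k + M Im k = mean (\<lambda>n. (Re (W (n + k)) - Re (W n))\<^sup>2 + (Im (W (n + k)) - Im (W n))\<^sup>2)"
      unfolding M_def
      by (rule mean_add[symmetric]; intro bounded_seq_power2 bounded_seq_diff bR bounded_seq_reindex[OF bR(1)] bounded_seq_reindex[OF bR(2)])
    also have "\<dots> = mean (\<lambda>n. 2 - 2 * Re (D * (v ^ k) ^ n))" by (simp only: sq)
    also have "\<dots> = 2 - 2 * mean (\<lambda>n. Re (D * (v ^ k) ^ n))"
      using bR(3) by (subst mean_diff) (simp_all only: bounded_seq_const bounded_seq_mult mean_cmult mean_const)
    also have "\<dots> = 2"
      using mean_phase[of "v ^ k" D] nv bR(3) by (simp add: norm_power)
    finally show ?thesis .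
  qed
  then have "eventually (\<lambda>k. M Re k + M Im k = 2) p" using p(2) by (auto elim: eventually_mono)
  then have "((\<lambda>k. M Re k + M Im k) \<longlongrightarrow> 2) p" by (rule tendsto_eventually)
  ultimately show False using tendsto_unique[OF p(1)] by fastforce
qed

lemma rotation_ev_1: "rotation (ev 1) \<noteq> 1"
  using \<mu>(4) by (auto simp: rotation_ev infinite_order_def dest: spec[of _ "1::nat"])

lemma no_recurrent_family_of_distal_functions:
  assumes "limitin spectrum (\<lambda>k. ev (int k)) (ev 0) p" "p \<noteq> bot" "eventually (\<lambda>k. 1 \<le> k) p"
    and "\<forall>h\<in>\<H>. continuous_map spectrum euclideanreal h"
    and "\<forall>a\<in>points. \<forall>b\<in>points. a \<noteq> b \<longrightarrow> (\<exists>h\<in>\<H>. h a \<noteq> h b)"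
    and "\<forall>h\<in>\<H>. recurrent_in_mean p (\<lambda>n. h (ev (int (Suc n))))"
  shows False
  using no_recurrent_separating_family[OF ev_center[of 1] rotation_ev_1 assms(2-5)] assms(6)
  by (simp only: point_power_ev_1)

lemma ev_recurrence:
  obtains p where "ultrafilter p" "eventually (\<lambda>k. 1 \<le> k) p" "limitin spectrum (\<lambda>k. ev (int k)) (ev 0) p"
  using center_power_recurrence[OF ev_center[of 1]] by (auto simp: point_power_ev_1[abs_def])

section \<open>Operator compactifications and introverted spaces\<close>

text \<open>
  The separating family consists of the matrix coefficients \<open>x \<mapsto> \<theta> x \<psi> v\<close>.  For \<open>f(n) = \<psi> (h(n+1) v)\<close>
  the functional \<open>w \<mapsto> mean (f(n) \<psi> (h(n+1) w))\<close> is continuous by equicontinuity, so the operators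
  \<open>h k\<close> converge to the identity on it along \<open>p\<close>.
\<close>

theorem spectrum_not_operator_compactification:
  fixes T :: "'v::real_vector topology" and h :: "int \<Rightarrow> 'v \<Rightarrow> 'v"
  assumes T: "locally_convex_space T" and h: "equicontinuous_corepresentation T h"
    and equiv: "compactification_equiv spectrum ev
      (operator_compactification_space T h) (\<lambda>n. adjoint_operator T (h n))"
  shows False
proof -
  let ?V' = "continuous_dual T" and ?O = "operator_compactification_space T h"
  have lin: "linear (h s)" and h0: "h 0 = id" and hst: "h (s + t) = h t \<circ> h s" for s t
    using h by (auto simp: equicontinuous_corepresentation_def)
  have equi: "\<exists>W. openin T W \<and> 0 \<in> W \<and> (\<forall>s. h s ` W \<subseteq> U)" if "openin T U" "0 \<in> U" for U
    using h that by (auto simp: equicontinuous_corepresentation_def)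
  obtain \<theta> where hom: "homeomorphic_map spectrum ?O \<theta>" and \<theta>: "\<And>n. \<theta> (ev n) = adjoint_operator T (h n)"
    using equiv by (auto simp: compactification_equiv_def)
  have cont\<theta>: "continuous_map spectrum ?O \<theta>" and inj: "inj_on \<theta> points"
    using hom by (auto simp: homeomorphic_map_def quotient_imp_continuous_map)
  have topO: "topspace ?O \<subseteq> extensional ?V'"
    by (auto simp: operator_compactification_space_def dual_operators_def PiE_iff)
  have coord: "continuous_map spectrum euclideanreal (\<lambda>x. \<theta> x \<psi> v)" if \<psi>: "\<psi> \<in> ?V'" for \<psi> v
  proof -
    have "continuous_map ?O (weak_star T) (\<lambda>A. A \<psi>)"
      unfolding operator_compactification_space_def dual_operators_def
      by (intro continuous_map_from_subtopology continuous_map_product_projection \<psi>)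
    moreover have "continuous_map (weak_star T) euclideanreal (\<lambda>f. f v)"
      unfolding weak_star_def by (intro continuous_map_from_subtopology continuous_map_product_projection) simp
    ultimately have "continuous_map spectrum euclideanreal ((\<lambda>f. f v) \<circ> ((\<lambda>A. A \<psi>) \<circ> \<theta>))"
      by (intro continuous_map_compose[OF continuous_map_compose[OF cont\<theta>]])
    then show ?thesis by (simp add: o_def)
  qed
  have ev: "\<theta> (ev n) \<psi> v = \<psi> (h n v)" if "\<psi> \<in> ?V'" for n \<psi> v
    using that by (simp add: \<theta> adjoint_operator_def)
  obtain p where p: "ultrafilter p" "eventually (\<lambda>k. 1 \<le> k) p" "limitin spectrum (\<lambda>k. ev (int k)) (ev 0) p"
    using ev_recurrence by blast
  have lim: "((\<lambda>k. \<psi> (h (int k) v)) \<longlongrightarrow> \<psi> v) p" if "\<psi> \<in> ?V'" for \<psi> v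
    using continuous_map_limit[OF coord[OF that] p(3)] by (simp add: o_def ev that h0)
  define \<H> where "\<H> = {(\<lambda>x. \<theta> x \<psi> v) | \<psi> v. \<psi> \<in> ?V'}"
  show False
  proof (rule no_recurrent_family_of_distal_functions[OF p(3) ultrafilter_neq_bot[OF p(1)] p(2)])
    show "\<forall>g\<in>\<H>. continuous_map spectrum euclideanreal g" using coord by (auto simp: \<H>_def)
    show "\<forall>a\<in>points. \<forall>b\<in>points. a \<noteq> b \<longrightarrow> (\<exists>g\<in>\<H>. g a \<noteq> g b)"
    proof (intro ballI impI, rule ccontr)
      fix a b assume ab: "a \<in> points" "b \<in> points" "a \<noteq> b" and no: "\<not> (\<exists>g\<in>\<H>. g a \<noteq> g b)"
      have "\<theta> a \<psi> v = \<theta> b \<psi> v" if "\<psi> \<in> ?V'" for \<psi> v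
        using no that by (auto simp: \<H>_def)
      then have eq: "\<theta> a \<psi> = \<theta> b \<psi>" if "\<psi> \<in> ?V'" for \<psi>
        using that by (simp add: fun_eq_iff)
      have "\<theta> a \<in> extensional ?V'" "\<theta> b \<in> extensional ?V'"
        using ab topO cont\<theta> by (auto simp: continuous_map_def)
      then have "\<theta> a = \<theta> b" using eq by (rule extensionalityI)
      then show False using ab inj by (simp add: inj_on_def)
    qed
    show "\<forall>g\<in>\<H>. recurrent_in_mean p (\<lambda>n. g (ev (int (Suc n))))"
    proof
      fix g assume "g \<in> \<H>"
      then obtain \<psi> v where \<psi>: "\<psi> \<in> ?V'" and g: "g = (\<lambda>x. \<theta> x \<psi> v)" by (auto simp: \<H>_def)
      define f where "f n = \<psi> (h (int (Suc n)) v)" for n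
      have bd: "bounded_seq (\<lambda>n. \<psi> (h (int (Suc n)) w))" for w
      proof -
        obtain M where "\<forall>x\<in>points. \<bar>\<theta> x \<psi> w\<bar> \<le> M"
          using continuous_map_compact_bounded[OF compact_spectrum coord[OF \<psi>, of w]] by metis
        then have "\<bar>\<theta> (ev (int (Suc n))) \<psi> w\<bar> \<le> M" for n using ev_points by blast
        then show ?thesis unfolding ev[OF \<psi>] by (rule bounded_seqI)
      qed
      obtain M where M: "0 < M" "\<And>n. \<bar>f n\<bar> \<le> M" using bd[of v] bounded_seqE unfolding f_def by metis
      have bf: "bounded_seq f" using M(2) by (rule bounded_seqI)
      have lin\<psi>: "linear \<psi>" and cont\<psi>: "continuous_map T euclideanreal \<psi>"
        using \<psi> by (auto simp: continuous_dual_def)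
      define \<kappa> where "\<kappa> w = mean (\<lambda>n. f n * \<psi> (h (int (Suc n)) w))" for w
      have b: "bounded_seq (\<lambda>n. f n * \<psi> (h (int (Suc n)) w))" for w
        by (intro bounded_seq_mult bf bd)
      have "\<kappa> \<in> ?V'"
      proof -
        have "linear \<kappa>"
        proof (rule linearI)
          show "\<kappa> (x + y) = \<kappa> x + \<kappa> y" for x y
            unfolding \<kappa>_def by (subst mean_add[OF b b, symmetric])
              (simp add: linear_add[OF lin] linear_add[OF lin\<psi>] distrib_left)
          show "\<kappa> (c *\<^sub>R x) = c *\<^sub>R \<kappa> x" for c x
          proof -
            have "\<kappa> (c *\<^sub>R x) = mean (\<lambda>n. c * (f n * \<psi> (h (int (Suc n)) x)))"
              unfolding \<kappa>_def by (simp add: linear_cmul[OF lin] linear_cmul[OF lin\<psi>] mult_ac)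
            also have "\<dots> = c * mean (\<lambda>n. f n * \<psi> (h (int (Suc n)) x))" by (rule mean_cmult[OF b])
            finally show ?thesis by (simp only: \<kappa>_def real_scaleR_def)
          qed
        qed
        moreover have "continuous_map T euclideanreal \<kappa>"
        proof -
          \<comment> \<open>The radius \<open>1 / M\<close> makes the products in the mean bounded by \<open>1\<close>.\<close>
          define U where "U = {w \<in> topspace T. \<psi> w \<in> {-1/M<..<1/M}}"
          have "openin T U" unfolding U_def by (rule openin_continuous_map_preimage[OF cont\<psi>]) simp
          moreover have "0 \<in> U"
            using T M(1) linear_0[OF lin\<psi>] by (simp add: U_def locally_convex_space_def)
          ultimately obtain W where W: "openin T W" "0 \<in> W" "\<And>s. h s ` W \<subseteq> U" using equi by blast
          have "\<kappa> w \<le> 1" if w: "w \<in> W" for w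
          proof -
            have "\<bar>f n * \<psi> (h (int (Suc n)) w)\<bar> \<le> 1" for n
            proof -
              have "h (int (Suc n)) w \<in> U" using W(3) w by blast
              then have "\<bar>\<psi> (h (int (Suc n)) w)\<bar> \<le> 1 / M" unfolding U_def by auto
              then have "\<bar>f n * \<psi> (h (int (Suc n)) w)\<bar> \<le> M * (1 / M)"
                unfolding abs_mult using M by (intro mult_mono) auto
              then show ?thesis using M(1) by simp
            qed
            then have "\<bar>\<kappa> w\<bar> \<le> 1" unfolding \<kappa>_def by (rule abs_mean_le)
            then show ?thesis by simp
          qed
          then show ?thesis by (rule linear_continuous_map_of_bound[OF T \<open>linear \<kappa>\<close> W(1,2)])
        qed
        ultimately show ?thesis by (simp add: continuous_dual_def)
      qed
      from lim[OF this, of v] have "((\<lambda>k. \<kappa> (h (int k) v)) \<longlongrightarrow> \<kappa> v) p" .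
      moreover have "\<kappa> (h (int k) v) = mean (\<lambda>n. f n * f (n + k))" for k
      proof -
        have "h (int (Suc n)) (h (int k) v) = h (int (Suc (n + k))) v" for n
          using hst[of "int k" "int (Suc n)"] by (simp add: add_ac)
        then show ?thesis by (simp only: \<kappa>_def f_def)
      qed
      moreover have "\<kappa> v = mean (\<lambda>n. f n * f n)" by (simp only: \<kappa>_def f_def)
      ultimately have "recurrent_in_mean p f" by (intro recurrent_in_meanI bf) simp
      then show "recurrent_in_mean p (\<lambda>n. g (ev (int (Suc n))))"
        unfolding g ev[OF \<psi>] f_def .
    qed
  qed
qed

lemma closed_unital_subalgebra_hull:
  "closed_unital_subalgebra (closed_unital_subalgebra hull V)"
  by (rule hull_in)
    (auto simp: closed_unital_subalgebra_def unital_subspace_def subspace_def intro: closed_Inter)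

text \<open>
  The separating family consists of the evaluations at members of \<open>V\<close>, which separate points as \<open>V\<close>
  generates the algebra.  For \<open>f\<close> in \<open>V\<close>, introversion applied to the functional \<open>d \<mapsto> mean (f d)\<close>
  says that the correlations of \<open>f\<close> form a distal function of the shift, and distal functions
  converge along \<open>p\<close> to their value at \<open>0\<close>.
\<close>

theorem distal_functions_not_intro_generated: "\<not> intro_generated \<D>"
proof
  assume "intro_generated \<D>"
  then obtain V where V: "introverted V" "V \<subseteq> \<D>"
    and hull: "closed_unital_subalgebra hull V = \<D>"
    by (auto simp: intro_generated_def)
  have closedD: "closed \<D>"
    using closed_unital_subalgebra_hull[of V] by (simp add: hull closed_unital_subalgebra_def)
  have ltransV: "\<And>s f. f \<in> V \<Longrightarrow> ltrans s f \<in> V"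
    and addV: "\<And>f g. f \<in> V \<Longrightarrow> g \<in> V \<Longrightarrow> f + g \<in> V"
    and scaleV: "\<And>f c. f \<in> V \<Longrightarrow> c *\<^sub>R f \<in> V"
    using V(1) by (auto simp: introverted_def unital_subspace_def subspace_def)
  have introV: "\<exists>d\<in>\<D>. \<forall>s. apply_bcontfun d s = \<phi> (ltrans s f)"
    if f: "f \<in> V" and \<phi>: "\<phi> \<in> dual_on V" for f \<phi>
  proof -
    have "(\<lambda>s. \<phi> (ltrans s f)) \<in> apply_bcontfun ` V"
      using V(1) f \<phi> unfolding introverted_def by blast
    then show ?thesis using V(2) by (auto simp: fun_eq_iff)
  qed
  obtain p where p: "ultrafilter p" "eventually (\<lambda>k. 1 \<le> k) p" "limitin spectrum (\<lambda>k. ev (int k)) (ev 0) p"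
    using ev_recurrence by blast
  define \<H> :: "(((int \<Rightarrow>\<^sub>C real) \<Rightarrow> real) \<Rightarrow> real) set" where "\<H> = (\<lambda>f x. x f) ` V"
  show False
  proof (rule no_recurrent_family_of_distal_functions[OF p(3) ultrafilter_neq_bot[OF p(1)] p(2)])
    show "\<forall>h\<in>\<H>. continuous_map spectrum euclideanreal h"
      using V(2) by (auto simp: \<H>_def intro: continuous_map_apply)
    show "\<forall>a\<in>points. \<forall>b\<in>points. a \<noteq> b \<longrightarrow> (\<exists>h\<in>\<H>. h a \<noteq> h b)"
    proof (intro ballI impI, rule ccontr)
      fix a b assume ab: "a \<in> points" "b \<in> points" "a \<noteq> b" and no: "\<not> (\<exists>h\<in>\<H>. h a \<noteq> h b)"
      define E where "E = {f \<in> \<D>. a f = b f}"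
      have "V \<subseteq> E" using no V(2) by (auto simp: \<H>_def E_def)
      moreover have "closed_unital_subalgebra E"
      proof -
        have "closed E"
          unfolding closed_sequential_limits
        proof (intro allI impI)
          fix x l assume xl: "(\<forall>n. x n \<in> E) \<and> x \<longlonglongrightarrow> l"
          then have xD: "\<And>n. x n \<in> \<D>" and xe: "\<And>n. a (x n) = b (x n)"
            by (auto simp: E_def)
          have lD: "l \<in> \<D>"
            using closedD xl xD unfolding closed_sequential_limits by blast
          have "(\<lambda>n. x n - l) \<longlonglongrightarrow> 0" using xl LIM_zero by blast
          then have n0: "(\<lambda>n. norm (x n - l)) \<longlonglongrightarrow> 0" by (rule tendsto_norm_zero)
          have "(\<lambda>n. c (x n)) \<longlonglongrightarrow> c l" if c: "c \<in> points" for c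
          proof (rule LIM_zero_cancel, rule Lim_null_comparison[OF _ n0])
            show "eventually (\<lambda>n. norm (c (x n) - c l) \<le> norm (x n - l)) sequentially"
              using point_diff[OF c xD lD] abs_point_le[OF c distal_diff[OF xD lD]]
              by (auto intro!: always_eventually)
          qed
          from this[OF ab(1)] this[OF ab(2)] have "a l = b l"
            unfolding xe by (rule LIMSEQ_unique)
          then show "l \<in> E" using lD by (simp add: E_def)
        qed
        moreover have "bmult f g \<in> E" if "f \<in> E" "g \<in> E" for f g
          using that ab by (auto simp: E_def pointD(5))
        moreover have "f + g \<in> E" if "f \<in> E" "g \<in> E" for f g
          using that ab by (auto simp: E_def pointD(2))
        moreover have "c *\<^sub>R f \<in> E" if "f \<in> E" for f c
          using that ab by (auto simp: E_def pointD(3))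
        moreover have "const_bcontfun c \<in> E" for c
          using point_const[OF ab(1), of c] point_const[OF ab(2), of c] by (simp add: E_def)
        moreover have "0 \<in> E"
        proof -
          have "const_bcontfun 0 = (0 :: int \<Rightarrow>\<^sub>C real)" by (rule bcontfun_eqI) simp
          then show ?thesis using \<open>\<And>c. const_bcontfun c \<in> E\<close>[of 0] by simp
        qed
        ultimately show ?thesis
          by (simp add: closed_unital_subalgebra_def unital_subspace_def subspace_def)
      qed
      ultimately have "\<D> \<subseteq> E" unfolding hull[symmetric] by (rule hull_minimal)
      then have "a = b" using ab by (intro point_eqI) (auto simp: E_def)
      then show False using ab by simp
    qed
    show "\<forall>h\<in>\<H>. recurrent_in_mean p (\<lambda>n. h (ev (int (Suc n))))"
    proof
      fix h assume "h \<in> \<H>"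
      then obtain f where f: "f \<in> V" "h = (\<lambda>x. x f)" by (auto simp: \<H>_def)
      have fD: "f \<in> \<D>" using f V by blast
      define g where "g n = apply_bcontfun f (int (Suc n))" for n
      have bd: "bounded_seq (\<lambda>n. apply_bcontfun d (int (Suc n)))" for d :: "int \<Rightarrow>\<^sub>C real"
        by (rule bounded_seq_reindex[OF bounded_seq_bcontfun])
      have bg: "bounded_seq g" unfolding g_def by (rule bd)
      have b: "bounded_seq (\<lambda>n. g n * apply_bcontfun d (int (Suc n)))" for d
        by (intro bounded_seq_mult bg bd)
      define \<psi> where "\<psi> = restrict (\<lambda>d. mean (\<lambda>n. g n * apply_bcontfun d (int (Suc n)))) V"
      have "\<psi> \<in> dual_on V"
      proof -
        have "\<bar>\<psi> d\<bar> \<le> norm f * norm d" if "d \<in> V" for d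
        proof -
          have "\<bar>g n * apply_bcontfun d (int (Suc n))\<bar> \<le> norm f * norm d" for n
            unfolding abs_mult g_def
            using norm_bounded[of f "int (Suc n)"] norm_bounded[of d "int (Suc n)"]
            by (intro mult_mono) auto
          then have "\<bar>mean (\<lambda>n. g n * apply_bcontfun d (int (Suc n)))\<bar> \<le> norm f * norm d"
            by (rule abs_mean_le)
          then show ?thesis using that by (simp add: \<psi>_def)
        qed
        moreover have "\<psi> (d + d') = \<psi> d + \<psi> d'" if "d \<in> V" "d' \<in> V" for d d'
          using that addV mean_add[OF b b, of d d'] by (simp add: \<psi>_def distrib_left)
        moreover have "\<psi> (c *\<^sub>R d) = c * \<psi> d" if "d \<in> V" for c d
          using that scaleV mean_cmult[OF b, of c d] by (simp add: \<psi>_def mult.left_commute)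
        ultimately show ?thesis by (auto simp: dual_on_def \<psi>_def)
      qed
      then obtain d where d: "d \<in> \<D>" "\<And>s. apply_bcontfun d s = \<psi> (ltrans s f)"
        using introV[OF f(1)] by blast
      have "((\<lambda>k. apply_bcontfun d (int k)) \<longlongrightarrow> apply_bcontfun d 0) p"
        using limitin_spectrumD[OF p(3) d(1)] d(1) by simp
      moreover have "apply_bcontfun d (int k) = mean (\<lambda>n. g n * g (n + k))" for k
        unfolding d(2) \<psi>_def using ltransV[OF f(1)] by (simp add: g_def add_ac)
      moreover have "apply_bcontfun d 0 = mean (\<lambda>n. g n * g n)"
        unfolding d(2) \<psi>_def using f(1) by (simp add: g_def)
      ultimately have "recurrent_in_mean p g" by (intro recurrent_in_meanI bg) simp
      then show "recurrent_in_mean p (\<lambda>n. h (ev (int (Suc n))))"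
        by (simp only: f(2) ev_apply[OF fD] g_def[abs_def])
    qed
  qed
qed

section \<open>Affine compactifications\<close>

text \<open>
  Along \<open>p\<close> the translations of \<open>Q\<close> converge to an element of the enveloping semigroup that restricts to the
  identity of the image of the spectrum.  By \<open>E\<close>-compatibility it is the identity of \<open>Q\<close>, so every
  point of \<open>Q\<close> is recurrent along \<open>p\<close> and the averaging argument for affine systems applies.
\<close>

theorem spectrum_no_E_compatible_affine_compactification:
  fixes T :: "'q::real_vector topology"
  assumes aff: "affine_compactification spectrum (gelfand_action \<D>) T Q b \<alpha>"
    and faithful: "faithful_map spectrum T Q \<alpha>"
    and E: "E_compatible spectrum T Q b \<alpha>"
  shows False
proof -
  let ?Y = "subtopology T Q"
  have T: "locally_convex_space T" and Q: "compactin T Q" "convex Q"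
    and b: "separately_continuous_action ?Y b" "\<And>s. affine_on Q (b s)"
    and \<alpha>: "continuous_map spectrum ?Y \<alpha>" "\<And>s x. x \<in> points \<Longrightarrow> \<alpha> (ev s \<odot> x) = b s (\<alpha> x)"
    using aff by (auto simp: affine_compactification_def gelfand_action_eq)
  have topY: "topspace ?Y = Q" using T by (auto simp: locally_convex_space_def)
  have haus: "Hausdorff_space T" using T by (simp add: locally_convex_space_def)
  then have hausY: "Hausdorff_space ?Y" by (rule Hausdorff_space_subtopology)
  have compY: "compact_space ?Y" using Q(1) by (rule compact_space_subtopology)
  have bc: "\<And>s. continuous_map ?Y ?Y (b s)" and b0: "\<And>q. q \<in> Q \<Longrightarrow> b 0 q = q"
    and badd: "\<And>s t q. q \<in> Q \<Longrightarrow> b (s + t) q = b s (b t q)"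
    and bQ: "\<And>s q. q \<in> Q \<Longrightarrow> b s q \<in> Q"
    using b(1) unfolding separately_continuous_action_def action_on_def topY by blast+
  have \<alpha>Q: "\<alpha> x \<in> Q" if "x \<in> points" for x
    using \<alpha>(1) that topY by (auto simp: continuous_map_def)
  have inj: "inj_on \<alpha> points"
    using faithful by (simp add: faithful_map_def embedding_map_def homeomorphic_map_def)
  obtain p where p: "ultrafilter p" "eventually (\<lambda>k. 1 \<le> k) p" "limitin spectrum (\<lambda>k. ev (int k)) (ev 0) p"
    using ev_recurrence by blast
  have bpow: "(b 1 ^^ k) q = b (int k) q" if "q \<in> Q" for k q
  proof (induction k)
    case 0 then show ?case using b0 that by simp
  next
    case (Suc k) then show ?case using badd[OF that, of 1 "int k"] by simp
  qed
  have lim: "limitin ?Y (\<lambda>k. b (int k) q) q p" if q: "q \<in> Q" for q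
  proof -
    let ?P = "product_topology (\<lambda>_. ?Y) Q"
    define R where "R s = restrict (b s) Q" for s
    have RP: "R s \<in> topspace ?P" for s using bQ by (auto simp: R_def topY simp del: topspace_subtopology)
    have "compact_space ?P" using compY by (simp add: compact_space_product_topology)
    then obtain g where g: "g \<in> topspace ?P" "limitin ?P (\<lambda>k. R (int k)) g p"
      using ultrafilter_limitin_compact_space[OF p(1), of ?P "\<lambda>k. R (int k)"] RP by blast
    have E_eq: "enveloping_semigroup ?Y b = ?P closure_of range R"
      unfolding enveloping_semigroup_def topY R_def ..
    have "g \<in> enveloping_semigroup ?Y b"
      unfolding E_eq by (rule in_closure_of_limitin[OF g(2) ultrafilter_neq_bot[OF p(1)]]) simp
    moreover have "R 0 \<in> enveloping_semigroup ?Y b"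
      unfolding E_eq using closure_of_subset[of "range R" ?P] RP by blast
    moreover have "restrict g (T closure_of (\<alpha> ` points)) = restrict (R 0) (T closure_of (\<alpha> ` points))"
    proof (rule restrict_ext)
      have "compactin T (\<alpha> ` points)"
        using image_compactin[OF _ \<alpha>(1), of points] compact_spectrum
        by (simp add: compact_space_def compactin_subtopology)
      then have "closedin T (\<alpha> ` points)" using haus by (rule compactin_imp_closedin[rotated])
      then have cl: "T closure_of (\<alpha> ` points) = \<alpha> ` points" by (rule closure_of_closedin)
      fix y assume "y \<in> T closure_of (\<alpha> ` points)"
      then obtain x where x: "x \<in> points" "y = \<alpha> x" unfolding cl by blast
      have yQ: "y \<in> Q" using x \<alpha>Q by simp
      have "limitin ?Y (\<lambda>k. R (int k) y) (g y) p"
        using g(2) yQ unfolding limitin_componentwise by blast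
      moreover have "limitin ?Y (\<lambda>k. \<alpha> (ev (int k) \<odot> x)) (\<alpha> (ev 0 \<odot> x)) p"
        using continuous_map_limit[OF \<alpha>(1) limitin_mult_right[OF p(3) x(1)]] by (simp add: o_def)
      ultimately have "g y = \<alpha> (ev 0 \<odot> x)"
        using \<alpha>(2)[OF x(1)] x(2) yQ
        by (intro limitin_Hausdorff_unique[OF _ _ ultrafilter_neq_bot[OF p(1)] hausY]) (auto simp: R_def)
      then show "g y = R 0 y" using x yQ b0 by (simp add: R_def)
    qed
    ultimately have "g = R 0" using E unfolding E_compatible_def inj_on_def by blast
    then have "limitin ?Y (\<lambda>k. R (int k) q) (R 0 q) p"
      using g(2) q unfolding limitin_componentwise by blast
    then show ?thesis using q b0 by (simp add: R_def)
  qed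
  define \<H> where "\<H> = {(\<lambda>x. l (\<alpha> x)) | l. l \<in> continuous_dual T}"
  have lY: "continuous_map ?Y euclideanreal l" if "l \<in> continuous_dual T" for l
    using that by (simp add: continuous_dual_def continuous_map_from_subtopology)
  show False
  proof (rule no_recurrent_family_of_distal_functions[OF p(3) ultrafilter_neq_bot[OF p(1)] p(2)])
    show "\<forall>h\<in>\<H>. continuous_map spectrum euclideanreal h"
      using continuous_map_compose[OF \<alpha>(1) lY] by (auto simp: \<H>_def o_def)
    show "\<forall>x\<in>points. \<forall>y\<in>points. x \<noteq> y \<longrightarrow> (\<exists>h\<in>\<H>. h x \<noteq> h y)"
    proof (intro ballI impI)
      fix x y assume "x \<in> points" "y \<in> points" "x \<noteq> y"
      then have "\<alpha> x \<noteq> \<alpha> y" using inj by (auto simp: inj_on_def)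
      from continuous_dual_separates_points[OF T this] show "\<exists>h\<in>\<H>. h x \<noteq> h y"
        by (auto simp: \<H>_def)
    qed
    show "\<forall>h\<in>\<H>. recurrent_in_mean p (\<lambda>n. h (ev (int (Suc n))))"
    proof
      fix h assume "h \<in> \<H>"
      then obtain l where l: "l \<in> continuous_dual T" "h = (\<lambda>x. l (\<alpha> x))" by (auto simp: \<H>_def)
      have "recurrent_in_mean p (\<lambda>n. l ((b 1 ^^ Suc n) (\<alpha> (ev 0))))"
      proof (rule recurrent_in_mean_affine[OF compY _ bc])
        show "convex (topspace ?Y)" unfolding topY by (rule Q)
        show "affine_map_on (topspace ?Y) (b 1)"
          unfolding topY using b(2)[of 1] by (simp add: affine_on_def affine_map_on_def)
        show "continuous_map ?Y euclideanreal l" by (rule lY[OF l(1)])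
        show "affine_map_on (topspace ?Y) l"
          using l(1) by (auto simp: affine_map_on_def continuous_dual_def linear_add linear_cmul)
        show "limitin ?Y (\<lambda>k. (b 1 ^^ k) (b 1 q)) (b 1 q) p" if "q \<in> topspace ?Y" for q
          using lim[OF bQ[of q 1]] that by (simp add: bpow bQ topY)
        show "\<alpha> (ev 0) \<in> topspace ?Y" using \<alpha>Q topY by simp
      qed
      moreover have "(b 1 ^^ Suc n) (\<alpha> (ev 0)) = \<alpha> (ev (int (Suc n)))" for n
        using \<alpha>(2)[OF ev_points, of "int (Suc n)" 0] bpow[OF \<alpha>Q[OF ev_points], of "Suc n"]
        by (simp add: ev_mult_ev)
      ultimately show "recurrent_in_mean p (\<lambda>n. h (ev (int (Suc n))))" unfolding l(2) by simp
    qed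
  qed
qed

section \<open>The dual ball of a Banach space and its operator semigroup\<close>

lemma topspace_weak_star_ball [simp]: "topspace weak_star_ball = dual_ball"
  by (auto simp: weak_star_ball_def topspace_pullback_topology)

lemma continuous_map_blinfun_apply:
  "continuous_map weak_star_ball (powertop_real UNIV) blinfun_apply"
  unfolding weak_star_ball_def
  using continuous_map_pullback[OF continuous_map_id, of dual_ball blinfun_apply "powertop_real UNIV"]
  by simp

lemma continuous_map_weak_star_apply:
  "continuous_map weak_star_ball euclideanreal (\<lambda>\<psi>. blinfun_apply \<psi> v)"
proof -
  from continuous_map_compose[OF continuous_map_blinfun_apply continuous_map_product_projection[of v UNIV]]
  show ?thesis by (simp add: o_def)
qed

lemma limitin_weak_star_ball:
  "limitin weak_star_ball g z F \<longleftrightarrow>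
     z \<in> dual_ball \<and> eventually (\<lambda>i. g i \<in> dual_ball) F \<and> (\<forall>v. ((\<lambda>i. blinfun_apply (g i) v) \<longlongrightarrow> z v) F)"
proof (intro iffI conjI allI)
  assume lim: "limitin weak_star_ball g z F"
  show "z \<in> dual_ball" using limitin_topspace[OF lim] by simp
  show "eventually (\<lambda>i. g i \<in> dual_ball) F"
    using limitinD[OF lim openin_topspace] \<open>z \<in> dual_ball\<close> by simp
  show "((\<lambda>i. blinfun_apply (g i) v) \<longlongrightarrow> z v) F" for v
    using continuous_map_limit[OF continuous_map_weak_star_apply lim] by (simp add: o_def)
next
  assume asm: "z \<in> dual_ball \<and> eventually (\<lambda>i. g i \<in> dual_ball) F \<and>
    (\<forall>v. ((\<lambda>i. blinfun_apply (g i) v) \<longlongrightarrow> z v) F)"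
  then have lim: "limitin (powertop_real UNIV) (\<lambda>i. blinfun_apply (g i)) (blinfun_apply z) F"
    by (simp add: limitin_componentwise)
  show "limitin weak_star_ball g z F"
    unfolding limitin_def
  proof (intro conjI allI impI)
    show "z \<in> topspace weak_star_ball" using asm by simp
    fix U assume "openin weak_star_ball U \<and> z \<in> U"
    then obtain V where V: "openin (powertop_real UNIV) V" "U = blinfun_apply -` V \<inter> dual_ball" "z \<in> U"
      by (auto simp: weak_star_ball_def openin_pullback_topology)
    then have "eventually (\<lambda>i. blinfun_apply (g i) \<in> V) F" using limitinD[OF lim V(1)] by simp
    moreover have "eventually (\<lambda>i. g i \<in> dual_ball) F" using asm by blast
    ultimately show "eventually (\<lambda>i. g i \<in> U) F"
      by eventually_elim (simp add: V(2))
  qed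
qed

lemma abs_dual_ball_le: "\<psi> \<in> dual_ball \<Longrightarrow> \<bar>blinfun_apply \<psi> v\<bar> \<le> norm v"
  using norm_blinfun[of \<psi> v] mult_right_mono[of "norm \<psi>" 1 "norm v"] by simp

text \<open>
  The Banach-Alaoglu theorem.
\<close>

theorem compact_weak_star_ball: "compact_space weak_star_ball"
proof (rule compact_space_of_ultrafilter_limits)
  fix U :: "('b::banach \<Rightarrow>\<^sub>L real) filter"
  assume U: "ultrafilter U" and "eventually (\<lambda>x. x \<in> topspace weak_star_ball) U"
  then have ev: "eventually (\<lambda>x. x \<in> dual_ball) U" by simp
  note nb = ultrafilter_neq_bot[OF U]
  have "\<exists>L. ((\<lambda>x. blinfun_apply x v) \<longlongrightarrow> L) U" for v
  proof (rule ultrafilter_tendsto_bounded[OF U])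
    show "eventually (\<lambda>x. \<bar>blinfun_apply x v\<bar> \<le> norm v) U"
      using ev by eventually_elim (rule abs_dual_ball_le)
  qed
  then obtain l where l: "\<And>v. ((\<lambda>x. blinfun_apply x v) \<longlongrightarrow> l v) U" by metis
  have bound: "\<bar>l v\<bar> \<le> norm v" for v
  proof (rule tendsto_upperbound[OF tendsto_rabs[OF l] _ nb])
    show "eventually (\<lambda>x. \<bar>blinfun_apply x v\<bar> \<le> norm v) U"
      using ev by eventually_elim (rule abs_dual_ball_le)
  qed
  have "bounded_linear l"
  proof (rule bounded_linear_intro[of _ 1])
    show "l (v + w) = l v + l w" for v w
      using tendsto_unique[OF nb l[of "v + w"]] tendsto_add[OF l[of v] l[of w]] by (simp add: blinfun.add_right)
    show "l (c *\<^sub>R v) = c *\<^sub>R l v" for c v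
      using tendsto_unique[OF nb l[of "c *\<^sub>R v"]] tendsto_mult_left[OF l[of v], of c]
      by (simp add: blinfun.scaleR_right)
    show "norm (l v) \<le> norm v * 1" for v using bound by simp
  qed
  then have ap: "blinfun_apply (Blinfun l) = l" by (rule bounded_linear_Blinfun_apply)
  have "norm (Blinfun l) \<le> 1" by (rule norm_blinfun_bound) (use ap bound in auto)
  then have "limitin weak_star_ball (\<lambda>x. x) (Blinfun l) U"
    using ev l by (simp add: limitin_weak_star_ball ap)
  then show "\<exists>z. limitin weak_star_ball (\<lambda>x. x) z U" by blast
qed

lemma convex_dual_ball: "convex (dual_ball :: ('b::banach \<Rightarrow>\<^sub>L real) set)"
  using convex_cball[of "0 :: 'b \<Rightarrow>\<^sub>L real" 1] by (simp add: cball_def dist_norm)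

lemma Hausdorff_weak_star_ball: "Hausdorff_space weak_star_ball"
  by (rule Hausdorff_space_injective_preimage[OF _ continuous_map_blinfun_apply])
    (auto simp: inj_on_def blinfun_eqI Hausdorff_space_product_topology)

lemma continuous_map_of_ultrafilter_limits:
  assumes "\<And>x U. ultrafilter U \<Longrightarrow> limitin X (\<lambda>x. x) x U \<Longrightarrow> limitin Y f (f x) U"
  shows "continuous_map X Y f"
  unfolding continuous_map_eq_image_closure_subset
proof
  fix S
  show "f \<in> (X closure_of S) \<rightarrow> Y closure_of f ` S"
  proof
    fix x assume "x \<in> X closure_of S"
    then have "x \<in> X closure_of ((\<lambda>x. x) ` S)" by simp
    then obtain U where U: "ultrafilter U" "eventually (\<lambda>x. x \<in> S) U" "limitin X (\<lambda>x. x) x U"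
      by (rule closure_of_limitin)
    have lim: "limitin Y f (f x) U" by (rule assms(1)[OF U(1,3)])
    show "f x \<in> Y closure_of f ` S"
      unfolding in_closure_of
    proof (intro conjI allI impI)
      show "f x \<in> topspace Y" using lim by (rule limitin_topspace)
      fix V assume "f x \<in> V \<and> openin Y V"
      then have "eventually (\<lambda>x. f x \<in> V) U" using limitinD[OF lim] by blast
      with U(2) have "eventually (\<lambda>x. x \<in> S \<and> f x \<in> V) U" by (rule eventually_conj)
      then obtain y where "y \<in> S" "f y \<in> V"
        using eventually_happens'[OF ultrafilter_neq_bot[OF U(1)]] by blast
      then show "\<exists>y. y \<in> f ` S \<and> y \<in> V" by blast
    qed
  qed
qed

abbreviation operators_top :: "(('b::banach \<Rightarrow>\<^sub>L real) \<Rightarrow> ('b \<Rightarrow>\<^sub>L real)) topology" where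
  "operators_top \<equiv> product_topology (\<lambda>_. weak_star_ball) dual_ball"

lemma adjoint_ball_in: "norm T \<le> 1 \<Longrightarrow> adjoint_ball T \<in> topspace operators_top"
proof -
  assume T: "norm T \<le> 1"
  have "norm (\<psi> o\<^sub>L T) \<le> 1" if "norm \<psi> \<le> 1" for \<psi> :: "'a \<Rightarrow>\<^sub>L real"
    using norm_blinfun_compose[of \<psi> T] mult_mono[OF that T] by simp
  then show ?thesis by (auto simp: adjoint_ball_def)
qed

lemma banach_semigroup_topspace:
  "topspace banach_semigroup = operators_top closure_of (adjoint_ball ` {T. norm T \<le> 1})"
  unfolding banach_semigroup_def topspace_subtopology
  by (rule Int_absorb1[OF closure_of_subset_topspace])

lemma compact_banach_semigroup: "compact_space banach_semigroup"
proof -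
  have "compact_space operators_top"
    by (simp add: compact_space_product_topology compact_weak_star_ball)
  then show ?thesis
    unfolding banach_semigroup_def
    by (intro compact_space_subtopology closedin_compact_space) simp_all
qed

lemma banach_semigroupD:
  assumes "\<eta> \<in> topspace banach_semigroup"
  shows "\<eta> \<in> extensional dual_ball" "\<psi> \<in> dual_ball \<Longrightarrow> \<eta> \<psi> \<in> dual_ball"
proof -
  have "\<eta> \<in> topspace operators_top"
    using assms unfolding banach_semigroup_topspace by (rule subsetD[OF closure_of_subset_topspace])
  then have "\<eta> \<in> PiE dual_ball (\<lambda>_. dual_ball)" by simp
  then show "\<eta> \<in> extensional dual_ball" "\<psi> \<in> dual_ball \<Longrightarrow> \<eta> \<psi> \<in> dual_ball"
    by (simp_all only: PiE_iff simp_thms)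
qed

lemma limitin_banach_semigroup:
  assumes "limitin banach_semigroup g \<eta> F" "\<psi> \<in> dual_ball"
  shows "limitin weak_star_ball (\<lambda>i. g i \<psi>) (\<eta> \<psi>) F"
  using assms unfolding banach_semigroup_def limitin_subtopology limitin_componentwise by blast

lemma banach_semigroup_affine:
  assumes "\<eta> \<in> topspace banach_semigroup"
  shows "affine_map_on dual_ball \<eta>"
  unfolding affine_map_on_def
proof (intro ballI)
  fix \<psi> \<psi>' :: "'a \<Rightarrow>\<^sub>L real" and t :: real
  assume \<psi>: "\<psi> \<in> dual_ball" "\<psi>' \<in> dual_ball" and t: "t \<in> {0..1}"
  have "\<eta> \<in> operators_top closure_of ((\<lambda>x. x) ` (adjoint_ball ` {T. norm T \<le> 1}))"
    using assms by (simp add: banach_semigroup_topspace)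
  then obtain U where U: "ultrafilter U" "eventually (\<lambda>x. x \<in> adjoint_ball ` {T. norm T \<le> 1}) U"
    "limitin operators_top (\<lambda>x. x) \<eta> U" by (rule closure_of_limitin)
  let ?c = "(1 - t) *\<^sub>R \<psi> + t *\<^sub>R \<psi>'"
  have c: "?c \<in> dual_ball" using \<psi> t by (intro convexD_alt[OF convex_dual_ball]) auto
  have lim: "((\<lambda>x. blinfun_apply (x \<omega>) v) \<longlongrightarrow> \<eta> \<omega> v) U" if "\<omega> \<in> dual_ball" for \<omega> v
    using U(3) that unfolding limitin_componentwise limitin_weak_star_ball by blast
  show "\<eta> ?c = (1 - t) *\<^sub>R \<eta> \<psi> + t *\<^sub>R \<eta> \<psi>'"
  proof (rule blinfun_eqI)
    fix v
    have "((\<lambda>x. (1 - t) * blinfun_apply (x \<psi>) v + t * blinfun_apply (x \<psi>') v) \<longlongrightarrow>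
        (1 - t) * \<eta> \<psi> v + t * \<eta> \<psi>' v) U"
      by (intro tendsto_add tendsto_mult_left lim \<psi>)
    moreover have "eventually (\<lambda>x. (1 - t) * blinfun_apply (x \<psi>) v + t * blinfun_apply (x \<psi>') v = blinfun_apply (x ?c) v) U"
      using U(2)
    proof eventually_elim
      case (elim x)
      then show ?case using c \<psi> by (auto simp: adjoint_ball_def blinfun.bilinear_simps)
    qed
    ultimately have "((\<lambda>x. blinfun_apply (x ?c) v) \<longlongrightarrow> (1 - t) * \<eta> \<psi> v + t * \<eta> \<psi>' v) U"
      by (rule Lim_transform_eventually)
    then show "\<eta> ?c v = ((1 - t) *\<^sub>R \<eta> \<psi> + t *\<^sub>R \<eta> \<psi>') v"
      using tendsto_unique[OF ultrafilter_neq_bot[OF U(1)] lim[OF c]] by (simp add: blinfun.bilinear_simps)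
  qed
qed

text \<open>
  The operators of rank one \<open>w \<mapsto> \<omega>(w) v\<close> with \<open>norm v \<le> 1\<close> have adjoints that send \<open>\<psi>0\<close> to
  \<open>\<psi>0(v) \<omega>\<close>, and \<open>\<psi>0(v)\<close> comes arbitrarily close to \<open>1\<close>.
\<close>

lemma banach_semigroup_orbit:
  fixes \<psi>0 \<omega> :: "'b::banach \<Rightarrow>\<^sub>L real"
  assumes \<psi>0: "norm \<psi>0 = 1" and \<omega>: "\<omega> \<in> dual_ball"
  shows "\<exists>\<eta>\<in>topspace banach_semigroup. \<eta> \<psi>0 = \<omega>"
proof -
  have "\<exists>v. norm v \<le> 1 \<and> 1 - 1 / real (Suc n) < \<psi>0 v" for n
  proof (rule ccontr)
    assume no: "\<not> ?thesis"
    let ?c = "1 - 1 / real (Suc n)"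
    have le: "\<psi>0 v \<le> ?c" if "norm v \<le> 1" for v using no that by (meson not_less)
    have "norm \<psi>0 \<le> ?c"
    proof (rule norm_blinfun_bound)
      fix x :: 'b
      have "norm ((1 / norm x) *\<^sub>R x) \<le> 1" "norm (- ((1 / norm x) *\<^sub>R x)) \<le> 1" by simp_all
      from le[OF this(1)] le[OF this(2)] have "\<psi>0 x / norm x \<le> ?c" "- \<psi>0 x / norm x \<le> ?c"
        by (simp_all add: blinfun.bilinear_simps)
      then show "norm (\<psi>0 x) \<le> ?c * norm x"
        by (cases "x = 0") (simp_all add: blinfun.bilinear_simps field_simps abs_le_iff)
    qed simp
    then show False using \<psi>0 by simp
  qed
  then obtain v where v: "\<And>n. norm (v n) \<le> 1" "\<And>n. 1 - 1 / real (Suc n) < \<psi>0 (v n)" by metis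
  define A where "A n = Blinfun (\<lambda>w. \<omega> w *\<^sub>R v n)" for n
  have A: "blinfun_apply (A n) w = \<omega> w *\<^sub>R v n" for n w
    unfolding A_def by (subst bounded_linear_Blinfun_apply) (auto intro!: bounded_linear_intros)
  have "norm (A n) \<le> 1" for n
  proof (rule norm_blinfun_bound)
    fix w
    show "norm (A n w) \<le> 1 * norm w"
      using abs_dual_ball_le[OF \<omega>, of w] v(1)[of n] mult_mono[of "\<bar>\<omega> w\<bar>" "norm w" "norm (v n)" 1]
      by (simp add: A)
  qed simp
  then have "adjoint_ball (A n) \<in> topspace banach_semigroup" for n
    unfolding banach_semigroup_topspace
    by (intro subsetD[OF closure_of_subset]) (use adjoint_ball_in in auto)
  then obtain \<eta> where \<eta>: "\<eta> \<in> topspace banach_semigroup"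
    "limitin banach_semigroup (\<lambda>n. adjoint_ball (A n)) \<eta> mean_filter"
    using ultrafilter_limitin_compact_space[OF mean_filter(1) compact_banach_semigroup,
        of "\<lambda>n. adjoint_ball (A n)"] by auto
  have "\<eta> \<psi>0 = \<omega>"
  proof (rule blinfun_eqI)
    fix w
    have "\<psi>0 \<in> dual_ball" using \<psi>0 by simp
    from limitin_banach_semigroup[OF \<eta>(2) this]
    have "((\<lambda>n. blinfun_apply (adjoint_ball (A n) \<psi>0) w) \<longlongrightarrow> \<eta> \<psi>0 w) mean_filter"
      by (simp add: limitin_weak_star_ball)
    then have "((\<lambda>n. \<omega> w * \<psi>0 (v n)) \<longlongrightarrow> \<eta> \<psi>0 w) mean_filter"
      using \<psi>0 by (simp add: adjoint_ball_def A blinfun.bilinear_simps)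
    moreover have "((\<lambda>n. \<psi>0 (v n)) \<longlonglongrightarrow> 1)"
    proof (rule tendsto_sandwich)
      show "eventually (\<lambda>n. 1 - 1 / real (Suc n) \<le> \<psi>0 (v n)) sequentially"
        using v(2) by (auto intro!: always_eventually less_imp_le)
      show "eventually (\<lambda>n. \<psi>0 (v n) \<le> 1) sequentially"
      proof (intro always_eventually allI)
        fix n
        have "\<bar>\<psi>0 (v n)\<bar> \<le> norm (v n)" by (rule abs_dual_ball_le) (use \<psi>0 in simp)
        then show "\<psi>0 (v n) \<le> 1" using v(1)[of n] by linarith
      qed
      have "(\<lambda>n. 1 - 1 / real (Suc n)) \<longlonglongrightarrow> 1 - 0"
        by (intro tendsto_diff tendsto_const LIMSEQ_Suc[OF lim_1_over_n])
      then show "(\<lambda>n. 1 - 1 / real (Suc n)) \<longlonglongrightarrow> 1" by simp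
    qed simp
    then have "((\<lambda>n. \<omega> w * \<psi>0 (v n)) \<longlongrightarrow> \<omega> w * 1) mean_filter"
      using mean_filter(2) by (intro tendsto_mult_left) (rule tendsto_mono)
    ultimately show "\<eta> \<psi>0 w = \<omega> w" using tendsto_unique[OF mean_filter_neq_bot] by fastforce
  qed
  then show ?thesis using \<eta>(1) by blast
qed

text \<open>
  By \<open>banach_semigroup_orbit\<close>, evaluation at a functional \<open>\<psi>0\<close> of norm \<open>1\<close> maps the compact semigroup onto the
  dual ball.  So a convergent ultrafilter on the ball lifts to a convergent one of
  operators, and continuity of left multiplication by \<open>\<sigma>\<close> descends to continuity of \<open>\<sigma>\<close>.
\<close>

lemma top_center_banach_semigroup_continuous:
  fixes \<psi>0 :: "'b::banach \<Rightarrow>\<^sub>L real" and \<sigma> :: "('b \<Rightarrow>\<^sub>L real) \<Rightarrow> ('b \<Rightarrow>\<^sub>L real)"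
  assumes \<sigma>: "\<sigma> \<in> top_center banach_semigroup (compose dual_ball)" and \<psi>0: "norm \<psi>0 = 1"
  shows "continuous_map weak_star_ball weak_star_ball \<sigma>"
proof (rule continuous_map_of_ultrafilter_limits)
  have \<sigma>S: "\<sigma> \<in> topspace banach_semigroup"
    and cont: "continuous_map banach_semigroup banach_semigroup (compose dual_ball \<sigma>)"
    using \<sigma> by (auto simp: top_center_def)
  have b0: "\<psi>0 \<in> dual_ball" using \<psi>0 by simp
  fix x U assume U: "ultrafilter U" and x: "limitin weak_star_ball (\<lambda>x. x) x (U :: ('b \<Rightarrow>\<^sub>L real) filter)"
  have "\<forall>\<omega>. \<exists>\<eta>. \<eta> \<in> topspace banach_semigroup \<and> (\<omega> \<in> dual_ball \<longrightarrow> \<eta> \<psi>0 = \<omega>)"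
  proof
    fix \<omega> :: "'b \<Rightarrow>\<^sub>L real"
    show "\<exists>\<eta>. \<eta> \<in> topspace banach_semigroup \<and> (\<omega> \<in> dual_ball \<longrightarrow> \<eta> \<psi>0 = \<omega>)"
    proof (cases "\<omega> \<in> dual_ball")
      case True
      then show ?thesis using banach_semigroup_orbit[OF \<psi>0 True] by blast
    next
      case False
      then show ?thesis using \<sigma>S by blast
    qed
  qed
  then obtain g where g: "\<And>\<omega>. g \<omega> \<in> topspace banach_semigroup" "\<And>\<omega>. \<omega> \<in> dual_ball \<Longrightarrow> g \<omega> \<psi>0 = \<omega>" by metis
  obtain \<eta> where \<eta>: "\<eta> \<in> topspace banach_semigroup" "limitin banach_semigroup g \<eta> U"
    using ultrafilter_limitin_compact_space[OF U compact_banach_semigroup, of g] g(1) by blast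
  have ev: "eventually (\<lambda>\<omega>. \<omega> \<in> dual_ball) U" using x by (simp add: limitin_weak_star_ball)
  have "limitin weak_star_ball (\<lambda>\<omega>. g \<omega> \<psi>0) (\<eta> \<psi>0) U"
    by (rule limitin_banach_semigroup[OF \<eta>(2) b0])
  then have "limitin weak_star_ball (\<lambda>\<omega>. \<omega>) (\<eta> \<psi>0) U"
    by (rule limitin_transform_eventually[rotated]) (use ev g(2) in \<open>auto elim: eventually_mono\<close>)
  then have eq: "\<eta> \<psi>0 = x"
    using x limitin_Hausdorff_unique[OF _ _ ultrafilter_neq_bot[OF U] Hausdorff_weak_star_ball] by blast
  have "limitin banach_semigroup (\<lambda>\<omega>. compose dual_ball \<sigma> (g \<omega>)) (compose dual_ball \<sigma> \<eta>) U"
    using continuous_map_limit[OF cont \<eta>(2)] by (simp add: o_def)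
  from limitin_banach_semigroup[OF this b0]
  have "limitin weak_star_ball (\<lambda>\<omega>. \<sigma> (g \<omega> \<psi>0)) (\<sigma> x) U"
    using b0 eq by (simp add: compose_def)
  then show "limitin weak_star_ball \<sigma> (\<sigma> x) U"
    by (rule limitin_transform_eventually[rotated]) (use ev g(2) in \<open>auto elim: eventually_mono\<close>)
qed

section \<open>Admissible embeddings\<close>

text \<open>
  Choose \<open>s\<close> in the given dense subsemigroup with nontrivial rotation.  Then \<open>\<sigma> = \<alpha> s\<close> is a continuous affine
  map of the dual ball.  Its powers converge along \<open>p\<close> to \<open>\<alpha> (ev 0)\<close>, an idempotent which fixes the image of
  \<open>\<sigma>\<close> since \<open>ev 0\<close> is the identity of the group.
\<close>

theorem spectrum_no_admissible_embedding:
  fixes \<alpha> :: "((int \<Rightarrow>\<^sub>C real) \<Rightarrow> real) \<Rightarrow> (('b::banach \<Rightarrow>\<^sub>L real) \<Rightarrow> ('b \<Rightarrow>\<^sub>L real))"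
  assumes "admissible_embedding spectrum (gelfand_mult \<D>) banach_semigroup (compose dual_ball) \<alpha>"
  shows False
proof -
  have emb: "embedding_map spectrum banach_semigroup \<alpha>"
    and hom: "\<And>x y. x \<in> points \<Longrightarrow> y \<in> points \<Longrightarrow> \<alpha> (x \<odot> y) = compose dual_ball (\<alpha> x) (\<alpha> y)"
    using assms by (auto simp: admissible_embedding_def)
  obtain S' where S': "S' \<subseteq> center" "spectrum closure_of S' = points"
    "\<alpha> ` S' \<subseteq> top_center banach_semigroup (compose dual_ball)"
    using assms by (auto simp: admissible_embedding_def)
  have cont: "continuous_map spectrum banach_semigroup \<alpha>" and inj: "inj_on \<alpha> points"
    using emb quotient_imp_continuous_map continuous_map_into_fulltopology
    unfolding embedding_map_def homeomorphic_map_def by metis+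
  have \<alpha>S: "\<alpha> x \<in> topspace banach_semigroup" if "x \<in> points" for x
    using cont that by (auto simp: continuous_map_def)
  \<comment> \<open>The Banach space has a nonzero functional: otherwise \<open>\<alpha>\<close> could not be injective.\<close>
  have "\<exists>\<psi>\<in>dual_ball. \<alpha> (ev 0) \<psi> \<noteq> \<alpha> (ev 1) \<psi>"
  proof (rule ccontr)
    assume "\<not> ?thesis"
    then have "\<alpha> (ev 0) = \<alpha> (ev 1)"
      by (intro extensionalityI[OF banach_semigroupD(1)[OF \<alpha>S[OF ev_points]]
            banach_semigroupD(1)[OF \<alpha>S[OF ev_points]]]) blast
    then have "ev 0 = ev 1" using inj by (simp add: inj_on_def)
    then have "rotation (ev 1) = rotation (ev 0)" by simp
    then show False using rotation_ev_1 by (simp add: rotation_ev[of 0])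
  qed
  then obtain \<psi> where "\<psi> \<in> dual_ball" "\<alpha> (ev 0) \<psi> \<noteq> \<alpha> (ev 1) \<psi>" by blast
  then obtain \<omega> :: "'b \<Rightarrow>\<^sub>L real" where "\<omega> \<noteq> 0" by metis
  then have \<psi>0: "norm ((1 / norm \<omega>) *\<^sub>R \<omega>) = 1" by simp
  \<comment> \<open>Otherwise the rotation would be trivial on the closure of \<open>S'\<close>, but it is not at \<open>ev 1\<close>.\<close>
  have "\<exists>s\<in>S'. rotation s \<noteq> 1"
  proof (rule ccontr)
    assume no: "\<not> ?thesis"
    have "ev 1 \<in> spectrum closure_of ((\<lambda>x. x) ` S')" using S'(2) by simp
    then obtain U where U: "ultrafilter U" "eventually (\<lambda>x. x \<in> S') U" "limitin spectrum (\<lambda>x. x) (ev 1) U"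
      by (rule closure_of_limitin)
    have "eventually (\<lambda>x. rotation x = 1) U" using U(2) no by (auto elim: eventually_mono)
    then have "((\<lambda>x. rotation x) \<longlongrightarrow> 1) U" by (rule tendsto_eventually)
    then show False
      using tendsto_unique[OF ultrafilter_neq_bot[OF U(1)] tendsto_rotation[OF U(3)]] rotation_ev_1 by blast
  qed
  then obtain s where s: "s \<in> S'" "rotation s \<noteq> 1" by blast
  have sc: "s \<in> center" using s S' by blast
  then have sp: "s \<in> points" by (simp add: top_center_def)
  define \<sigma> where "\<sigma> = \<alpha> s"
  have \<sigma>c: "continuous_map weak_star_ball weak_star_ball \<sigma>"
    using top_center_banach_semigroup_continuous[OF _ \<psi>0] s(1) S'(3) by (auto simp: \<sigma>_def)
  have \<sigma>S: "\<sigma> \<in> topspace banach_semigroup" unfolding \<sigma>_def by (rule \<alpha>S[OF sp])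
  obtain p where p: "ultrafilter p" "eventually (\<lambda>k. 1 \<le> k) p" "limitin spectrum (point_power s) (ev 0) p"
    using center_power_recurrence[OF sc] by blast
  have pow: "\<alpha> (point_power s (Suc n)) \<psi> = (\<sigma> ^^ Suc n) \<psi>" if "\<psi> \<in> dual_ball" for n \<psi>
  proof (induction n)
    case 0
    then show ?case by (simp add: point_power_Suc sp \<sigma>_def)
  next
    case (Suc n)
    have "\<alpha> (point_power s (Suc (Suc n))) = compose dual_ball \<sigma> (\<alpha> (point_power s (Suc n)))"
      unfolding point_power_Suc[of s "Suc n"] \<sigma>_def by (rule hom[OF sp point_power_points[OF sp]])
    then show ?case using Suc that by (simp add: compose_def)
  qed
  have lim: "limitin weak_star_ball (\<lambda>k. (\<sigma> ^^ k) (\<sigma> \<psi>)) (\<sigma> \<psi>) p" if \<psi>: "\<psi> \<in> dual_ball" for \<psi>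
  proof -
    have "point_power s k \<odot> s = point_power s (Suc k)" for k
      using point_power_add[OF sp, of k 1] by (simp add: point_power_Suc sp)
    then have "limitin spectrum (\<lambda>k. point_power s (Suc k)) s p"
      using limitin_mult_right[OF p(3) sp] sp by simp
    from continuous_map_limit[OF cont this]
    have "limitin banach_semigroup (\<lambda>k. \<alpha> (point_power s (Suc k))) \<sigma> p" by (simp add: o_def \<sigma>_def)
    from limitin_banach_semigroup[OF this \<psi>] show ?thesis
      by (simp only: pow[OF \<psi>] funpow_Suc_right o_apply)
  qed
  define \<H> where "\<H> = {(\<lambda>x. blinfun_apply (\<alpha> x \<psi>) v) | \<psi> v. \<psi> \<in> dual_ball}"
  show False
  proof (rule no_recurrent_separating_family[OF sc s(2) ultrafilter_neq_bot[OF p(1)] p(2)])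
    show "\<forall>h\<in>\<H>. continuous_map spectrum euclideanreal h"
    proof
      fix h assume "h \<in> \<H>"
      then obtain \<psi> v where \<psi>: "\<psi> \<in> dual_ball" "h = (\<lambda>x. blinfun_apply (\<alpha> x \<psi>) v)" by (auto simp: \<H>_def)
      have "continuous_map banach_semigroup weak_star_ball (\<lambda>\<eta>. \<eta> \<psi>)"
        unfolding banach_semigroup_def
        by (intro continuous_map_from_subtopology continuous_map_product_projection \<psi>)
      from continuous_map_compose[OF continuous_map_compose[OF cont this] continuous_map_weak_star_apply]
      show "continuous_map spectrum euclideanreal h" by (simp add: o_def \<psi>)
    qed
    show "\<forall>a\<in>points. \<forall>b\<in>points. a \<noteq> b \<longrightarrow> (\<exists>h\<in>\<H>. h a \<noteq> h b)"
    proof (intro ballI impI, rule ccontr)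
      fix a b assume ab: "a \<in> points" "b \<in> points" "a \<noteq> b" and no: "\<not> (\<exists>h\<in>\<H>. h a \<noteq> h b)"
      have eq: "\<alpha> a \<psi> = \<alpha> b \<psi>" if "\<psi> \<in> dual_ball" for \<psi>
        by (rule blinfun_eqI) (use no that in \<open>auto simp: \<H>_def\<close>)
      have "\<alpha> a = \<alpha> b"
        using banach_semigroupD(1)[OF \<alpha>S[OF ab(1)]] banach_semigroupD(1)[OF \<alpha>S[OF ab(2)]] eq
        by (rule extensionalityI)
      then show False using ab inj by (simp add: inj_on_def)
    qed
    show "\<forall>h\<in>\<H>. recurrent_in_mean p (\<lambda>n. h (point_power s (Suc n)))"
    proof
      fix h assume "h \<in> \<H>"
      then obtain \<psi> v where \<psi>: "\<psi> \<in> dual_ball" "h = (\<lambda>x. blinfun_apply (\<alpha> x \<psi>) v)" by (auto simp: \<H>_def)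
      have "recurrent_in_mean p (\<lambda>n. blinfun_apply ((\<sigma> ^^ Suc n) \<psi>) v)"
      proof (rule recurrent_in_mean_affine[OF compact_weak_star_ball _ \<sigma>c _ continuous_map_weak_star_apply])
        show "affine_map_on (topspace weak_star_ball) \<sigma>" using banach_semigroup_affine[OF \<sigma>S] by simp
        show "affine_map_on (topspace weak_star_ball) (\<lambda>\<psi>. blinfun_apply \<psi> v)"
          by (simp add: affine_map_on_def blinfun.bilinear_simps)
        show "limitin weak_star_ball (\<lambda>k. (\<sigma> ^^ k) (\<sigma> q)) (\<sigma> q) p" if "q \<in> topspace weak_star_ball" for q
          using lim that by simp
      qed (use \<psi> convex_dual_ball in simp_all)
      then show "recurrent_in_mean p (\<lambda>n. h (point_power s (Suc n)))" unfolding \<psi>(2) pow[OF \<psi>(1)] .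
    qed
  qed
qed

section \<open>The universal distal cascade has no linear representation\<close>

theorem theorem5p6:
  shows
    "\<not> (\<exists>(T :: 'v::real_vector topology) (h :: int \<Rightarrow> 'v \<Rightarrow> 'v).
          locally_convex_space T \<and> equicontinuous_corepresentation T h \<and>
          compactification_equiv
            (gelfand_space distal_functions) (gelfand_eval distal_functions)
            (operator_compactification_space T h) (\<lambda>n. adjoint_operator T (h n)))
   \<and> \<not> intro_generated distal_functions
   \<and> (compact_system (gelfand_space distal_functions) (gelfand_action distal_functions) \<and>
      minimal_system (gelfand_space distal_functions) (gelfand_action distal_functions) \<and>
      distal_system (gelfand_space distal_functions) (gelfand_action distal_functions) \<and>
      \<not> (\<exists>(T :: 'q::real_vector topology) Q b \<alpha>.
            affine_compactification
              (gelfand_space distal_functions) (gelfand_action distal_functions) T Q b \<alpha> \<and>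
            faithful_map (gelfand_space distal_functions) T Q \<alpha> \<and>
            E_compatible (gelfand_space distal_functions) T Q b \<alpha>))
   \<and> \<not> (\<exists>\<alpha> :: ((int \<Rightarrow>\<^sub>C real) \<Rightarrow> real) \<Rightarrow> (('b::banach \<Rightarrow>\<^sub>L real) \<Rightarrow> ('b \<Rightarrow>\<^sub>L real)).
          admissible_embedding
            (gelfand_space distal_functions) (gelfand_mult distal_functions)
            banach_semigroup (compose dual_ball) \<alpha>)"
proof (intro conjI notI)
  assume "\<exists>(T :: 'v topology) (h :: int \<Rightarrow> 'v \<Rightarrow> 'v).
    locally_convex_space T \<and> equicontinuous_corepresentation T h \<and>
    compactification_equiv spectrum ev
      (operator_compactification_space T h) (\<lambda>n. adjoint_operator T (h n))"
  then show False using spectrum_not_operator_compactification by blast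
next
  assume "intro_generated distal_functions"
  then show False using distal_functions_not_intro_generated by blast
next
  show "compact_system spectrum (gelfand_action distal_functions)"
    by (rule spectrum_compact_system)
  show "minimal_system spectrum (gelfand_action distal_functions)"
    by (rule spectrum_minimal_system)
  show "distal_system spectrum (gelfand_action distal_functions)"
    by (rule spectrum_distal_system)
next
  assume "\<exists>(T :: 'q topology) Q b \<alpha>.
    affine_compactification spectrum (gelfand_action distal_functions) T Q b \<alpha> \<and>
    faithful_map spectrum T Q \<alpha> \<and> E_compatible spectrum T Q b \<alpha>"
  then show False using spectrum_no_E_compatible_affine_compactification by blast
next
  assume "\<exists>\<alpha> :: ((int \<Rightarrow>\<^sub>C real) \<Rightarrow> real) \<Rightarrow> (('b \<Rightarrow>\<^sub>L real) \<Rightarrow> ('b \<Rightarrow>\<^sub>L real)).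
    admissible_embedding spectrum (gelfand_mult distal_functions)
      banach_semigroup (compose dual_ball) \<alpha>"
  then show False using spectrum_no_admissible_embedding by blast
qed

end
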